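(* Let $N\ge2$, let $Q_1,\dots,Q_N$ be distinct nonzero real numbers and let $a_1,\dots,a_N$ be complex numbers. Let $\mathcal Z^d$ be the $N\times N$ matrix with diagonal entries $(\mathcal Z^d)_{ii}=a_i$ and off-diagonal entries $$(\mathcal Z^d)_{ij}=\frac{Q_i}{Q_j-Q_i}\qquad(i\neq j).$$ Let $z_1,\dots,z_N$ be the eigenvalues of $\mathcal Z^d$ (listed with algebraic multiplicity), and assume that $z_1,\dots,z_N$ are real. Then: (1) If $|z_i-z_j|\ge1$ for all $i\ne j$, then the numbers $a_1,\dots,a_N$ are real. (2) Let the $Q_i$ be either all positive or all negative. Assume that there exists a subset $I\subset\{1,\dots,N\}$ such that $|z_i-z_j|\ge1$ for $i\ne j$ provided either $i,j\in I$ or $i,j\notin I$. Then the numbers $a_1,\dots,a_N$ are real. *)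

theory Defs
  imports "Jordan_Normal_Form.Char_Poly"
begin

text \<open>Rows and columns of the matrix are indexed from 0 to N - 1.\<close>

definition Zd :: "nat \<Rightarrow> (nat \<Rightarrow> real) \<Rightarrow> (nat \<Rightarrow> complex) \<Rightarrow> complex mat" where
  "Zd N Q a = mat N N (\<lambda>(i, j). if i = j then a i else complex_of_real (Q i / (Q j - Q i)))"

text \<open>The numbers z 0, ..., z (n - 1) list the eigenvalues of the n by n matrix A, each
  repeated according to its algebraic multiplicity, i.e. its multiplicity as a root of the
  characteristic polynomial.\<close>

definition lists_eigenvalues :: "nat \<Rightarrow> complex mat \<Rightarrow> (nat \<Rightarrow> complex) \<Rightarrow> bool" where
  "lists_eigenvalues n A z \<longleftrightarrow> char_poly A = (\<Prod>i<n. [:- z i, 1:])"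

end

theory Submission
  imports Defs "HOL-Combinatorics.Permutations"
begin

text \<open>The numbers a k are joint eigenvalues of trigonometric Gaudin Hamiltonians, and these are
  Hermitian for a suitable positive form. To see this, let the trigonometric Dunkl operators Y i
  act on the functions on the symmetric group with parameters Q and a. They commute and satisfy
  degenerate affine Hecke relations, so that the product of all x - Y i acts on the constant
  function by a polynomial in x, which turns out to be the characteristic polynomial of the given matrix.
  A joint eigenvector of the Y i therefore has the numbers z i as eigenvalues, in some order.
  Inverting the permutations turns its eigenvalue equations into the statement that the a k are
  eigenvalues of Hamiltonians in which Q and z are parameters.

  Multiply the exchange terms by a coupling constant c. For c < 1 the longest product of Yang
  R-matrices in the letters of each of the two groups (I and its complement) is invertible, hence
  positive definite, since it is the identity for c = 0. After weighting by products of the Q i, which takes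
  care of exchanges between the groups and needs the Q i to have the same sign, it makes the
  Hamiltonians self-adjoint. So their spectrum is real for c < 1, and by continuity of the
  characteristic polynomial also for c = 1.\<close>

section \<open>Trigonometric Dunkl operators\<close>

text \<open>Taking the adjoint of a Hamiltonian reverses the order of letters in its exchange term.
  A product of R-matrices that reverses this order intertwines the Hamiltonian with its adjoint, and
  inserting that product \<open>K\<close> into the form makes the Hamiltonian symmetric. Positivity
  of \<open>K\<close> requires separated spectral parameters, so only letters of the same group can
  be reversed this way. A pair from different groups keeps its order, and there the weight has to do
  the transposing: the two exchange coefficients are in the ratio of two Q's, which makes the weight
  proportional to the Q's. At separation exactly 1 an R-matrix degenerates for c = 1, hence the
  detour through c < 1. The Dunkl eigenvector comes with the natural order of letters, which must
  first be rearranged to put one group in front. That uses R-matrices between the groups as well,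
  invertible only if c avoids the finitely many distances |z i - z j|; reality is therefore shown
  for c close to 1. The characteristic polynomial enters because the last Dunkl operator acts on
  functions of the last letter as the given matrix. Two monic polynomials of degree N then kill the
  all-ones vector, and they agree when this vector is cyclic.\<close>

abbreviation swap_ix :: "nat \<Rightarrow> nat \<Rightarrow> nat \<Rightarrow> nat" where
  "swap_ix \<equiv> Transposition.transpose"

lemma permutes_comp_swap_ix:
  "w permutes {..<n} \<Longrightarrow> i < n \<Longrightarrow> j < n \<Longrightarrow> (w \<circ> swap_ix i j) permutes {..<n}"
  by (intro permutes_compose permutes_swap_id) auto

lemma permutes_comp_swap_ix_iff:
  assumes "i < n" "j < n"
  shows "(w \<circ> swap_ix i j) permutes {..<n} \<longleftrightarrow> w permutes {..<n}"
  using permutes_comp_swap_ix[of "w \<circ> swap_ix i j" n i j] permutes_comp_swap_ix[of w n i j] assms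
  by (auto simp: comp_assoc)

lemma permutes_lt: "w permutes {..<n} \<Longrightarrow> i < n \<Longrightarrow> w i < (n::nat)"
  using permutes_in_image[of w "{..<n}" i] by simp

lemma permutes_neq: "w permutes S \<Longrightarrow> i \<noteq> j \<Longrightarrow> w i \<noteq> w j"
  using permutes_inj[of w S] by (auto simp: inj_def)

text \<open>The instance in mind is \<open>G x y = Q x / (Q y - Q x)\<close>; commutation of the
  operators rests on these two functional equations alone. The first says that G + 1/2 is
  antisymmetric, the second is a partial fraction identity of Yang-Baxter type.\<close>

locale dunkl =
  fixes n :: nat and G :: "nat \<Rightarrow> nat \<Rightarrow> complex"
  assumes G_skew: "x < n \<Longrightarrow> y < n \<Longrightarrow> x \<noteq> y \<Longrightarrow> G y x = - 1 - G x y"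
    and G_triple: "x < n \<Longrightarrow> y < n \<Longrightarrow> z < n \<Longrightarrow> x \<noteq> y \<Longrightarrow> x \<noteq> z \<Longrightarrow> y \<noteq> z \<Longrightarrow>
      G x y * G x z + G x z * G y z + G x z = G y z * G x y"
begin

text \<open>The step in the positions repairs the constant by which \<open>G\<close> fails to be
  antisymmetric: \<open>th j i w = - th i j w\<close> for distinct positions.\<close>

definition th :: "nat \<Rightarrow> nat \<Rightarrow> (nat \<Rightarrow> nat) \<Rightarrow> complex" where
  "th i j w = G (w i) (w j) + of_bool (i < j)"

text \<open>Functions live on all maps nat to nat; forcing the value 0 off the permutations replaces
  a carrier set. The coupling \<open>c\<close> stays free because the characteristic polynomial is
  identified by deforming from c = 0.\<close>

definition Y :: "complex \<Rightarrow> (nat \<Rightarrow> complex) \<Rightarrow> nat \<Rightarrow> ((nat \<Rightarrow> nat) \<Rightarrow> complex) \<Rightarrow> (nat \<Rightarrow> nat) \<Rightarrow> complex" where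
  "Y c a i f w = (if w permutes {..<n}
     then a (w i) * f w + c * (\<Sum>j\<in>{..<n} - {i}. th i j w * f (w \<circ> swap_ix i j)) else 0)"

lemma Y_split:
  assumes "i < n" "j < n" "i \<noteq> j" "w permutes {..<n}"
  shows "Y c a i f w = a (w i) * f w + c * (th i j w * f (w \<circ> swap_ix i j))
    + c * (\<Sum>k\<in>{..<n} - {i, j}. th i k w * f (w \<circ> swap_ix i k))"
proof -
  have "{..<n} - {i} = insert j ({..<n} - {i, j})" using assms by auto
  then show ?thesis using assms by (simp add: Y_def algebra_simps)
qed

lemma cycle3:
  assumes "i \<noteq> j" "i \<noteq> k" "j \<noteq> k"
  shows "w \<circ> swap_ix i k \<circ> swap_ix j i = w \<circ> swap_ix i j \<circ> swap_ix j k"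
    and "w \<circ> swap_ix j k \<circ> swap_ix i k = w \<circ> swap_ix i j \<circ> swap_ix j k"
  using assms by (auto simp: fun_eq_iff Transposition.transpose_def)

text \<open>The products of two steps match by \<open>eps\<close>, the products of two values of
  \<open>G\<close> by \<open>G_triple\<close>. In the mixed products the steps for (i, j) and (j, i)
  add up to 1, which produces exactly the linear term \<open>G x z\<close> of
  \<open>G_triple\<close>.\<close>

lemma th_comm3:
  assumes "i < n" "j < n" "k < n" "i \<noteq> j" "i \<noteq> k" "j \<noteq> k" and w: "w permutes {..<n}"
  shows "th i j w * th j k (w \<circ> swap_ix i j) + th i k w * th j i (w \<circ> swap_ix i k)
    = th j k w * th i k (w \<circ> swap_ix j k)"
proof -
  have lt: "w i < n" "w j < n" "w k < n" using assms permutes_lt by auto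
  have ne: "w i \<noteq> w j" "w i \<noteq> w k" "w j \<noteq> w k" using assms permutes_neq[OF w] by auto
  have eps: "of_bool (i < j) * of_bool (j < k) + of_bool (i < k) * of_bool (j < i)
      = (of_bool (j < k) * of_bool (i < k) :: complex)"
    "of_bool (j < i) = (1 - of_bool (i < j) :: complex)" using assms by auto
  show ?thesis
    unfolding th_def comp_def using assms(4-6) eps G_triple[OF lt ne]
    by (simp add: algebra_simps)
qed

lemma th_comm2:
  assumes "i < n" "j < n" "i \<noteq> j" and w: "w permutes {..<n}"
  shows "th j i w = - th i j w"
    "th i j w * th j i (w \<circ> swap_ix i j) = th j i w * th i j (w \<circ> swap_ix i j)"
proof -
  have lt: "w i < n" "w j < n" using assms permutes_lt by auto
  have ne: "w i \<noteq> w j" using assms permutes_neq[OF w] by auto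
  have e: "of_bool (j < i) = (1 - of_bool (i < j) :: complex)" using assms by auto
  show "th j i w = - th i j w" using G_skew[OF lt ne] e by (simp add: th_def)
  then show "th i j w * th j i (w \<circ> swap_ix i j) = th j i w * th i j (w \<circ> swap_ix i j)"
    by (simp add: th_def G_skew[OF lt ne] e) (simp add: algebra_simps)
qed

text \<open>The terms are sorted by the permutation at which \<open>f\<close> is evaluated. Two of
  the three products involving i, j and a further k give the same 3-cycle, the remaining one gives
  its inverse; exchanging i and j exchanges these two cycles, so \<open>th_comm3\<close> compares
  them.\<close>

lemma Y_Y_expand:
  assumes ij: "i < n" "j < n" "i \<noteq> j" and w: "w permutes {..<n}"
  defines "A \<equiv> {..<n} - {i, j}"
  shows "Y c a i (Y c a j f) w = a (w i) * a (w j) * f w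
    + c * (a (w i) * th j i w * f (w \<circ> swap_ix i j) + th i j w * a (w i) * f (w \<circ> swap_ix i j))
    + c * (\<Sum>k\<in>A. a (w i) * th j k w * f (w \<circ> swap_ix j k) + th i k w * a (w j) * f (w \<circ> swap_ix i k))
    + c^2 * (th i j w * th j i (w \<circ> swap_ix i j) * f w)
    + c^2 * (\<Sum>k\<in>A. (th i j w * th j k (w \<circ> swap_ix i j) + th i k w * th j i (w \<circ> swap_ix i k)) * f (w \<circ> swap_ix i j \<circ> swap_ix j k)
        + th i k w * th j k (w \<circ> swap_ix i k) * f (w \<circ> swap_ix i k \<circ> swap_ix j k))
    + c^2 * (\<Sum>k\<in>A. \<Sum>l\<in>A - {k}. th i k w * th j l w * f (w \<circ> swap_ix i k \<circ> swap_ix j l))"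
proof -
  have A: "finite A" "\<And>k. k \<in> A \<Longrightarrow> k < n \<and> k \<noteq> i \<and> k \<noteq> j" by (auto simp: A_def)
  have A': "{..<n} - {j, i} = A" by (auto simp: A_def)
  have Yj: "Y c a j f w = a (w j) * f w + c * (th j i w * f (w \<circ> swap_ix i j)) + c * (\<Sum>k\<in>A. th j k w * f (w \<circ> swap_ix j k))"
    using Y_split[of j i w c a f] ij w by (simp add: A' Transposition.transpose_commute)
  have Yij: "Y c a j f (w \<circ> swap_ix i j) = a (w i) * f (w \<circ> swap_ix i j) + c * (th j i (w \<circ> swap_ix i j) * f w)
      + c * (\<Sum>k\<in>A. th j k (w \<circ> swap_ix i j) * f (w \<circ> swap_ix i j \<circ> swap_ix j k))"
    using Y_split[of j i "w \<circ> swap_ix i j" c a f] ij permutes_comp_swap_ix[OF w ij(1,2)]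
    by (simp add: A' Transposition.transpose_commute comp_assoc)
  have Yik: "Y c a j f (w \<circ> swap_ix i k) = a (w j) * f (w \<circ> swap_ix i k)
      + c * (th j i (w \<circ> swap_ix i k) * f (w \<circ> swap_ix i j \<circ> swap_ix j k))
      + c * (th j k (w \<circ> swap_ix i k) * f (w \<circ> swap_ix i k \<circ> swap_ix j k)
        + (\<Sum>l\<in>A-{k}. th j l w * f (w \<circ> swap_ix i k \<circ> swap_ix j l)))" if k: "k \<in> A" for k
  proof -
    have k': "k < n" "k \<noteq> i" "k \<noteq> j" using A k by auto
    have "(\<Sum>l\<in>A. th j l (w \<circ> swap_ix i k) * f (w \<circ> swap_ix i k \<circ> swap_ix j l))
      = th j k (w \<circ> swap_ix i k) * f (w \<circ> swap_ix i k \<circ> swap_ix j k)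
        + (\<Sum>l\<in>A-{k}. th j l (w \<circ> swap_ix i k) * f (w \<circ> swap_ix i k \<circ> swap_ix j l))"
      using k A(1) by (rule sum.remove[rotated])
    also have "(\<Sum>l\<in>A-{k}. th j l (w \<circ> swap_ix i k) * f (w \<circ> swap_ix i k \<circ> swap_ix j l))
      = (\<Sum>l\<in>A-{k}. th j l w * f (w \<circ> swap_ix i k \<circ> swap_ix j l))"
      using k' A(2) ij by (intro sum.cong) (auto simp: th_def)
    finally have S: "(\<Sum>l\<in>A. th j l (w \<circ> swap_ix i k) * f (w \<circ> swap_ix i k \<circ> swap_ix j l))
      = th j k (w \<circ> swap_ix i k) * f (w \<circ> swap_ix i k \<circ> swap_ix j k)
        + (\<Sum>l\<in>A-{k}. th j l w * f (w \<circ> swap_ix i k \<circ> swap_ix j l))" .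
    have "(w \<circ> swap_ix i k) j = w j" using k' ij by (simp add: Transposition.transpose_def)
    then show ?thesis
      using Y_split[of j i "w \<circ> swap_ix i k" c a f] ij k' permutes_comp_swap_ix[OF w ij(1) k'(1)]
        cycle3(1)[of i j k w]
      by (simp only: A' S not_sym simp_thms)
  qed
  have "Y c a i (Y c a j f) w = a (w i) * Y c a j f w + c * (th i j w * Y c a j f (w \<circ> swap_ix i j))
    + c * (\<Sum>k\<in>A. th i k w * Y c a j f (w \<circ> swap_ix i k))"
    using Y_split[OF ij w] by (simp add: A_def)
  also have "(\<Sum>k\<in>A. th i k w * Y c a j f (w \<circ> swap_ix i k)) = (\<Sum>k\<in>A. th i k w * (a (w j) * f (w \<circ> swap_ix i k)
      + c * (th j i (w \<circ> swap_ix i k) * f (w \<circ> swap_ix i j \<circ> swap_ix j k))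
      + c * (th j k (w \<circ> swap_ix i k) * f (w \<circ> swap_ix i k \<circ> swap_ix j k)
        + (\<Sum>l\<in>A-{k}. th j l w * f (w \<circ> swap_ix i k \<circ> swap_ix j l)))))"
    by (intro sum.cong refl) (simp add: Yik)
  finally show ?thesis unfolding Yj Yij
    by (simp add: algebra_simps sum.distrib sum_distrib_left power2_eq_square)
qed

lemma Y_commute:
  assumes ij: "i < n" "j < n"
  shows "Y c a i (Y c a j f) = Y c a j (Y c a i f)"
proof (cases "i = j")
  case False
  show ?thesis
  proof
    fix w show "Y c a i (Y c a j f) w = Y c a j (Y c a i f) w"
    proof (cases "w permutes {..<n}")
      case w: True
      let ?A = "{..<n} - {i, j}"
      have A': "{..<n} - {j, i} = ?A" by auto
      let ?C = "\<lambda>i j k. (th i j w * th j k (w \<circ> swap_ix i j) + th i k w * th j i (w \<circ> swap_ix i k)) * f (w \<circ> swap_ix i j \<circ> swap_ix j k)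
        + th i k w * th j k (w \<circ> swap_ix i k) * f (w \<circ> swap_ix i k \<circ> swap_ix j k)"
      have k: "(th j i w * th i k (w \<circ> swap_ix j i) + th j k w * th i j (w \<circ> swap_ix j k)) * f (w \<circ> swap_ix j i \<circ> swap_ix i k)
        + th j k w * th i k (w \<circ> swap_ix j k) * f (w \<circ> swap_ix j k \<circ> swap_ix i k)
        = (th i j w * th j k (w \<circ> swap_ix i j) + th i k w * th j i (w \<circ> swap_ix i k)) * f (w \<circ> swap_ix i j \<circ> swap_ix j k)
        + th i k w * th j k (w \<circ> swap_ix i k) * f (w \<circ> swap_ix i k \<circ> swap_ix j k)" if "k \<in> ?A" for k
        using that ij False w th_comm3[of i j k w] th_comm3[of j i k w] cycle3(2)[of i j k w] cycle3(2)[of j i k w]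
        by simp
      have C: "(\<Sum>k\<in>?A. ?C j i k) = (\<Sum>k\<in>?A. ?C i j k)"
        by (intro sum.cong refl k)
      have D: "(\<Sum>k\<in>?A. \<Sum>l\<in>?A - {k}. th j k w * th i l w * f (w \<circ> swap_ix j k \<circ> swap_ix i l))
        = (\<Sum>k\<in>?A. \<Sum>l\<in>?A - {k}. th i k w * th j l w * f (w \<circ> swap_ix i k \<circ> swap_ix j l))"
      proof -
        have "(\<Sum>k\<in>?A. \<Sum>l\<in>?A - {k}. th j k w * th i l w * f (w \<circ> swap_ix j k \<circ> swap_ix i l))
          = (\<Sum>l\<in>?A. \<Sum>k\<in>{k\<in>?A. l \<in> ?A - {k}}. th j k w * th i l w * f (w \<circ> swap_ix j k \<circ> swap_ix i l))"
          by (subst sum.swap_restrict[symmetric]) (auto intro!: sum.cong)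
        also have "\<dots> = (\<Sum>k\<in>?A. \<Sum>l\<in>?A - {k}. th i k w * th j l w * f (w \<circ> swap_ix i k \<circ> swap_ix j l))"
        proof (intro sum.cong)
          fix l k assume "l \<in> ?A" "k \<in> ?A - {l}"
          then have "w \<circ> swap_ix j k \<circ> swap_ix i l = w \<circ> swap_ix i l \<circ> swap_ix j k"
            using False by (auto simp: fun_eq_iff Transposition.transpose_def)
          then show "th j k w * th i l w * f (w \<circ> swap_ix j k \<circ> swap_ix i l) =
           th i l w * th j k w * f (w \<circ> swap_ix i l \<circ> swap_ix j k)" by simp
        qed auto
        finally show ?thesis .
      qed
      have ji: "j \<noteq> i" using False by simp
      show ?thesis
        unfolding Y_Y_expand[OF ij False w] Y_Y_expand[OF ij(2,1) ji w] A' D C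
        using th_comm2[OF ij False w]
        by (simp add: Transposition.transpose_commute[of j i] sum.distrib del: distrib_right distrib_left)
           (simp add: algebra_simps)
    qed (simp add: Y_def)
  qed
qed simp

end

section \<open>Joint eigenvectors of commuting operators\<close>

type_synonym 'x op = "('x \<Rightarrow> complex) \<Rightarrow> 'x \<Rightarrow> complex"

definition lin :: "'x op \<Rightarrow> bool" where
  "lin T \<longleftrightarrow> (\<forall>f g. T (\<lambda>w. f w + g w) = (\<lambda>w. T f w + T g w)) \<and> (\<forall>r f. T (\<lambda>w. r * f w) = (\<lambda>w. r * T f w))"

lemma linI:
  assumes "\<And>f g w. T (\<lambda>w. f w + g w) w = T f w + T g w" "\<And>r f w. T (\<lambda>w. r * f w) w = r * T f w"
  shows "lin T"
  using assms by (auto simp: lin_def fun_eq_iff)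

lemma
  assumes "lin T"
  shows lin_add: "T (\<lambda>w. f w + g w) = (\<lambda>w. T f w + T g w)"
    and lin_scale: "T (\<lambda>w. r * f w) = (\<lambda>w. r * T f w)"
    and lin_zero: "T (\<lambda>w. 0) = (\<lambda>w. 0)"
    and lin_uminus: "T (\<lambda>w. - f w) = (\<lambda>w. - T f w)"
    and lin_diff: "T (\<lambda>w. f w - g w) = (\<lambda>w. T f w - T g w)"
    and lin_sum: "T (\<lambda>w. \<Sum>i\<in>A. F i w) = (\<lambda>w. \<Sum>i\<in>A. T (F i) w)"
proof -
  show add: "T (\<lambda>w. f w + g w) = (\<lambda>w. T f w + T g w)" for f g using assms by (auto simp: lin_def)
  show sc: "T (\<lambda>w. r * f w) = (\<lambda>w. r * T f w)" for r f using assms by (auto simp: lin_def)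
  show z: "T (\<lambda>w. 0) = (\<lambda>w. 0)" using sc[of 0 "\<lambda>w. 0"] by simp
  show um: "T (\<lambda>w. - f w) = (\<lambda>w. - T f w)" for f using sc[of "-1" f] by simp
  show "T (\<lambda>w. f w - g w) = (\<lambda>w. T f w - T g w)" using add[of f "\<lambda>w. - g w"] um[of g] by simp
  show "T (\<lambda>w. \<Sum>i\<in>A. F i w) = (\<lambda>w. \<Sum>i\<in>A. T (F i) w)"
    by (induction A rule: infinite_finite_induct) (auto simp: z add)
qed

lemma lin_funpow: "lin T \<Longrightarrow> lin (T ^^ k)"
  by (induction k) (auto simp: lin_def)

text \<open>A sequence F of functions stands for the polynomial with function coefficients F k, and
  lmul T multiplies it by x - T.\<close>

definition lmul :: "'x op \<Rightarrow> (nat \<Rightarrow> 'x \<Rightarrow> complex) \<Rightarrow> nat \<Rightarrow> 'x \<Rightarrow> complex" where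
  "lmul T F k = (\<lambda>w. (case k of 0 \<Rightarrow> 0 | Suc j \<Rightarrow> F j w) - T (F k) w)"

lemma lmul_0: "lmul T F 0 = (\<lambda>w. - T (F 0) w)"
  and lmul_Suc: "lmul T F (Suc k) = (\<lambda>w. F k w - T (F (Suc k)) w)"
  by (simp_all add: lmul_def)

text \<open>The coefficient sequence of (x - T (m - 1)) ... (x - T 0) f, a polynomial in x with
  function coefficients.\<close>

fun lprod :: "(nat \<Rightarrow> 'x op) \<Rightarrow> nat \<Rightarrow> ('x \<Rightarrow> complex) \<Rightarrow> nat \<Rightarrow> 'x \<Rightarrow> complex" where
  "lprod T 0 f = (\<lambda>k w. if k = 0 then f w else 0)"
| "lprod T (Suc m) f = lmul (T m) (lprod T m f)"

lemma lmul_commute: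
  assumes "lin S" "lin T" "\<And>f. S (T f) = T (S f)"
  shows "lmul S (lmul T F) k = lmul T (lmul S F) k"
proof -
  consider "k = 0" | "k = Suc 0" | j where "k = Suc (Suc j)" by (metis not0_implies_Suc)
  then show ?thesis
    by cases (simp_all add: lmul_0 lmul_Suc lin_diff[OF assms(1)] lin_diff[OF assms(2)] assms(3)
      lin_uminus[OF assms(1)] lin_uminus[OF assms(2)] fun_eq_iff)
qed

lemma lprod_top:
  assumes "\<And>i. i < m \<Longrightarrow> lin (T i)"
  shows "lprod T m f m = f" and "k > m \<Longrightarrow> lprod T m f k = (\<lambda>w. 0)"
proof -
  have "lprod T m f m = f \<and> (\<forall>k>m. lprod T m f k = (\<lambda>w. 0))" using assms
  proof (induction m)
    case (Suc m)
    then have "lin (T m)" "lprod T m f m = f" "\<forall>k>m. lprod T m f k = (\<lambda>w. 0)" by auto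
    then show ?case by (auto simp: lmul_def lin_zero split: nat.splits)
  qed auto
  then show "lprod T m f m = f" "k > m \<Longrightarrow> lprod T m f k = (\<lambda>w. 0)" by auto
qed

text \<open>Substituting T for x, with powers on the left, kills every multiple of x - T: the
  partial sum up to M collapses to minus T to the power M + 1 applied to \<open>F M\<close>.\<close>

lemma lmul_telescope:
  assumes "lin T" and "\<And>k. k \<ge> m \<Longrightarrow> F k = (\<lambda>w. 0)"
  shows "(\<Sum>k\<le>m. (T ^^ k) (lmul T F k) w) = 0"
proof -
  have "(\<Sum>k\<le>M. (T ^^ k) (lmul T F k) w) = - (T ^^ Suc M) (F M) w" for M
  proof (induction M)
    case 0 then show ?case by (simp add: lmul_0)
  next
    case (Suc M)
    have l: "lin (T ^^ Suc M)" using assms(1) by (rule lin_funpow)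
    have "(T ^^ Suc M) (lmul T F (Suc M)) w = (T ^^ Suc M) (F M) w - (T ^^ Suc M) (T (F (Suc M))) w"
      unfolding lmul_Suc lin_diff[OF l] by simp
    also have "(T ^^ Suc M) (T (F (Suc M))) = (T ^^ Suc (Suc M)) (F (Suc M))"
      by (simp only: funpow_Suc_right comp_apply)
    finally show ?case unfolding sum.atMost_Suc Suc.IH by simp
  qed
  moreover have "(T ^^ Suc m) (F m) w = 0"
    unfolding assms(2)[OF order_refl] lin_zero[OF lin_funpow[OF assms(1)]] by simp
  ultimately show ?thesis by simp
qed

text \<open>A Cayley-Hamilton statement: by commutativity the factor x - T j can be brought to the
  front, and the substitution of T j for x then telescopes to 0.\<close>

lemma lprod_annihilates:
  assumes l: "\<And>i. i < m \<Longrightarrow> lin (T i)"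
    and c: "\<And>i j f. i < m \<Longrightarrow> j < m \<Longrightarrow> T i (T j f) = T j (T i f)" and j: "j < m"
  shows "(\<Sum>k\<le>m. (T j ^^ k) (lprod T m f k) w) = 0"
proof -
  have "\<exists>F. lprod T m f = lmul (T j) F \<and> (\<forall>k\<ge>m. F k = (\<lambda>w. 0))" using assms
  proof (induction m)
    case (Suc m)
    show ?case
    proof (cases "j = m")
      case True
      then show ?thesis using lprod_top(2)[of m T _ f] Suc.prems(1)
        by (intro exI[of _ "lprod T m f"]) auto
    next
      case False
      then obtain F where F: "lprod T m f = lmul (T j) F" "\<forall>k\<ge>m. F k = (\<lambda>w. 0)"
        using Suc by (auto simp: less_Suc_eq)
      have "lmul (T m) (lmul (T j) F) = lmul (T j) (lmul (T m) F)"
        using Suc.prems by (intro ext lmul_commute[THEN fun_cong]) auto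
      moreover have "lmul (T m) F k = (\<lambda>w. 0)" if "k \<ge> Suc m" for k
        using that F(2) Suc.prems(1)[of m] by (cases k) (auto simp: lmul_Suc lin_zero)
      ultimately show ?thesis using F(1)
        by (intro exI[of _ "lmul (T m) F"]) auto
    qed
  qed auto
  then obtain F where F: "lprod T m f = lmul (T j) F" "\<And>k. k\<ge>m \<Longrightarrow> F k = (\<lambda>w. 0)" by auto
  show ?thesis unfolding F(1) by (rule lmul_telescope[OF l[OF j] F(2)])
qed

lemma lprod_intertwine:
  assumes "lin S" "\<And>i f. i < m \<Longrightarrow> S (T i f) = T i (S f)"
  shows "S (lprod T m f k) = lprod T m (S f) k"
  using assms(2)
proof (induction m arbitrary: k)
  case 0 then show ?case by (cases "k = 0") (simp_all add: lin_zero[OF assms(1)])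
next
  case (Suc m)
  have IH: "S (lprod T m f k) = lprod T m (S f) k" for k using Suc by auto
  have c: "S (T m g) = T m (S g)" for g using Suc by auto
  show ?case
    by (cases k) (simp_all add: lmul_0 lmul_Suc lin_diff[OF assms(1)] lin_uminus[OF assms(1)] IH c)
qed

lemma lprod_lin:
  assumes "\<And>i. i < m \<Longrightarrow> lin (T i)"
  shows "lin (\<lambda>f. lprod T m f k)"
  using assms
proof (induction m arbitrary: k)
  case 0 then show ?case by (auto simp: lin_def fun_eq_iff)
next
  case (Suc m)
  have l: "lin (T m)" using Suc by auto
  have IH: "lin (\<lambda>f. lprod T m f k)" for k using Suc by auto
  show ?case
    by (cases k; rule linI) (simp_all add: lmul_0 lmul_Suc lin_add[OF IH] lin_scale[OF IH]
        lin_add[OF l] lin_scale[OF l] algebra_simps)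
qed

lemma lprod_eigen:
  assumes "\<And>i. i < m \<Longrightarrow> lin (T i)" "\<And>i. i < m \<Longrightarrow> T i f = (\<lambda>w. \<zeta> i * f w)"
  shows "lprod T m f k = (\<lambda>w. coeff (\<Prod>i<m. [:- \<zeta> i, 1:]) k * f w)"
  using assms
proof (induction m arbitrary: k)
  case 0 then show ?case by (auto simp: fun_eq_iff coeff_1)
next
  case (Suc m)
  have l: "lin (T m)" using Suc by auto
  have IH: "lprod T m f k = (\<lambda>w. coeff (\<Prod>i<m. [:- \<zeta> i, 1:]) k * f w)" for k using Suc by auto
  have e: "T m f = (\<lambda>w. \<zeta> m * f w)" using Suc by auto
  show ?case
    by (cases k) (simp_all add: lmul_0 lmul_Suc IH lin_scale[OF l] e fun_eq_iff
        mult.commute[of _ "[:- \<zeta> m, 1:]"], simp_all add: algebra_simps)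
qed

text \<open>Replaces a finite-dimensional cyclic module. It is closed under the steps T i - r that
  extract eigenvectors, and an operator that commutes with all T i and scales \<open>f0\<close>
  scales every member by the same number.\<close>

inductive_set gen :: "(nat \<Rightarrow> 'x op) \<Rightarrow> nat \<Rightarrow> ('x \<Rightarrow> complex) \<Rightarrow> ('x \<Rightarrow> complex) set"
  for T :: "nat \<Rightarrow> 'x op" and n f0 where
  base: "f0 \<in> gen T n f0"
| step: "f \<in> gen T n f0 \<Longrightarrow> i < n \<Longrightarrow> (\<lambda>w. T i f w - r * f w) \<in> gen T n f0"

lemma gen_invariant:
  assumes "f \<in> gen T n f0" "lin S" "\<And>i f. i < n \<Longrightarrow> S (T i f) = T i (S f)"
    "\<And>i. i < n \<Longrightarrow> lin (T i)" "S f0 = (\<lambda>w. r * f0 w)"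
  shows "S f = (\<lambda>w. r * f w)"
  using assms(1)
proof induction
  case (step f i s)
  have l: "lin (T i)" using step assms by auto
  have "S (\<lambda>w. T i f w - s * f w) = (\<lambda>w. T i (S f) w - s * S f w)"
    using step assms(3)[of i f] by (simp add: lin_diff[OF assms(2)] lin_scale[OF assms(2)])
  also have "\<dots> = (\<lambda>w. r * (T i f w - s * f w))"
    by (simp add: step lin_scale[OF l] fun_eq_iff algebra_simps)
  finally show ?case .
qed (use assms in auto)

text \<open>The last nonzero function in the chain of factors T - r is killed by the next factor,
  hence an eigenvector. \<open>P\<close> collects what must survive the extraction, such as
  eigenvector equations already obtained.\<close>

lemma chain_eigen:
  fixes T :: "'x op"
  assumes "foldr (\<lambda>r g w. T g w - r * g w) rs f = (\<lambda>w. 0)" "f \<noteq> (\<lambda>w. 0)" "P f"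
    "\<And>g r. P g \<Longrightarrow> P (\<lambda>w. T g w - r * g w)"
  shows "\<exists>g r. g \<noteq> (\<lambda>w. 0) \<and> P g \<and> T g = (\<lambda>w. r * g w)"
  using assms(1)
proof (induction rs)
  case (Cons r rs)
  let ?g = "foldr (\<lambda>r g w. T g w - r * g w) rs f"
  have P: "P ?g" by (induction rs) (auto intro: assms)
  show ?case
  proof (cases "?g = (\<lambda>w. 0)")
    case False
    have "T ?g = (\<lambda>w. r * ?g w)" using Cons.prems by (simp add: fun_eq_iff)
    then show ?thesis using False P by blast
  qed (use Cons in auto)
qed (use assms in auto)

lemma funpow_lincomb_factor:
  assumes l: "lin T"
  shows "foldr (\<lambda>r g w. T g w - r * g w) rs f
    = (\<lambda>w. \<Sum>k\<le>length rs. coeff (\<Prod>r\<leftarrow>rs. [:- r, 1:]) k * (T ^^ k) f w)"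
proof (induction rs)
  case (Cons r rs)
  let ?p = "\<Prod>r\<leftarrow>rs. [:- r, 1:]" and ?n = "length rs"
  have deg: "coeff ?p (Suc ?n) = 0"
    by (rule coeff_eq_0) (metis degree_linear_factors le_imp_less_Suc order_refl)
  show ?case
  proof
    fix w
    have "(\<Sum>k\<le>Suc ?n. coeff ([:- r, 1:] * ?p) k * (T ^^ k) f w)
       = (\<Sum>k\<le>Suc ?n. (case k of 0 \<Rightarrow> 0 | Suc j \<Rightarrow> coeff ?p j) * (T ^^ k) f w) - (\<Sum>k\<le>Suc ?n. r * (coeff ?p k * (T ^^ k) f w))"
      unfolding sum_subtractf[symmetric]
      by (intro sum.cong) (auto simp: algebra_simps split: nat.splits)
    also have "(\<Sum>k\<le>Suc ?n. (case k of 0 \<Rightarrow> 0 | Suc j \<Rightarrow> coeff ?p j) * (T ^^ k) f w)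
       = (\<Sum>k\<le>?n. coeff ?p k * (T ^^ Suc k) f w)"
      by (subst sum.atMost_Suc_shift) simp
    also have "\<dots> = T (\<lambda>w. \<Sum>k\<le>?n. coeff ?p k * (T ^^ k) f w) w"
      by (simp add: lin_sum[OF l] lin_scale[OF l])
    also have "(\<Sum>k\<le>Suc ?n. r * (coeff ?p k * (T ^^ k) f w)) = r * (\<Sum>k\<le>?n. coeff ?p k * (T ^^ k) f w)"
      using deg by (simp add: sum_distrib_left)
    finally show "foldr (\<lambda>r g w. T g w - r * g w) (r # rs) f w
      = (\<Sum>k\<le>length (r # rs). coeff (\<Prod>r\<leftarrow>r # rs. [:- r, 1:]) k * (T ^^ k) f w)"
      using Cons by simp
  qed
qed simp

text \<open>The coefficients of the product act on all of \<open>gen\<close> by the scalars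
  \<open>q k\<close>, so by \<open>lprod_annihilates\<close> the scalar polynomial with these
  coefficients kills each T j there. Splitting it over the complex numbers yields eigenvectors for
  one operator after another. On the joint eigenvector the product acts by the linear factors in
  \<open>\<zeta>\<close>, which are therefore a factorization of the same polynomial.\<close>

lemma joint_eigenvector:
  assumes l: "\<And>i. i < n \<Longrightarrow> lin (T i)"
    and com: "\<And>i j f. i < n \<Longrightarrow> j < n \<Longrightarrow> T i (T j f) = T j (T i f)"
    and f0: "f0 w0 \<noteq> 0" and sc: "\<And>k. lprod T n f0 k = (\<lambda>w. q k * f0 w)"
  shows "\<exists>f \<zeta>. f \<noteq> (\<lambda>w. 0) \<and> f \<in> gen T n f0 \<and> (\<forall>i<n. T i f = (\<lambda>w. \<zeta> i * f w)) \<and> (\<forall>k. coeff (\<Prod>i<n. [:- \<zeta> i, 1:]) k = q k)"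
proof -
  have sc': "lprod T n f k = (\<lambda>w. q k * f w)" if "f \<in> gen T n f0" for f k
  proof (rule gen_invariant[OF that lprod_lin])
    show "lprod T n (T i f) k = T i (lprod T n f k)" if "i < n" for i f
      by (rule lprod_intertwine[symmetric]) (use l com that in auto)
  qed (use l sc in auto)
  have qn: "q n = 1" using fun_cong[OF sc[of n], of w0] lprod_top(1)[of n T f0] l f0 by simp
  have q0: "q k = 0" if "k > n" for k
    using fun_cong[OF sc[of k], of w0] lprod_top(2)[of n T k f0] l f0 that by simp
  define p where "p = Poly (map q [0..<Suc n])"
  have cp: "coeff p k = q k" for k using q0 by (auto simp: p_def nth_default_def simp del: upt_Suc)
  have dp: "degree p = n" by (rule antisym[OF degree_le le_degree]) (auto simp: cp qn q0)
  obtain rs where rs: "(\<Prod>r\<leftarrow>rs. [:- r, 1:]) = p" "length rs = n"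
    using fundamental_theorem_algebra_factorized[of p] dp cp qn by auto
  have ann: "foldr (\<lambda>r g w. T j g w - r * g w) rs f = (\<lambda>w. 0)" if f: "f \<in> gen T n f0" and j: "j < n" for f j
  proof -
    have "(\<Sum>k\<le>n. (T j ^^ k) (lprod T n f k) w) = 0" for w by (rule lprod_annihilates) (use l com j in auto)
    then show ?thesis unfolding funpow_lincomb_factor[OF l[OF j]]
      by (simp add: rs cp sc'[OF f] lin_scale[OF lin_funpow[OF l[OF j]]])
  qed
  have "\<exists>f \<zeta>. f \<noteq> (\<lambda>w. 0) \<and> f \<in> gen T n f0 \<and> (\<forall>i<m. T i f = (\<lambda>w. \<zeta> i * f w))" if "m \<le> n" for m
    using that
  proof (induction m)
    case 0 then show ?case using f0 gen.base by (metis less_nat_zero_code)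
  next
    case (Suc m)
    then obtain f \<zeta> where f: "f \<noteq> (\<lambda>w. 0)" "f \<in> gen T n f0" "\<forall>i<m. T i f = (\<lambda>w. \<zeta> i * f w)" by auto
    have m: "m < n" using Suc by simp
    have "\<exists>g r. g \<noteq> (\<lambda>w. 0) \<and> (g \<in> gen T n f0 \<and> (\<forall>i<m. T i g = (\<lambda>w. \<zeta> i * g w))) \<and> T m g = (\<lambda>w. r * g w)"
    proof (rule chain_eigen[OF ann[OF f(2) m] f(1)])
      fix g r assume g: "g \<in> gen T n f0 \<and> (\<forall>i<m. T i g = (\<lambda>w. \<zeta> i * g w))"
      show "(\<lambda>w. T m g w - r * g w) \<in> gen T n f0 \<and> (\<forall>i<m. T i (\<lambda>w. T m g w - r * g w) = (\<lambda>w. \<zeta> i * (T m g w - r * g w)))"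
      proof (intro conjI allI impI)
        fix i assume i: "i < m"
        have li: "lin (T i)" using l m i by auto
        have "T i (\<lambda>w. T m g w - r * g w) = (\<lambda>w. T m (T i g) w - r * T i g w)"
          using m i com[of i m g] by (simp add: lin_diff[OF li] lin_scale[OF li])
        then show "T i (\<lambda>w. T m g w - r * g w) = (\<lambda>w. \<zeta> i * (T m g w - r * g w))"
          using g i by (simp add: lin_scale[OF l[OF m]] fun_eq_iff algebra_simps)
      qed (use g m gen.step in auto)
    qed (use f in auto)
    then obtain g r where g: "g \<noteq> (\<lambda>w. 0)" "g \<in> gen T n f0" "\<forall>i<m. T i g = (\<lambda>w. \<zeta> i * g w)" "T m g = (\<lambda>w. r * g w)" by blast
    show ?case
      by (rule exI[of _ g], rule exI[of _ "\<zeta>(m := r)"]) (use g in \<open>auto simp: less_Suc_eq\<close>)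
  qed
  from this[of n] obtain f \<zeta> where f: "f \<noteq> (\<lambda>w. 0)" "f \<in> gen T n f0" "\<forall>i<n. T i f = (\<lambda>w. \<zeta> i * f w)" by auto
  obtain w where w: "f w \<noteq> 0" using f(1) by auto
  have "lprod T n f k = (\<lambda>w. coeff (\<Prod>i<n. [:- \<zeta> i, 1:]) k * f w)" for k
    by (rule lprod_eigen) (use l f in auto)
  then have "coeff (\<Prod>i<n. [:- \<zeta> i, 1:]) k = q k" for k
    using sc'[OF f(2), of k] w by (metis mult_right_cancel)
  then show ?thesis using f by blast
qed

section \<open>Affine Hecke relations and central elements\<close>

context dunkl
begin

definition one_perm :: "(nat \<Rightarrow> nat) \<Rightarrow> complex" where
  "one_perm w = of_bool (w permutes {..<n})"

definition flip :: "nat \<Rightarrow> (nat \<Rightarrow> nat) op" where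
  "flip m f w = f (w \<circ> swap_ix m (Suc m))"

lemma Y_lin: "lin (Y c a i)"
  by (rule linI) (simp_all add: Y_def algebra_simps sum.distrib sum_distrib_left)

lemma flip_lin: "lin (flip m)"
  by (rule linI) (simp_all add: flip_def)

lemma flip_flip: "flip m (flip m f) = f"
  by (rule ext) (simp add: flip_def comp_assoc)

lemma flip_one: "Suc m < n \<Longrightarrow> flip m one_perm = one_perm"
  by (rule ext) (simp add: flip_def one_perm_def permutes_comp_swap_ix_iff)

text \<open>Conjugation by the adjacent transposition s renames position j to s j everywhere except
  in the step function, which still compares j with s k. This discrepancy is the source of the Hecke
  constant.\<close>

lemma flip_Y:
  assumes m: "Suc m < n" and w: "w permutes {..<n}" and j: "j < n"
  defines "s \<equiv> swap_ix m (Suc m)"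
  shows "flip m (Y c a j f) w = a (w (s j)) * f (w \<circ> s)
    + c * (\<Sum>k\<in>{..<n} - {s j}. (G (w (s j)) (w k) + of_bool (j < s k)) * flip m f (w \<circ> swap_ix (s j) k))"
proof -
  have ws: "(w \<circ> s) permutes {..<n}" unfolding s_def using permutes_comp_swap_ix[OF w] m by simp
  have "(\<Sum>k\<in>{..<n} - {j}. th j k (w \<circ> s) * f (w \<circ> s \<circ> swap_ix j k))
    = (\<Sum>k\<in>{..<n} - {s j}. (G (w (s j)) (w k) + of_bool (j < s k)) * flip m f (w \<circ> swap_ix (s j) k))"
  proof (rule sum.reindex_bij_witness[of _ s s])
    fix k assume "k \<in> {..<n} - {j}"
    then show "s (s k) = k" "s k \<in> {..<n} - {s j}" using m j
      by (auto simp: s_def Transposition.transpose_def)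
  next
    fix k assume "k \<in> {..<n} - {s j}"
    then show "s (s k) = k" "s k \<in> {..<n} - {j}" using m j
      by (auto simp: s_def Transposition.transpose_def)
  next
    fix k assume "k \<in> {..<n} - {j}"
    have "w \<circ> swap_ix (s j) (s k) \<circ> s = w \<circ> s \<circ> swap_ix j k"
      by (auto simp: s_def fun_eq_iff Transposition.transpose_def)
    then show "(G (w (s j)) (w (s k)) + of_bool (j < s (s k))) * flip m f (w \<circ> swap_ix (s j) (s k)) =
      th j k (w \<circ> s) * f (w \<circ> s \<circ> swap_ix j k)"
      by (simp add: flip_def th_def s_def)
  qed
  then show ?thesis using ws by (simp add: flip_def[of m "Y c a j f"] Y_def s_def[symmetric])
qed

lemma flip_Y_other:
  assumes m: "Suc m < n" and j: "j < n" "j \<noteq> m" "j \<noteq> Suc m"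
  shows "flip m (Y c a j f) = Y c a j (flip m f)"
proof
  fix w
  show "flip m (Y c a j f) w = Y c a j (flip m f) w"
  proof (cases "w permutes {..<n}")
    case True
    have "(\<Sum>k\<in>{..<n} - {j}. (G (w j) (w k) + of_bool (j < swap_ix m (Suc m) k)) * flip m f (w \<circ> swap_ix j k))
      = (\<Sum>k\<in>{..<n} - {j}. th j k w * flip m f (w \<circ> swap_ix j k))"
      using j by (intro sum.cong refl) (auto simp: th_def Transposition.transpose_def)
    then show ?thesis using flip_Y[OF m True j(1), of c a f] j True by (simp add: Y_def flip_def[of m f w])
  next
    case False
    then show ?thesis using m permutes_comp_swap_ix_iff[of m n "Suc m" w] by (simp add: flip_def Y_def)
  qed
qed

text \<open>The steps for \<open>m < s k\<close> and \<open>Suc m < k\<close> differ only at k = m,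
  and there the two transpositions cancel, leaving \<open>c * f w\<close>.\<close>

lemma flip_Y_adjacent:
  assumes m: "Suc m < n" and f: "\<And>w. \<not> w permutes {..<n} \<Longrightarrow> f w = 0"
  shows "flip m (Y c a m f) = (\<lambda>w. Y c a (Suc m) (flip m f) w + c * f w)"
proof
  fix w
  show "flip m (Y c a m f) w = Y c a (Suc m) (flip m f) w + c * f w"
  proof (cases "w permutes {..<n}")
    case True
    let ?s = "swap_ix m (Suc m)"
    have "(\<Sum>k\<in>{..<n} - {Suc m}. (G (w (Suc m)) (w k) + of_bool (m < ?s k)) * flip m f (w \<circ> swap_ix (Suc m) k))
      = (\<Sum>k\<in>{..<n} - {Suc m}. th (Suc m) k w * flip m f (w \<circ> swap_ix (Suc m) k)
          + (if k = m then flip m f (w \<circ> swap_ix (Suc m) m) else 0))"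
      by (intro sum.cong refl) (auto simp: th_def Transposition.transpose_def algebra_simps)
    also have "\<dots> = (\<Sum>k\<in>{..<n} - {Suc m}. th (Suc m) k w * flip m f (w \<circ> swap_ix (Suc m) k)) + f w"
      using m by (simp add: sum.distrib flip_def comp_assoc Transposition.transpose_commute[of "Suc m" m])
    finally show ?thesis using flip_Y[OF m True, of m c a f] m True
      by (simp add: Y_def flip_def[of m f w] algebra_simps)
  next
    case False
    then show ?thesis using m permutes_comp_swap_ix_iff[of m n "Suc m" w] f[OF False] by (simp add: flip_def Y_def)
  qed
qed

lemma lprod_support:
  "\<not> w permutes {..<n} \<Longrightarrow> lprod (Y c a) m one_perm k w = 0"
  by (induction m arbitrary: k) (auto simp: one_perm_def lmul_def Y_def split: nat.splits)

text \<open>Factors at other positions commute with the flip. For the two factors at m and m + 1,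
  the Hecke constants cancel in the sum of the operators and in their product on flip-invariant
  functions, and these are the coefficients of the quadratic polynomial in x.\<close>

lemma lprod_flip_invariant:
  assumes m: "Suc m < n" and M: "M \<ge> Suc (Suc m)" "M \<le> n"
  shows "flip m (lprod (Y c a) M one_perm k) = lprod (Y c a) M one_perm k"
  using M
proof (induction M arbitrary: k rule: dec_induct)
  case base
  let ?F = "lprod (Y c a) m one_perm" and ?A = "Y c a m" and ?B = "Y c a (Suc m)"
  have SF: "flip m (?F k) = ?F k" for k
    using lprod_intertwine[OF flip_lin, of m m "Y c a" one_perm k] flip_Y_other[OF m] m by (simp add: flip_one)
  have supF: "\<And>w k. \<not> w permutes {..<n} \<Longrightarrow> ?F k w = 0" by (rule lprod_support)
  have SA: "flip m (?A (?F k)) = (\<lambda>w. ?B (?F k) w + c * ?F k w)" for k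
    using flip_Y_adjacent[OF m, of "?F k" c a] supF SF by simp
  have "flip m (flip m (?A (?F k))) = (\<lambda>w. flip m (?B (?F k)) w + c * flip m (?F k) w)" for k
    unfolding SA lin_add[OF flip_lin] lin_scale[OF flip_lin] ..
  then have SB: "flip m (?B (?F k)) = (\<lambda>w. ?A (?F k) w - c * ?F k w)" for k
    unfolding flip_flip SF by (simp add: fun_eq_iff)
  have "flip m (?A (?B (?F k))) = (\<lambda>w. ?B (flip m (?B (?F k))) w + c * ?B (?F k) w)" for k
    by (rule flip_Y_adjacent[OF m]) (simp add: Y_def)
  moreover have AB: "?A (?B (?F k)) = ?B (?A (?F k))" for k
    by (rule Y_commute) (use m in auto)
  ultimately have SBA: "flip m (?B (?A (?F k))) = ?B (?A (?F k))" for k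
    unfolding SB lin_diff[OF Y_lin] lin_scale[OF Y_lin] by simp
  consider "k = 0" | "k = Suc 0" | j where "k = Suc (Suc j)" by (metis not0_implies_Suc)
  then show ?case
    by cases (simp_all add: lmul_0 lmul_Suc lin_diff[OF flip_lin] lin_uminus[OF flip_lin] lin_diff[OF Y_lin]
        lin_uminus[OF Y_lin] SF SA SB SBA, simp_all add: fun_eq_iff)
next
  case (step M)
  have IH: "flip m (lprod (Y c a) M one_perm k) = lprod (Y c a) M one_perm k" for k using step by simp
  have "flip m (Y c a M (lprod (Y c a) M one_perm k)) = Y c a M (lprod (Y c a) M one_perm k)" for k
    using flip_Y_other[OF m, of M] step by (simp add: IH)
  then show ?case
    by (cases k) (simp_all add: lmul_0 lmul_Suc lin_diff[OF flip_lin] lin_uminus[OF flip_lin] IH)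
qed

lemma adjacent_invariant_imp_const:
  assumes inv: "\<And>m w. Suc m < n \<Longrightarrow> F (w \<circ> swap_ix m (Suc m)) = F w" and p: "p permutes {..<n}"
  shows "F p = F id"
proof -
  have 1: "F (w \<circ> swap_ix i (Suc (i + d))) = F w" if "Suc (i + d) < n" for i d w
    using that
  proof (induction d arbitrary: w)
    case (Suc d)
    let ?b = "Suc (i + d)"
    have "swap_ix i (Suc ?b) = swap_ix ?b (Suc ?b) \<circ> swap_ix i ?b \<circ> swap_ix ?b (Suc ?b)"
      by (auto simp: fun_eq_iff Transposition.transpose_def)
    then have "F (w \<circ> swap_ix i (Suc ?b)) = F (w \<circ> swap_ix ?b (Suc ?b) \<circ> swap_ix i ?b \<circ> swap_ix ?b (Suc ?b))"
      by (simp add: comp_assoc)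
    also have "\<dots> = F (w \<circ> swap_ix ?b (Suc ?b) \<circ> swap_ix i ?b)" by (rule inv) (use Suc in simp)
    also have "\<dots> = F (w \<circ> swap_ix ?b (Suc ?b))" by (rule Suc.IH) (use Suc in simp)
    also have "\<dots> = F w" by (rule inv) (use Suc in simp)
    finally show ?case by (simp only: add_Suc_right)
  qed (use inv in simp)
  have lt: "F (w \<circ> swap_ix i j) = F w" if "i < j" "j < n" for i j w
  proof -
    obtain d where "j = Suc (i + d)" using \<open>i < j\<close> less_imp_Suc_add by blast
    then show ?thesis using 1 that by simp
  qed
  have 2: "F (w \<circ> swap_ix i j) = F w" if "i < n" "j < n" "i \<noteq> j" for i j w
    using lt[of i j w] lt[of j i w] that
    by (cases "i < j") (simp_all add: Transposition.transpose_commute[of i j])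
  have "\<forall>w. F (w \<circ> p) = F w"
    using p finite_lessThan
  proof (induction p rule: permutes_induct)
    case (swap a b p)
    have "F (w \<circ> (swap_ix a b \<circ> p)) = F w" for w
      using swap.IH[rule_format, of "w \<circ> swap_ix a b"] 2[of a b w] swap.hyps by (simp add: comp_assoc)
    then show ?case by blast
  qed simp
  then show ?thesis by (metis id_comp)
qed

definition ccoeff :: "complex \<Rightarrow> (nat \<Rightarrow> complex) \<Rightarrow> nat \<Rightarrow> complex" where
  "ccoeff c a k = lprod (Y c a) n one_perm k id"

text \<open>Adjacent transpositions generate all permutations, so each coefficient is constant on
  the permutations. This supplies the scalar action required by
  \<open>joint_eigenvector\<close>.\<close>

lemma lprod_one_perm:
  "lprod (Y c a) n one_perm k = (\<lambda>w. ccoeff c a k * one_perm w)"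
proof
  fix w
  show "lprod (Y c a) n one_perm k w = ccoeff c a k * one_perm w"
  proof (cases "w permutes {..<n}")
    case True
    have "lprod (Y c a) n one_perm k w = lprod (Y c a) n one_perm k id"
    proof (rule adjacent_invariant_imp_const[OF _ True])
      fix m w assume "Suc m < n"
      then show "lprod (Y c a) n one_perm k (w \<circ> swap_ix m (Suc m)) = lprod (Y c a) n one_perm k w"
        using fun_cong[OF lprod_flip_invariant[of m n c a k], of w] by (simp add: flip_def)
    qed
    then show ?thesis using True by (simp add: ccoeff_def one_perm_def)
  qed (simp add: lprod_support one_perm_def)
qed

lemma Y_joint_eigenvector:
  "\<exists>f \<zeta>. f \<noteq> (\<lambda>w. 0) \<and> (\<forall>w. \<not> w permutes {..<n} \<longrightarrow> f w = 0) \<and> (\<forall>i<n. Y c a i f = (\<lambda>w. \<zeta> i * f w))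
    \<and> (\<forall>k. coeff (\<Prod>i<n. [:- \<zeta> i, 1:]) k = ccoeff c a k)"
proof -
  obtain f \<zeta> where f: "f \<noteq> (\<lambda>w. 0)" "f \<in> gen (Y c a) n one_perm" "\<forall>i<n. Y c a i f = (\<lambda>w. \<zeta> i * f w)"
    "\<forall>k. coeff (\<Prod>i<n. [:- \<zeta> i, 1:]) k = ccoeff c a k"
    using joint_eigenvector[of n "Y c a" one_perm id "ccoeff c a"] Y_lin Y_commute lprod_one_perm
    by (auto simp: one_perm_def permutes_id)
  have "\<forall>w. \<not> w permutes {..<n} \<longrightarrow> f w = 0"
    using f(2) by induction (auto simp: one_perm_def Y_def)
  then show ?thesis using f by blast
qed

section \<open>The last Dunkl operator and the given matrix\<close>

definition Z :: "complex \<Rightarrow> (nat \<Rightarrow> complex) \<Rightarrow> nat op" where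
  "Z c a h x = (if x < n then \<Sum>y<n. (if x = y then a x else c * G x y) * h y else 0)"

definition one_ix :: "nat \<Rightarrow> complex" where
  "one_ix x = of_bool (x < n)"

definition emb :: "(nat \<Rightarrow> complex) \<Rightarrow> (nat \<Rightarrow> nat) \<Rightarrow> complex" where
  "emb h w = (if w permutes {..<n} then h (w (n - 1)) else 0)"

text \<open>No position exceeds n - 1, so the step function vanishes and \<open>th\<close> reduces
  to \<open>G\<close>. Every exchange with position n - 1 replaces the last letter by another one,
  each exactly once, so functions of the last letter are preserved.\<close>

lemma Y_emb:
  assumes "n > 0"
  shows "Y c a (n - 1) (emb h) = emb (Z c a h)"
proof
  fix w
  show "Y c a (n - 1) (emb h) w = emb (Z c a h) w"
  proof (cases "w permutes {..<n}")
    case w: True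
    let ?N = "n - 1"
    have N: "?N < n" using assms by simp
    have x: "w ?N < n" using permutes_lt[OF w N] .
    have "(\<Sum>j\<in>{..<n} - {?N}. th ?N j w * emb h (w \<circ> swap_ix ?N j)) = (\<Sum>j\<in>{..<n} - {?N}. G (w ?N) (w j) * h (w j))"
      using w N by (intro sum.cong refl) (auto simp: th_def emb_def permutes_comp_swap_ix)
    also have "\<dots> = (\<Sum>y\<in>{..<n} - {w ?N}. G (w ?N) y * h y)"
    proof (rule sum.reindex_bij_betw[of w, where g = "\<lambda>y. G (w ?N) y * h y"])
      have "w ` ({..<n} - {?N}) = {..<n} - {w ?N}"
        using permutes_image[OF w] permutes_inj[OF w] by (simp add: image_set_diff)
      then show "bij_betw w ({..<n} - {?N}) ({..<n} - {w ?N})"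
        using permutes_inj_on[OF w] by (simp add: bij_betw_def)
    qed
    also have "a (w ?N) * h (w ?N) + c * \<dots> = (\<Sum>y<n. (if w ?N = y then a (w ?N) else c * G (w ?N) y) * h y)"
    proof -
      have "(\<Sum>y<n. (if w ?N = y then a (w ?N) else c * G (w ?N) y) * h y)
        = a (w ?N) * h (w ?N) + (\<Sum>y\<in>{..<n} - {w ?N}. (if w ?N = y then a (w ?N) else c * G (w ?N) y) * h y)"
        using x by (subst sum.remove[of _ "w ?N"]) auto
      also have "(\<Sum>y\<in>{..<n} - {w ?N}. (if w ?N = y then a (w ?N) else c * G (w ?N) y) * h y) = c * (\<Sum>y\<in>{..<n} - {w ?N}. G (w ?N) y * h y)"
        unfolding sum_distrib_left by (intro sum.cong) auto
      finally show ?thesis by simp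
    qed
    finally show ?thesis using w x by (simp add: Y_def Z_def emb_def del: One_nat_def)
  qed (simp add: Y_def emb_def)
qed

text \<open>The relation of \<open>lprod_annihilates\<close> for the last operator, read on
  functions of the last letter: the polynomial with coefficients \<open>ccoeff\<close> kills the
  all-ones vector under the matrix.\<close>

lemma Z_annihilated:
  "(\<Sum>k\<le>n. ccoeff c a k * (Z c a ^^ k) one_ix x) = 0"
proof (cases "x < n")
  case x: True
  let ?T = "Y c a (n - 1)"
  have one: "one_perm = emb one_ix"
    using permutes_lt[of _ n "n - 1"] x by (auto simp: fun_eq_iff one_perm_def emb_def one_ix_def)
  have pow: "(?T ^^ k) one_perm = emb ((Z c a ^^ k) one_ix)" for k
    by (induction k) (use Y_emb x in \<open>simp_all add: one\<close>)
  \<comment> \<open>A permutation whose last letter is x, so that evaluating there reads off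
    coordinate x.\<close>
  let ?w = "swap_ix (n - 1) x"
  have w: "?w permutes {..<n}" using x by (intro permutes_swap_id) auto
  have "(\<Sum>k\<le>n. (?T ^^ k) (lprod (Y c a) n one_perm k) ?w) = 0"
    by (rule lprod_annihilates) (use Y_lin Y_commute x in auto)
  then show ?thesis
    unfolding lprod_one_perm lin_scale[OF lin_funpow[OF Y_lin]] pow emb_def using w by (simp del: One_nat_def)
next
  case False
  have "(Z c a ^^ k) one_ix x = 0" for k
    by (cases k) (use False in \<open>auto simp: one_ix_def Z_def\<close>)
  then show ?thesis by simp
qed

end

section \<open>Identification with the characteristic polynomial\<close>

definition polyfun :: "(complex \<Rightarrow> complex) \<Rightarrow> bool" where
  "polyfun f \<longleftrightarrow> (\<exists>p. \<forall>s. f s = poly p s)"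

lemma polyfunI: "(\<And>s. f s = poly p s) \<Longrightarrow> polyfun f"
  by (auto simp: polyfun_def)

lemma polyfun_const: "polyfun (\<lambda>s. r)"
  by (rule polyfunI[of _ "[:r:]"]) simp

lemma polyfun_id: "polyfun (\<lambda>s. s)"
  by (rule polyfunI[of _ "[:0, 1:]"]) simp

lemma polyfun_add: "polyfun f \<Longrightarrow> polyfun g \<Longrightarrow> polyfun (\<lambda>s. f s + g s)"
  unfolding polyfun_def by (metis poly_add)

lemma polyfun_diff: "polyfun f \<Longrightarrow> polyfun g \<Longrightarrow> polyfun (\<lambda>s. f s - g s)"
  unfolding polyfun_def by (metis poly_diff)

lemma polyfun_mult: "polyfun f \<Longrightarrow> polyfun g \<Longrightarrow> polyfun (\<lambda>s. f s * g s)"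
  unfolding polyfun_def by (metis poly_mult)

lemma polyfun_sum: "(\<And>i. i \<in> A \<Longrightarrow> polyfun (f i)) \<Longrightarrow> polyfun (\<lambda>s. \<Sum>i\<in>A. f i s)"
  by (induction A rule: infinite_finite_induct) (auto intro: polyfun_const polyfun_add)

lemma polyfun_prod: "(\<And>i. i \<in> A \<Longrightarrow> polyfun (f i)) \<Longrightarrow> polyfun (\<lambda>s. \<Prod>i\<in>A. f i s)"
  by (induction A rule: infinite_finite_induct) (auto intro: polyfun_const polyfun_mult)

lemmas polyfun_intros = polyfun_const polyfun_id polyfun_add polyfun_diff polyfun_mult polyfun_sum polyfun_prod

lemma polyfun_det:
  assumes "\<And>i j. i < n \<Longrightarrow> j < n \<Longrightarrow> polyfun (\<lambda>s. F s i j)"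
  shows "polyfun (\<lambda>s. det (mat n n (\<lambda>(i, j). F s i j)))"
proof -
  have "det (mat n n (\<lambda>(i, j). F s i j)) = (\<Sum>p\<in>{p. p permutes {0..<n}}. signof p * (\<Prod>i=0..<n. F s i (p i)))" for s
  proof -
    have "(\<Prod>i=0..<n. mat n n (\<lambda>(i, j). F s i j) $$ (i, p i)) = (\<Prod>i=0..<n. F s i (p i))"
      if "p permutes {0..<n}" for p
      using that permutes_in_image[OF that] by (intro prod.cong) auto
    then show ?thesis by (subst det_def') (auto intro!: sum.cong)
  qed
  moreover have "polyfun (\<lambda>s. F s i (p i))" if "p permutes {0..<n}" "i < n" for p i
    using that permutes_in_image[OF that(1), of i] by (intro assms) auto
  ultimately show ?thesis by (auto intro!: polyfun_sum polyfun_mult polyfun_const polyfun_prod)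
qed

lemma polyfun_continuous: "polyfun f \<Longrightarrow> isCont f s"
  unfolding polyfun_def by (auto simp: fun_eq_iff[symmetric])

text \<open>Polynomials over the complex numbers form an integral domain. This extends an identity
  from the parameters where a generic condition \<open>g s \<noteq> 0\<close> holds to all
  parameters.\<close>

lemma polyfun_eq_0:
  assumes "polyfun f" "polyfun g" "\<And>s. f s * g s = 0" "g s0 \<noteq> 0"
  shows "f s = 0"
proof -
  obtain p p' where p: "\<And>s. f s = poly p s" "\<And>s. g s = poly p' s"
    using assms(1,2) unfolding polyfun_def by auto
  have "poly (p * p') s = 0" for s using assms(3) by (simp add: p)
  then have "p * p' = 0" using poly_all_0_iff_0 by blast
  moreover have "p' \<noteq> 0" using assms(4) p by auto
  ultimately show ?thesis by (simp add: p)
qed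

text \<open>Let \<open>H\<close> consist of the row sums of the adjugate of xI - A. Then (x - T) H
  is the characteristic polynomial times the all-ones vector, and \<open>lmul_telescope\<close>
  applies. In this form the relation is directly comparable with
  \<open>Z_annihilated\<close>.\<close>

lemma cayley_hamilton_ones:
  fixes A :: "complex mat" and T :: "nat op"
  assumes A: "A \<in> carrier_mat n n"
    and T: "\<And>h x. T h x = (if x < n then \<Sum>y<n. A $$ (x, y) * h y else 0)"
  shows "(\<Sum>k\<le>n. coeff (char_poly A) k * (T ^^ k) (\<lambda>x. of_bool (x < n)) x) = 0"
proof -
  have lin: "lin T" by (rule linI) (simp_all add: T algebra_simps sum.distrib sum_distrib_left)
  let ?C = "char_poly_matrix A"
  have C: "?C \<in> carrier_mat n n" using A by simp
  define B where "B = adj_mat ?C"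
  have B: "B \<in> carrier_mat n n" "?C * B = char_poly A \<cdot>\<^sub>m 1\<^sub>m n"
    using adj_mat[OF C] by (auto simp: B_def char_poly_def)
  define H where "H x = (if x < n then \<Sum>j<n. B $$ (x, j) else 0)" for x
  define F where "F k x = coeff (H x) k" for k x
  have row: "[:0, 1:] * H x - (\<Sum>y<n. [:A $$ (x, y):] * H y) = char_poly A" if x: "x < n" for x
  proof -
    have C_entry: "?C $$ (x, y) = (if x = y then [:0, 1:] else 0) - [:A $$ (x, y):]" if "y < n" for y
      using A x that by (auto simp: char_poly_matrix_def)
    have "(?C * B) $$ (x, j) = (\<Sum>y<n. ?C $$ (x, y) * B $$ (y, j))" if "j < n" for j
      using C B(1) x that by (simp add: scalar_prod_def atLeast0LessThan)
    then have "(\<Sum>j<n. \<Sum>y<n. ?C $$ (x, y) * B $$ (y, j)) = (\<Sum>j<n. (char_poly A \<cdot>\<^sub>m 1\<^sub>m n) $$ (x, j))"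
      using B(2) by simp
    also have "\<dots> = (\<Sum>j<n. if x = j then char_poly A else 0)"
      using x by (intro sum.cong) auto
    also have "\<dots> = char_poly A" using x by simp
    also have "(\<Sum>j<n. \<Sum>y<n. ?C $$ (x, y) * B $$ (y, j)) = (\<Sum>y<n. ?C $$ (x, y) * H y)"
      by (subst sum.swap) (simp add: H_def sum_distrib_left)
    also have "\<dots> = (\<Sum>y<n. (if x = y then [:0, 1:] * H y else 0) - [:A $$ (x, y):] * H y)"
      by (intro sum.cong refl) (simp add: C_entry algebra_simps)
    also have "\<dots> = [:0, 1:] * H x - (\<Sum>y<n. [:A $$ (x, y):] * H y)"
      using x by (simp add: sum_subtractf)
    finally show ?thesis .
  qed
  have lm: "lmul T F k x = coeff (char_poly A) k * of_bool (x < n)" for k x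
  proof (cases "x < n")
    case True
    have "coeff (char_poly A) k = (case k of 0 \<Rightarrow> 0 | Suc j \<Rightarrow> F j x) - (\<Sum>y<n. A $$ (x, y) * F k y)"
      unfolding row[OF True, symmetric] by (simp add: coeff_sum F_def coeff_pCons split: nat.split)
    then show ?thesis using True by (simp add: lmul_def T)
  qed (auto simp: lmul_def T F_def H_def split: nat.splits)
  have deg: "degree (char_poly A) = n" using degree_monic_char_poly[OF A] by simp
  \<comment> \<open>Exceeds the degrees of all entries of \<open>H\<close>, so that the telescoping
    sum ends, and also n, so that every coefficient of the characteristic polynomial is
    included.\<close>
  define m where "m = Suc (n + (\<Sum>y<n. degree (H y)))"
  have Fm: "F k = (\<lambda>x. 0)" if "k \<ge> m" for k
  proof
    fix x show "F k x = 0"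
    proof (cases "x < n")
      case True
      have "degree (H x) \<le> (\<Sum>y<n. degree (H y))" by (rule member_le_sum) (use True in auto)
      then show ?thesis using that by (auto simp: F_def m_def intro!: coeff_eq_0)
    qed (simp add: F_def H_def)
  qed
  have "(\<Sum>k\<le>m. (T ^^ k) (lmul T F k) x) = 0" by (rule lmul_telescope[OF lin Fm])
  moreover have "lmul T F k = (\<lambda>x. coeff (char_poly A) k * of_bool (x < n))" for k by (rule ext) (rule lm)
  ultimately have "(\<Sum>k\<le>m. coeff (char_poly A) k * (T ^^ k) (\<lambda>x. of_bool (x < n)) x) = 0"
    by (simp only: lin_scale[OF lin_funpow[OF lin]])
  moreover have "(\<Sum>k\<le>m. coeff (char_poly A) k * (T ^^ k) (\<lambda>x. of_bool (x < n)) x)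
    = (\<Sum>k\<le>n. coeff (char_poly A) k * (T ^^ k) (\<lambda>x. of_bool (x < n)) x)"
    by (rule sum.mono_neutral_right) (auto simp: m_def deg intro!: coeff_eq_0)
  ultimately show ?thesis by simp
qed

context dunkl
begin

definition Zmat :: "complex \<Rightarrow> (nat \<Rightarrow> complex) \<Rightarrow> complex mat" where
  "Zmat c a = mat n n (\<lambda>(x, y). if x = y then a x else c * G x y)"

definition krylov :: "complex \<Rightarrow> (nat \<Rightarrow> complex) \<Rightarrow> complex mat" where
  "krylov c a = mat n n (\<lambda>(x, k). (Z c a ^^ k) one_ix x)"

lemma ccoeff_top: "ccoeff c a n = 1" "k > n \<Longrightarrow> ccoeff c a k = 0"
  using lprod_top(1)[of n "Y c a" one_perm] lprod_top(2)[of n "Y c a" k one_perm] Y_lin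
  by (simp_all add: ccoeff_def one_perm_def permutes_id)

text \<open>Both polynomials are monic of degree n and kill the all-ones vector. Their difference
  has degree below n, hence gives a linear relation between the columns of the Krylov
  matrix.\<close>

lemma krylov_imp_ccoeff_char_poly:
  assumes "det (krylov c a) \<noteq> 0"
  shows "ccoeff c a k = coeff (char_poly (Zmat c a)) k"
proof -
  have M: "Zmat c a \<in> carrier_mat n n" by (simp add: Zmat_def)
  have cp: "coeff (char_poly (Zmat c a)) n = 1" "\<And>k. k > n \<Longrightarrow> coeff (char_poly (Zmat c a)) k = 0"
    using degree_monic_char_poly[OF M] by (auto intro: coeff_eq_0)
  have K: "krylov c a \<in> carrier_mat n n" by (simp add: krylov_def)
  define d where "d k = ccoeff c a k - coeff (char_poly (Zmat c a)) k" for k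
  have CH: "(\<Sum>k\<le>n. coeff (char_poly (Zmat c a)) k * (Z c a ^^ k) one_ix x) = 0" for x
    using cayley_hamilton_ones[OF M, of "Z c a" x]
    by (simp add: Z_def Zmat_def one_ix_def[abs_def])
  have "(\<Sum>k\<le>n. d k * (Z c a ^^ k) one_ix x) = 0" for x
    using Z_annihilated[of c a x] CH[of x] by (simp add: d_def algebra_simps sum_subtractf)
  then have rel: "(\<Sum>k<n. d k * (Z c a ^^ k) one_ix x) = 0" for x
    using ccoeff_top(1) cp(1) by (simp add: lessThan_Suc_atMost[symmetric] d_def)
  have "krylov c a *\<^sub>v vec n d = 0\<^sub>v n"
  proof
    fix x assume "x < dim_vec (0\<^sub>v n)"
    then show "(krylov c a *\<^sub>v vec n d) $ x = 0\<^sub>v n $ x"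
      using rel[of x] by (simp add: krylov_def scalar_prod_def atLeast0LessThan mult.commute)
  qed (simp add: krylov_def)
  then have "vec n d = 0\<^sub>v n"
    using det_0_iff_vec_prod_zero_field[OF K] assms by (metis vec_carrier)
  then have "d k = 0" if "k < n" for k using that by (metis index_vec index_zero_vec(1))
  then show ?thesis using ccoeff_top cp by (cases k n rule: linorder_cases) (auto simp: d_def)
qed

lemma Z_funpow_Suc:
  "(Z c a ^^ Suc k) h x = (if x < n then \<Sum>y<n. (if x = y then a x else c * G x y) * (Z c a ^^ k) h y else 0)"
  by (simp only: funpow.simps comp_apply Z_def[of c a "(Z c a ^^ k) h" x])

lemma polyfun_funpow_Z:
  assumes "polyfun c" "\<And>x. polyfun (\<lambda>s. a s x)"
  shows "polyfun (\<lambda>s. (Z (c s) (a s) ^^ k) one_ix x)"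
proof (induction k arbitrary: x)
  case (Suc k)
  have "polyfun (\<lambda>s. if x = y then a s x else c s * G x y)" for y
    using assms by (cases "x = y") (auto intro!: polyfun_intros)
  then show ?case unfolding Z_funpow_Suc using Suc by (cases "x < n") (auto simp del: funpow.simps intro!: polyfun_intros)
qed (auto intro: polyfun_intros)

lemma polyfun_ccoeff:
  assumes "polyfun c" "\<And>x. polyfun (\<lambda>s. a s x)"
  shows "polyfun (\<lambda>s. ccoeff (c s) (a s) k)"
proof -
  have "polyfun (\<lambda>s. lprod (Y (c s) (a s)) m one_perm k w)" for m w
  proof (induction m arbitrary: k w)
    case 0 then show ?case by (cases "k = 0") (auto intro: polyfun_intros)
  next
    case (Suc m)
    have IH: "polyfun (\<lambda>s. lprod (Y (c s) (a s)) m one_perm k w)" for k w by (rule Suc)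
    have "polyfun (\<lambda>s. Y (c s) (a s) m (lprod (Y (c s) (a s)) m one_perm k) w)" for k w
      by (cases "w permutes {..<n}") (auto simp: Y_def intro!: polyfun_intros IH assms)
    then show ?case by (cases k) (auto simp: lmul_def intro!: polyfun_intros IH polyfun_diff[of "\<lambda>s. 0", simplified])
  qed
  then show ?thesis by (simp add: ccoeff_def)
qed

lemma poly_char_poly_Zmat:
  "poly (char_poly (Zmat c a)) x = det (mat n n (\<lambda>(i, j). (if i = j then x else 0) - (if i = j then a i else c * G i j)))"
proof -
  have "poly (char_poly (Zmat c a)) x = det (- char_matrix (Zmat c a) x)"
    by (rule char_poly_matrix[of _ n]) (simp add: Zmat_def)
  also have "- char_matrix (Zmat c a) x = mat n n (\<lambda>(i, j). (if i = j then x else 0) - (if i = j then a i else c * G i j))"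
    by (rule eq_matI) (auto simp: char_matrix_def Zmat_def)
  finally show ?thesis .
qed

text \<open>The Krylov matrix of a diagonal matrix is a Vandermonde matrix, so the hypothesis of the
  previous criterion holds generically on the line through (1, a) and (0, diag(0, 1, 2, ...)).\<close>

lemma ccoeff_eq_char_poly: "ccoeff 1 a k = coeff (char_poly (Zmat 1 a)) k"
proof -
  define as where "as s x = of_nat x + s * (a x - of_nat x)" for s :: complex and x
  have as: "polyfun (\<lambda>s. as s x)" for x unfolding as_def by (intro polyfun_intros)
  have as0: "as 0 x = of_nat x" and as1: "as 1 = a" for x by (auto simp: as_def fun_eq_iff)
  have K0: "det (krylov 0 (as 0)) \<noteq> 0"
  proof
    assume "det (krylov 0 (as 0)) = 0"
    moreover have K: "krylov 0 (as 0) \<in> carrier_mat n n" by (simp add: krylov_def)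
    ultimately obtain v where v: "v \<in> carrier_vec n" "v \<noteq> 0\<^sub>v n" "krylov 0 (as 0) *\<^sub>v v = 0\<^sub>v n"
      using det_0_iff_vec_prod_zero_field[OF K] by blast
    have Zk: "(Z 0 (as 0) ^^ k) one_ix x = of_nat x ^ k" if "x < n" for x k
    proof (induction k)
      case (Suc k)
      have "(\<Sum>y<n. (if x = y then as 0 x else 0 * G x y) * (Z 0 (as 0) ^^ k) one_ix y)
        = (\<Sum>y<n. if y = x then as 0 x * (Z 0 (as 0) ^^ k) one_ix x else 0)"
        by (rule sum.cong) simp_all
      also have "\<dots> = as 0 x * (Z 0 (as 0) ^^ k) one_ix x"
        by (subst sum.delta) (use that in simp_all)
      finally have e: "(Z 0 (as 0) ^^ Suc k) one_ix x = as 0 x * (Z 0 (as 0) ^^ k) one_ix x"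
        unfolding Z_funpow_Suc by (simp only: that if_True)
      show ?case unfolding e Suc.IH unfolding as0[of x] power_Suc by (rule refl)
    qed (use that in \<open>simp add: one_ix_def\<close>)
    \<comment> \<open>A kernel vector of the Vandermonde matrix is the coefficient vector of a
      polynomial of degree below n with the n roots 0, ..., n - 1.\<close>
    define p where "p = (\<Sum>k<n. monom (v $ k) k)"
    have "poly p (of_nat x) = 0" if "x < n" for x
      using arg_cong[OF v(3), of "\<lambda>u. u $ x"] that v(1)
      by (simp add: p_def poly_sum poly_monom krylov_def scalar_prod_def atLeast0LessThan Zk mult.commute)
    then have roots: "of_nat ` {..<n} \<subseteq> {x. poly p x = 0}" by auto
    have "p = 0"
    proof (rule ccontr)
      assume "p \<noteq> 0"
      have "card (of_nat ` {..<n} :: complex set) \<le> card {x. poly p x = 0}"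
        by (rule card_mono[OF poly_roots_finite[OF \<open>p \<noteq> 0\<close>] roots])
      also have "\<dots> \<le> degree p" by (rule card_poly_roots_bound[OF \<open>p \<noteq> 0\<close>])
      finally have "n \<le> degree p" by (simp add: card_image inj_on_def)
      moreover have "coeff p k = 0" if "k \<ge> n" for k
        using that by (simp add: p_def coeff_sum)
      ultimately show False using \<open>p \<noteq> 0\<close> leading_coeff_0_iff[of p] by simp
    qed
    moreover have "coeff p k = v $ k" if "k < n" for k
      using that by (simp add: p_def coeff_sum)
    ultimately have "v $ k = 0" if "k < n" for k using that by (metis coeff_0)
    then have "v = 0\<^sub>v n" using v(1) by (intro eq_vecI) auto
    then show False using v(2) by simp
  qed
  have pk: "polyfun (\<lambda>s. det (krylov s (as s)))"
    unfolding krylov_def by (intro polyfun_det polyfun_funpow_Z as polyfun_id)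
  \<comment> \<open>For fixed x the difference is a polynomial in the deformation parameter s. Its
    product with the Krylov determinant vanishes for every s, and the determinant is nonzero at s =
    0.\<close>
  have e: "(\<Sum>k\<le>n. ccoeff 1 (as 1) k * x ^ k) - poly (char_poly (Zmat 1 (as 1))) x = 0" for x
  proof (rule polyfun_eq_0[where f = "\<lambda>s. (\<Sum>k\<le>n. ccoeff s (as s) k * x ^ k) - poly (char_poly (Zmat s (as s))) x", OF _ pk _ K0])
    have "polyfun (\<lambda>s. if i = j then as s i else s * G i j)" for i j
      using as by (cases "i = j") (auto intro!: polyfun_intros)
    then show "polyfun (\<lambda>s. (\<Sum>k\<le>n. ccoeff s (as s) k * x ^ k) - poly (char_poly (Zmat s (as s))) x)"
      unfolding poly_char_poly_Zmat
      by (intro polyfun_diff polyfun_sum polyfun_mult polyfun_ccoeff polyfun_det polyfun_const polyfun_id as)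
    show "((\<Sum>k\<le>n. ccoeff s (as s) k * x ^ k) - poly (char_poly (Zmat s (as s))) x) * det (krylov s (as s)) = 0" for s
    proof (cases "det (krylov s (as s)) = 0")
      case False
      have "degree (char_poly (Zmat s (as s))) = n" using degree_monic_char_poly[of "Zmat s (as s)" n] by (simp add: Zmat_def)
      then show ?thesis using krylov_imp_ccoeff_char_poly[OF False] by (simp add: poly_altdef)
    qed simp
  qed
  define p where "p = (\<Sum>k\<le>n. monom (ccoeff 1 a k) k)"
  have "poly p x = poly (char_poly (Zmat 1 a)) x" for x
    using e[of x] by (simp add: as1 p_def poly_sum poly_monom)
  then have "p = char_poly (Zmat 1 a)" by (simp add: poly_eq_poly_eq_iff[symmetric] fun_eq_iff)
  moreover have "coeff p k = ccoeff 1 a k"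
    using ccoeff_top(2)[of k 1 a] by (cases "k \<le> n") (auto simp: p_def coeff_sum)
  ultimately show ?thesis by simp
qed

lemma eigenvalues_as_weights:
  "\<exists>f \<zeta>. f \<noteq> (\<lambda>w. 0) \<and> (\<forall>w. \<not> w permutes {..<n} \<longrightarrow> f w = 0) \<and> (\<forall>i<n. Y 1 a i f = (\<lambda>w. \<zeta> i * f w))
    \<and> char_poly (Zmat 1 a) = (\<Prod>i<n. [:- \<zeta> i, 1:])"
  using Y_joint_eigenvector[of 1 a] by (metis poly_eqI ccoeff_eq_char_poly)

end

section \<open>Gaudin Hamiltonians and their intertwiners\<close>

fun bef :: "nat list \<Rightarrow> nat \<Rightarrow> nat \<Rightarrow> bool" where
  "bef [] x y = False"
| "bef (a # xs) x y = (x = a \<and> y \<in> set xs \<or> bef xs x y)"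

lemma bef_append: "bef (xs @ ys) x y \<longleftrightarrow> bef xs x y \<or> bef ys x y \<or> x \<in> set xs \<and> y \<in> set ys"
  by (induction xs) auto

lemma bef_set: "bef xs x y \<Longrightarrow> x \<in> set xs \<and> y \<in> set xs"
  by (induction xs) auto

lemma bef_rev: "bef (rev xs) x y = bef xs y x"
  by (induction xs) (auto simp: bef_append)

lemma bef_map: "inj s \<Longrightarrow> bef (map s xs) (s x) (s y) = bef xs x y"
  by (induction xs) (auto simp: inj_eq)

lemma bef_upt: "bef [i..<j] x y \<longleftrightarrow> i \<le> x \<and> x < y \<and> y < j"
  by (induction j) (auto simp: bef_append)

lemma bef_swap:
  assumes "distinct (us @ a # b # vs)"
  shows "bef (us @ b # a # vs) x y = bef (us @ a # b # vs) (swap_ix a b x) (swap_ix a b y)"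
proof -
  let ?s = "swap_ix a b"
  have m: "map ?s us = us" "map ?s vs = vs" using assms
    by (auto intro!: map_idI simp: Transposition.transpose_def)
  have "bef (us @ b # a # vs) x y = bef (map ?s (us @ a # b # vs)) (?s (?s x)) (?s (?s y))"
    using m by simp
  also have "\<dots> = bef (us @ a # b # vs) (?s x) (?s y)" by (rule bef_map) (rule inj_transpose)
  finally show ?thesis .
qed

lemma bef_swap_diff:
  assumes "distinct (us @ a # b # vs)" "x \<noteq> y"
  shows "of_bool (bef (us @ b # a # vs) x y) = (of_bool (bef (us @ a # b # vs) x y)
    + (if x = b \<and> y = a then 1 else if x = a \<and> y = b then - 1 else 0) :: complex)"
  using assms by (auto simp: bef_append dest: bef_set)

text \<open>Letters are permuted by composition on the left, positions by composition on the right.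
  With r = 1 and g = c / (z a - z b) this is Yang's R-matrix; the homogeneous version makes sense also for z a = z b.\<close>

definition rmat :: "nat \<Rightarrow> nat \<Rightarrow> complex \<Rightarrow> complex \<Rightarrow> ((nat \<Rightarrow> nat) \<Rightarrow> complex) \<Rightarrow> (nat \<Rightarrow> nat) \<Rightarrow> complex" where
  "rmat a b r g f v = r * f v - g * f (swap_ix a b \<circ> v)"

text \<open>The exchange term depends on the order xs of the letters; reversing the order amounts to
  transposing the exchange part.\<close>

definition gaudin :: "nat \<Rightarrow> (nat \<Rightarrow> nat \<Rightarrow> complex) \<Rightarrow> (nat \<Rightarrow> complex) \<Rightarrow> complex \<Rightarrow> nat list \<Rightarrow> nat
    \<Rightarrow> ((nat \<Rightarrow> nat) \<Rightarrow> complex) \<Rightarrow> (nat \<Rightarrow> nat) \<Rightarrow> complex" where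
  "gaudin n G \<zeta> c xs k f v = (if v permutes {..<n} then \<zeta> (v k) * f v
     - c * (\<Sum>l\<in>{..<n} - {k}. (G k l + of_bool (bef xs (v k) (v l))) * f (v \<circ> swap_ix k l)) else 0)"

lemma permutes_swap_ix_comp:
  "w permutes {..<n} \<Longrightarrow> i < n \<Longrightarrow> j < n \<Longrightarrow> (swap_ix i j \<circ> w) permutes {..<n}"
  by (intro permutes_compose permutes_swap_id) auto

lemma permutes_swap_ix_comp_iff:
  assumes "i < n" "j < n"
  shows "(swap_ix i j \<circ> w) permutes {..<n} \<longleftrightarrow> w permutes {..<n}"
  using permutes_swap_ix_comp[of "swap_ix i j \<circ> w" n i j] permutes_swap_ix_comp[of w n i j] assms
  by (auto simp: comp_assoc[symmetric])

text \<open>Unitarity of the R-matrix: it is invertible unless \<open>r^2 = g^2\<close>.\<close>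

lemma rmat_rmat: "rmat a b r (- g) (rmat a b r g f) = (\<lambda>v. (r^2 - g^2) * f v)"
  by (rule ext) (simp add: rmat_def comp_assoc[symmetric] power2_eq_square algebra_simps)

lemma comp_swap_eq_swap_comp:
  assumes "v permutes S"
  shows "v \<circ> swap_ix k l = swap_ix (v k) (v l) \<circ> v"
  using permutes_inj[OF assms] by (auto simp: fun_eq_iff Transposition.transpose_def inj_eq)

text \<open>Reordering the neighbours a and b changes the exchange term only where a and b
  themselves are exchanged, and exchanging their positions is the same as exchanging the letters.
  The resulting term is cancelled by the commutator of the letter swap with the diagonal part
  \<open>\<zeta> (v k)\<close>; the hypothesis on \<open>g\<close> is precisely this
  balance.\<close>

lemma gaudin_rmat_intertwine:
  assumes d: "distinct (us @ a # b # vs)" and ab: "a < n" "b < n" and k: "k < n"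
    and g: "g * (\<zeta> a - \<zeta> b) = c * r"
  shows "gaudin n G \<zeta> c (us @ b # a # vs) k (rmat a b r g f) = rmat a b r g (gaudin n G \<zeta> c (us @ a # b # vs) k f)"
proof
  fix v
  let ?s = "swap_ix a b" and ?xs = "us @ a # b # vs" and ?ys = "us @ b # a # vs"
  have anb: "a \<noteq> b" using d by auto
  show "gaudin n G \<zeta> c ?ys k (rmat a b r g f) v = rmat a b r g (gaudin n G \<zeta> c ?xs k f) v"
  proof (cases "v permutes {..<n}")
    case v: True
    then have sv: "(?s \<circ> v) permutes {..<n}" using ab by (rule permutes_swap_ix_comp)
    let ?A = "{..<n} - {k}"
    have e: "of_bool (bef ?ys (v k) (v l)) = (of_bool (bef ?xs (v k) (v l))
       + (if v k = b \<and> v l = a then 1 else if v k = a \<and> v l = b then - 1 else 0) :: complex)" if "l \<in> ?A" for l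
      by (rule bef_swap_diff[OF d]) (use that permutes_neq[OF v] in auto)
    \<comment> \<open>If site k carries a or b, exactly one site l carries the other letter;
      otherwise the sum is empty of nonzero terms.\<close>
    have D: "(\<Sum>l\<in>?A. (if v k = b \<and> v l = a then 1 else if v k = a \<and> v l = b then - 1 else 0) * f (v \<circ> swap_ix k l))
       = (if v k = b then 1 else if v k = a then - 1 else 0) * f (?s \<circ> v)" (is "?lhs = ?rhs")
    proof -
      have "?lhs = (\<Sum>l\<in>?A. (if v k = b \<and> v l = a then 1 else if v k = a \<and> v l = b then - 1 else 0) * f (?s \<circ> v))"
        by (intro sum.cong refl) (auto simp: comp_swap_eq_swap_comp[OF v] Transposition.transpose_commute)
      also have "\<dots> = (\<Sum>l\<in>?A. if l = inv_into UNIV v (if v k = b then a else b) then (if v k = b then 1 else if v k = a then - 1 else 0) * f (?s \<circ> v) else 0)"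
        using anb permutes_inverses[OF v] by (intro sum.cong refl) auto
      also have "\<dots> = ?rhs"
        using anb ab permutes_lt[OF permutes_inv[OF v]] permutes_inverses[OF v] by (auto simp: sum.delta)
      finally show ?thesis .
    qed
    have "(\<Sum>l\<in>?A. (G k l + of_bool (bef ?ys (v k) (v l))) * rmat a b r g f (v \<circ> swap_ix k l))
      = (\<Sum>l\<in>?A. r * ((G k l + of_bool (bef ?xs (v k) (v l))) * f (v \<circ> swap_ix k l))
         + r * ((if v k = b \<and> v l = a then 1 else if v k = a \<and> v l = b then - 1 else 0) * f (v \<circ> swap_ix k l))
         - g * ((G k l + of_bool (bef ?xs ((?s \<circ> v) k) ((?s \<circ> v) l))) * f (?s \<circ> v \<circ> swap_ix k l)))"
    proof (intro sum.cong refl)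
      fix l assume l: "l \<in> ?A"
      have "(G k l + of_bool (bef ?ys (v k) (v l))) * rmat a b r g f (v \<circ> swap_ix k l)
         = r * ((G k l + of_bool (bef ?ys (v k) (v l))) * f (v \<circ> swap_ix k l))
           - g * ((G k l + of_bool (bef ?ys (v k) (v l))) * f (?s \<circ> v \<circ> swap_ix k l))"
        by (simp add: rmat_def comp_assoc algebra_simps)
      also have "g * ((G k l + of_bool (bef ?ys (v k) (v l))) * f (?s \<circ> v \<circ> swap_ix k l))
         = g * ((G k l + of_bool (bef ?xs ((?s \<circ> v) k) ((?s \<circ> v) l))) * f (?s \<circ> v \<circ> swap_ix k l))"
        by (simp only: bef_swap[OF d] comp_apply)
      finally show "(G k l + of_bool (bef ?ys (v k) (v l))) * rmat a b r g f (v \<circ> swap_ix k l)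
        = r * ((G k l + of_bool (bef ?xs (v k) (v l))) * f (v \<circ> swap_ix k l))
         + r * ((if v k = b \<and> v l = a then 1 else if v k = a \<and> v l = b then - 1 else 0) * f (v \<circ> swap_ix k l))
         - g * ((G k l + of_bool (bef ?xs ((?s \<circ> v) k) ((?s \<circ> v) l))) * f (?s \<circ> v \<circ> swap_ix k l))"
        unfolding e[OF l] by (simp only: ring_distribs add.assoc)
    qed
    also have "\<dots> = r * (\<Sum>l\<in>?A. (G k l + of_bool (bef ?xs (v k) (v l))) * f (v \<circ> swap_ix k l))
       + r * ((if v k = b then 1 else if v k = a then - 1 else 0) * f (?s \<circ> v))
       - g * (\<Sum>l\<in>?A. (G k l + of_bool (bef ?xs ((?s \<circ> v) k) ((?s \<circ> v) l))) * f (?s \<circ> v \<circ> swap_ix k l))"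
      by (simp only: sum.distrib sum_subtractf sum_distrib_left[symmetric] D)
    finally have S: "(\<Sum>l\<in>?A. (G k l + of_bool (bef ?ys (v k) (v l))) * rmat a b r g f (v \<circ> swap_ix k l)) = \<dots>" .
    define S1 where "S1 = (\<Sum>l\<in>?A. (G k l + of_bool (bef ?xs (v k) (v l))) * f (v \<circ> swap_ix k l))"
    define S2 where "S2 = (\<Sum>l\<in>?A. (G k l + of_bool (bef ?xs ((?s \<circ> v) k) ((?s \<circ> v) l))) * f (?s \<circ> v \<circ> swap_ix k l))"
    have "gaudin n G \<zeta> c ?ys k (rmat a b r g f) v = \<zeta> (v k) * (r * f v - g * f (?s \<circ> v)) - c * (r * S1
       + r * ((if v k = b then 1 else if v k = a then - 1 else 0) * f (?s \<circ> v)) - g * S2)"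
      unfolding gaudin_def S S1_def[symmetric] S2_def[symmetric] using v by (simp add: rmat_def)
    also have "\<dots> = r * (\<zeta> (v k) * f v - c * S1) - g * (\<zeta> (?s (v k)) * f (?s \<circ> v) - c * S2)
       + (g * (\<zeta> (?s (v k)) - \<zeta> (v k)) - c * r * (if v k = b then 1 else if v k = a then - 1 else 0)) * f (?s \<circ> v)"
      by (simp add: algebra_simps)
    also have "g * (\<zeta> (?s (v k)) - \<zeta> (v k)) - c * r * (if v k = b then 1 else if v k = a then - 1 else 0) = 0"
      using g anb by (auto simp: algebra_simps Transposition.transpose_def)
    also have "r * (\<zeta> (v k) * f v - c * S1) - g * (\<zeta> (?s (v k)) * f (?s \<circ> v) - c * S2) + 0 * f (?s \<circ> v)
       = rmat a b r g (gaudin n G \<zeta> c ?xs k f) v"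
      unfolding rmat_def gaudin_def S1_def S2_def using v sv by simp
    finally show ?thesis .
  next
    case False
    then show ?thesis using permutes_swap_ix_comp_iff[OF ab] by (simp add: gaudin_def rmat_def)
  qed
qed

lemma adjacent_swaps_connect:
  assumes sw: "\<And>us a b vs. mset (us @ a # b # vs) = M \<Longrightarrow> P (us @ a # b # vs) \<Longrightarrow> P (us @ b # a # vs)"
    and "mset xs = M" "mset ys = M" "P xs"
  shows "P ys"
proof -
  have move: "P (us @ ys @ x # vs)" if "P (us @ x # ys @ vs)" "mset (us @ x # ys @ vs) = M" for us x ys vs
    using that
  proof (induction ys arbitrary: us)
    case (Cons y ys)
    have "P (us @ y # x # ys @ vs)" using sw[of us x y "ys @ vs"] Cons by simp
    then show ?case using Cons.IH[of "us @ [y]"] Cons.prems by (simp add: add_mset_commute)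
  qed simp
  have "P (us @ ys)" if "mset xs = mset ys" "P (us @ xs)" "mset (us @ xs) = M" for us xs ys
    using that
  proof (induction xs arbitrary: us ys)
    case (Cons x xs)
    have "x \<in> set ys" using Cons.prems(1) by (metis list.set_intros(1) set_mset_mset)
    then obtain y1 y2 where y: "ys = y1 @ x # y2" by (auto dest: split_list)
    have "mset xs = mset (y1 @ y2)" using Cons.prems(1) y by simp
    moreover have "P ((us @ [x]) @ xs)" "mset ((us @ [x]) @ xs) = M" using Cons.prems(2,3) by simp_all
    ultimately have "P ((us @ [x]) @ (y1 @ y2))" by (rule Cons.IH)
    then show ?case using move[of us x y1 y2] \<open>mset xs = mset (y1 @ y2)\<close> Cons.prems(3) y by simp
  qed simp
  from this[of xs ys "[]"] show ?thesis using assms by simp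
qed

definition gaudin_eigenvalue where
  "gaudin_eigenvalue n G \<zeta> c xs k \<alpha> \<longleftrightarrow> (\<exists>f. (\<exists>v. v permutes {..<n} \<and> f v \<noteq> 0)
     \<and> (\<forall>v. v permutes {..<n} \<longrightarrow> gaudin n G \<zeta> c xs k f v = \<alpha> * f v))"

text \<open>The homogeneous R-matrix with r = \<open>\<zeta> a - \<zeta> b\<close> and g = c carries
  eigenvectors to eigenvectors of the swapped order, and by unitarity it does not annihilate them.
  The condition concerns all pairs of letters, including those from different groups.\<close>

lemma gaudin_eigenvalue_reorder:
  assumes ne: "\<And>i j. i < n \<Longrightarrow> j < n \<Longrightarrow> i \<noteq> j \<Longrightarrow> (\<zeta> i - \<zeta> j)^2 \<noteq> c^2" and k: "k < n"
    and xs: "distinct xs" "set xs = {..<n}" and ys: "distinct ys" "set ys = {..<n}"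
    and ev: "gaudin_eigenvalue n G \<zeta> c xs k \<alpha>"
  shows "gaudin_eigenvalue n G \<zeta> c ys k \<alpha>"
proof (rule adjacent_swaps_connect[of "mset xs" "\<lambda>xs. gaudin_eigenvalue n G \<zeta> c xs k \<alpha>"])
  fix us a b vs
  assume m: "mset (us @ a # b # vs) = mset xs" and P: "gaudin_eigenvalue n G \<zeta> c (us @ a # b # vs) k \<alpha>"
  have d: "distinct (us @ a # b # vs)" using m xs(1) by (metis mset_eq_imp_distinct_iff)
  have "set (us @ a # b # vs) = {..<n}" using m xs(2) by (metis mset_eq_setD)
  then have ab: "a < n" "b < n" by auto
  from P obtain f v where f: "v permutes {..<n}" "f v \<noteq> 0"
    "\<And>v. v permutes {..<n} \<Longrightarrow> gaudin n G \<zeta> c (us @ a # b # vs) k f v = \<alpha> * f v"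
    unfolding gaudin_eigenvalue_def by blast
  let ?r = "\<zeta> a - \<zeta> b"
  let ?f = "rmat a b ?r c f"
  have "gaudin n G \<zeta> c (us @ b # a # vs) k ?f v = \<alpha> * ?f v" if "v permutes {..<n}" for v
    using f(3)[OF that] f(3)[OF permutes_swap_ix_comp[OF that ab]]
    by (subst gaudin_rmat_intertwine[OF d ab k]) (simp_all add: rmat_def algebra_simps)
  moreover have "\<exists>v. v permutes {..<n} \<and> ?f v \<noteq> 0"
  proof (rule ccontr)
    assume "\<not> ?thesis"
    then have z: "\<And>v. v permutes {..<n} \<Longrightarrow> ?f v = 0" by auto
    have "rmat a b ?r (- c) ?f v = 0" using z[OF f(1)] z[OF permutes_swap_ix_comp[OF f(1) ab]] by (simp add: rmat_def[of a b ?r "- c"])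
    then have "?r^2 = c^2" using f(2) unfolding rmat_rmat by simp
    then show False using ne[OF ab] d by auto
  qed
  ultimately show "gaudin_eigenvalue n G \<zeta> c (us @ b # a # vs) k \<alpha>" unfolding gaudin_eigenvalue_def by blast
qed (use xs ys ev in \<open>auto simp: set_eq_iff_mset_eq_distinct[symmetric]\<close>)

section \<open>The Hermitian form\<close>

lemma rmat_lin: "lin (rmat a b r g)"
  by (rule linI) (simp_all add: rmat_def algebra_simps)

lemma rmat_commute_disjoint:
  assumes "a \<noteq> x" "a \<noteq> y" "b \<noteq> x" "b \<noteq> y"
  shows "rmat a b r g (rmat x y r' g' f) = rmat x y r' g' (rmat a b r g f)"
proof
  fix v :: "nat \<Rightarrow> nat"
  have "swap_ix x y \<circ> (swap_ix a b \<circ> v) = swap_ix a b \<circ> (swap_ix x y \<circ> v)"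
    using assms by (auto simp: fun_eq_iff Transposition.transpose_def)
  then show "rmat a b r g (rmat x y r' g' f) v = rmat x y r' g' (rmat a b r g f) v"
    by (simp add: rmat_def algebra_simps)
qed

text \<open>The hypothesis on the coefficients is the addition rule satisfied by c / (z x - z y). It
  matches the two products of two transpositions that occur with different coefficients; the
  remaining products coincide as permutations.\<close>

lemma yang_baxter:
  assumes d: "x \<noteq> y" "x \<noteq> z" "y \<noteq> z" and g: "gxy * gyz = gxz * (gxy + gyz)"
  shows "rmat y z 1 gyz (rmat x z 1 gxz (rmat x y 1 gxy f)) = rmat x y 1 gxy (rmat x z 1 gxz (rmat y z 1 gyz f))"
proof
  fix v :: "nat \<Rightarrow> nat"
  have L3: "rmat a b 1 p (rmat c e 1 q (rmat k l 1 r f)) v = f v - r * f (swap_ix k l \<circ> v) - q * f (swap_ix c e \<circ> v)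
      - p * f (swap_ix a b \<circ> v) + q * r * f (swap_ix k l \<circ> (swap_ix c e \<circ> v))
      + p * r * f (swap_ix k l \<circ> (swap_ix a b \<circ> v)) + p * q * f (swap_ix c e \<circ> (swap_ix a b \<circ> v))
      - p * q * r * f (swap_ix k l \<circ> (swap_ix c e \<circ> (swap_ix a b \<circ> v)))" for a b c e k l p q r
    by (simp add: rmat_def algebra_simps)
  have "swap_ix x y \<circ> (swap_ix x z \<circ> v) = swap_ix x z \<circ> (swap_ix y z \<circ> v)"
    "swap_ix y z \<circ> (swap_ix x y \<circ> v) = swap_ix x z \<circ> (swap_ix y z \<circ> v)"
    "swap_ix x z \<circ> (swap_ix x y \<circ> v) = swap_ix x y \<circ> (swap_ix y z \<circ> v)"
    "swap_ix y z \<circ> (swap_ix x z \<circ> v) = swap_ix x y \<circ> (swap_ix y z \<circ> v)"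
    "swap_ix y z \<circ> (swap_ix x z \<circ> (swap_ix x y \<circ> v)) = swap_ix x y \<circ> (swap_ix x z \<circ> (swap_ix y z \<circ> v))"
    using d by (auto simp: fun_eq_iff Transposition.transpose_def)
  note e = this[THEN arg_cong[of _ _ f]]
  have "gxy * gyz * A = gxz * gxy * A + gxz * gyz * A" for A
    using g by (simp add: algebra_simps)
  from this[of "f (swap_ix x z \<circ> (swap_ix y z \<circ> v))"] this[of "f (swap_ix x y \<circ> (swap_ix y z \<circ> v))"]
  show "rmat y z 1 gyz (rmat x z 1 gxz (rmat x y 1 gxy f)) v = rmat x y 1 gxy (rmat x z 1 gxz (rmat y z 1 gyz f)) v"
    unfolding L3 e by (simp add: algebra_simps)
qed

text \<open>Mv moves the letter x behind all letters of ys, and Kop reverses the order of the letters.\<close>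

fun Mv :: "(nat \<Rightarrow> nat \<Rightarrow> complex) \<Rightarrow> nat \<Rightarrow> nat list \<Rightarrow> (nat \<Rightarrow> nat) op" where
  "Mv g x [] f = f"
| "Mv g x (y # ys) f = Mv g x ys (rmat x y 1 (g x y) f)"

fun Kop :: "(nat \<Rightarrow> nat \<Rightarrow> complex) \<Rightarrow> nat list \<Rightarrow> (nat \<Rightarrow> nat) op" where
  "Kop g [] f = f"
| "Kop g (x # xs) f = Kop g xs (Mv g x xs f)"

lemma Mv_snoc: "Mv g x (ys @ [y]) f = rmat x y 1 (g x y) (Mv g x ys f)"
  by (induction ys arbitrary: f) auto

lemma rmat_Mv_commute:
  assumes "a \<noteq> x" "b \<noteq> x" "a \<notin> set ys" "b \<notin> set ys"
  shows "rmat a b r h (Mv g x ys f) = Mv g x ys (rmat a b r h f)"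
  using assms
proof (induction ys arbitrary: f)
  case (Cons y ys)
  then show ?case using rmat_commute_disjoint[of a x y b] by simp
qed simp

lemma rmat_Kop_commute:
  assumes "a \<notin> set xs" "b \<notin> set xs"
  shows "rmat a b r h (Kop g xs f) = Kop g xs (rmat a b r h f)"
  using assms by (induction xs arbitrary: f) (auto simp: rmat_Mv_commute)

definition ybe_on :: "nat set \<Rightarrow> (nat \<Rightarrow> nat \<Rightarrow> complex) \<Rightarrow> bool" where
  "ybe_on A g \<longleftrightarrow> (\<forall>x\<in>A. \<forall>y\<in>A. \<forall>z\<in>A. x \<noteq> y \<longrightarrow> x \<noteq> z \<longrightarrow> y \<noteq> z \<longrightarrow> g x y * g y z = g x z * (g x y + g y z))"

lemma ybe_on_mono: "ybe_on B g \<Longrightarrow> A \<subseteq> B \<Longrightarrow> ybe_on A g"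
  unfolding ybe_on_def by blast

text \<open>Moving x and y past \<open>zs\<close> gives the same result whether they are exchanged
  before or after; each letter of \<open>zs\<close> costs one Yang-Baxter move.\<close>

lemma Mv_Mv:
  assumes "distinct (x # y # zs)" "ybe_on (insert x (insert y (set zs))) g"
  shows "Mv g y zs (Mv g x zs (rmat x y 1 (g x y) f)) = rmat x y 1 (g x y) (Mv g x zs (Mv g y zs f))"
  using assms
proof (induction zs arbitrary: f)
  case (Cons z zs)
  have "g x y * g y z = g x z * (g x y + g y z)" using Cons.prems by (auto simp: ybe_on_def)
  then have yb: "rmat y z 1 (g y z) (rmat x z 1 (g x z) (rmat x y 1 (g x y) f)) = rmat x y 1 (g x y) (rmat x z 1 (g x z) (rmat y z 1 (g y z) f))"
    using Cons.prems by (intro yang_baxter) auto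
  have IH: "Mv g y zs (Mv g x zs (rmat x y 1 (g x y) f)) = rmat x y 1 (g x y) (Mv g x zs (Mv g y zs f))" for f
  proof (rule Cons.IH)
    show "ybe_on (insert x (insert y (set zs))) g" using Cons.prems(2) by (rule ybe_on_mono) auto
  qed (use Cons.prems in auto)
  have "Mv g y (z # zs) (Mv g x (z # zs) (rmat x y 1 (g x y) f))
    = Mv g y zs (Mv g x zs (rmat y z 1 (g y z) (rmat x z 1 (g x z) (rmat x y 1 (g x y) f))))"
    using Cons.prems by (simp add: rmat_Mv_commute)
  also have "\<dots> = rmat x y 1 (g x y) (Mv g x (z # zs) (Mv g y (z # zs) f))"
    unfolding yb IH using Cons.prems by (simp add: rmat_Mv_commute)
  finally show ?case .
qed simp

text \<open>The reversal can be built with x moved first or moved last. The second form lists the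
  factors in the opposite order, which is how the adjoint of the first one appears.\<close>

lemma Kop_Mv:
  assumes "distinct (x # xs)" "ybe_on (insert x (set xs)) g"
  shows "Kop g xs (Mv g x xs f) = Mv g x (rev xs) (Kop g xs f)"
  using assms
proof (induction xs arbitrary: f)
  case (Cons y ys)
  have IH: "Kop g ys (Mv g x ys f) = Mv g x (rev ys) (Kop g ys f)" for f
  proof (rule Cons.IH)
    show "ybe_on (insert x (set ys)) g" using Cons.prems(2) by (rule ybe_on_mono) auto
  qed (use Cons.prems in auto)
  have "Kop g (y # ys) (Mv g x (y # ys) f) = Kop g ys (Mv g y ys (Mv g x ys (rmat x y 1 (g x y) f)))" by simp
  also have "\<dots> = Kop g ys (rmat x y 1 (g x y) (Mv g x ys (Mv g y ys f)))"
    using Cons.prems by (subst Mv_Mv) auto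
  also have "\<dots> = rmat x y 1 (g x y) (Kop g ys (Mv g x ys (Mv g y ys f)))"
    using Cons.prems by (subst rmat_Kop_commute) auto
  also have "\<dots> = Mv g x (rev (y # ys)) (Kop g (y # ys) f)"
    by (simp add: IH Mv_snoc)
  finally show ?case .
qed simp

lemma Mv_lin: "lin (Mv g x ys)"
proof (induction ys)
  case (Cons y ys)
  then show ?case by (intro linI) (simp_all add: lin_add[OF rmat_lin] lin_scale[OF rmat_lin] lin_add lin_scale)
qed (simp add: lin_def)

lemma Kop_lin: "lin (Kop g xs)"
proof (induction xs)
  case (Cons y ys)
  then show ?case by (intro linI) (simp_all add: lin_add[OF Mv_lin] lin_scale[OF Mv_lin] lin_add lin_scale)
qed (simp add: lin_def)

lemma gaudin_Mv_intertwine: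
  assumes "distinct (us @ x # ys @ vs)" "\<And>y. y \<in> insert x (set ys) \<Longrightarrow> y < n" "k < n"
    and "\<And>a b. a \<in> insert x (set ys) \<Longrightarrow> b \<in> insert x (set ys) \<Longrightarrow> a \<noteq> b \<Longrightarrow> g a b * (\<zeta> a - \<zeta> b) = c"
  shows "gaudin n G \<zeta> c (us @ ys @ x # vs) k (Mv g x ys f) = Mv g x ys (gaudin n G \<zeta> c (us @ x # ys @ vs) k f)"
  using assms
proof (induction ys arbitrary: us f)
  case (Cons y ys)
  have "gaudin n G \<zeta> c ((us @ [y]) @ ys @ x # vs) k (Mv g x ys (rmat x y 1 (g x y) f))
    = Mv g x ys (gaudin n G \<zeta> c ((us @ [y]) @ x # ys @ vs) k (rmat x y 1 (g x y) f))"
  proof (rule Cons.IH)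
    show "distinct ((us @ [y]) @ x # ys @ vs)" using Cons.prems(1) by auto
    show "a < n" if "a \<in> insert x (set ys)" for a using that by (intro Cons.prems(2)) auto
    show "g a b * (\<zeta> a - \<zeta> b) = c" if "a \<in> insert x (set ys)" "b \<in> insert x (set ys)" "a \<noteq> b" for a b
      using that by (intro Cons.prems(4)) auto
  qed (rule Cons.prems(3))
  also have "gaudin n G \<zeta> c ((us @ [y]) @ x # ys @ vs) k (rmat x y 1 (g x y) f)
    = rmat x y 1 (g x y) (gaudin n G \<zeta> c (us @ x # y # ys @ vs) k f)"
  proof -
    have "x < n" "y < n" by (rule Cons.prems(2); simp)+
    moreover have "g x y * (\<zeta> x - \<zeta> y) = c * 1"
      using Cons.prems(4)[of x y] Cons.prems(1) by simp
    ultimately show ?thesis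
      using gaudin_rmat_intertwine[of us x y "ys @ vs" n k "g x y" \<zeta> c 1 G f] Cons.prems(1,3) by simp
  qed
  finally show ?case by simp
qed simp

text \<open>The surrounding lists \<open>us\<close> and \<open>vs\<close> keep their order, so that
  each group of letters can be reversed on its own.\<close>

lemma gaudin_Kop_intertwine:
  assumes "distinct (us @ xs @ vs)" "\<And>y. y \<in> set xs \<Longrightarrow> y < n" "k < n"
    and "\<And>a b. a \<in> set xs \<Longrightarrow> b \<in> set xs \<Longrightarrow> a \<noteq> b \<Longrightarrow> g a b * (\<zeta> a - \<zeta> b) = c"
  shows "gaudin n G \<zeta> c (us @ rev xs @ vs) k (Kop g xs f) = Kop g xs (gaudin n G \<zeta> c (us @ xs @ vs) k f)"
  using assms
proof (induction xs arbitrary: vs f)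
  case (Cons x xs)
  have "gaudin n G \<zeta> c (us @ rev xs @ (x # vs)) k (Kop g xs (Mv g x xs f))
    = Kop g xs (gaudin n G \<zeta> c (us @ xs @ (x # vs)) k (Mv g x xs f))"
  proof (rule Cons.IH)
    show "distinct (us @ xs @ x # vs)" using Cons.prems(1) by auto
    show "a < n" if "a \<in> set xs" for a using that by (intro Cons.prems(2)) auto
    show "g a b * (\<zeta> a - \<zeta> b) = c" if "a \<in> set xs" "b \<in> set xs" "a \<noteq> b" for a b
      using that by (intro Cons.prems(4)) auto
  qed (rule Cons.prems(3))
  also have "gaudin n G \<zeta> c (us @ xs @ x # vs) k (Mv g x xs f) = Mv g x xs (gaudin n G \<zeta> c (us @ x # xs @ vs) k f)"
    by (rule gaudin_Mv_intertwine) (use Cons.prems in simp_all)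
  finally show ?case by simp
qed simp

lemma Mv_injective:
  assumes "\<And>y. y \<in> set ys \<Longrightarrow> (g x y)^2 \<noteq> 1" "\<And>y. y \<in> insert x (set ys) \<Longrightarrow> y < n"
    and "\<And>v. v permutes {..<n} \<Longrightarrow> Mv g x ys f v = 0" and "v permutes {..<n}"
  shows "f v = 0"
  using assms
proof (induction ys arbitrary: f v)
  case (Cons y ys)
  have xy: "x < n" "y < n" by (rule Cons.prems(2); simp)+
  have z: "rmat x y 1 (g x y) f v = 0" if "v permutes {..<n}" for v
  proof (rule Cons.IH[OF _ _ _ that])
    show "(g x z)\<^sup>2 \<noteq> 1" if "z \<in> set ys" for z using that by (intro Cons.prems(1)) simp
    show "z < n" if "z \<in> insert x (set ys)" for z using that by (intro Cons.prems(2)) auto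
    show "Mv g x ys (rmat x y 1 (g x y) f) u = 0" if "u permutes {..<n}" for u
      using Cons.prems(3)[OF that] by simp
  qed
  have "rmat x y 1 (- g x y) (rmat x y 1 (g x y) f) v = 0"
    using z[OF Cons.prems(4)] z[OF permutes_swap_ix_comp[OF Cons.prems(4) xy]] by (simp add: rmat_def[of x y 1 "- g x y"])
  then show ?case unfolding rmat_rmat using Cons.prems(1)[of y] by simp
qed simp

lemma Kop_injective:
  assumes "\<And>x y. x \<in> set xs \<Longrightarrow> y \<in> set xs \<Longrightarrow> x \<noteq> y \<Longrightarrow> (g x y)^2 \<noteq> 1" "distinct xs" "\<And>y. y \<in> set xs \<Longrightarrow> y < n"
    and "\<And>v. v permutes {..<n} \<Longrightarrow> Kop g xs f v = 0" and "v permutes {..<n}"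
  shows "f v = 0"
  using assms
proof (induction xs arbitrary: f v)
  case (Cons x xs)
  have z: "Mv g x xs f v = 0" if "v permutes {..<n}" for v
  proof (rule Cons.IH[OF _ _ _ _ that])
    show "(g a b)\<^sup>2 \<noteq> 1" if "a \<in> set xs" "b \<in> set xs" "a \<noteq> b" for a b using that by (intro Cons.prems(1)) simp_all
    show "distinct xs" using Cons.prems(2) by simp
    show "b < n" if "b \<in> set xs" for b using that by (intro Cons.prems(3)) simp
    show "Kop g xs (Mv g x xs f) u = 0" if "u permutes {..<n}" for u
      using Cons.prems(4)[OF that] by simp
  qed
  show ?case
  proof (rule Mv_injective[OF _ _ z Cons.prems(5)])
    show "(g x b)\<^sup>2 \<noteq> 1" if "b \<in> set xs" for b using that Cons.prems(2) by (intro Cons.prems(1)) auto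
    show "b < n" if "b \<in> insert x (set xs)" for b using that by (intro Cons.prems(3)) simp
  qed
qed simp

section \<open>Weighted Hermitian forms and adjoints\<close>

definition form :: "'x set \<Rightarrow> ('x \<Rightarrow> real) \<Rightarrow> ('x \<Rightarrow> complex) \<Rightarrow> ('x \<Rightarrow> complex) \<Rightarrow> complex" where
  "form S d f h = (\<Sum>v\<in>S. complex_of_real (d v) * f v * cnj (h v))"

definition adj :: "'x set \<Rightarrow> ('x \<Rightarrow> real) \<Rightarrow> 'x op \<Rightarrow> 'x op \<Rightarrow> bool" where
  "adj S d A B \<longleftrightarrow> (\<forall>f h. form S d (A f) h = form S d f (B h))"

lemma adj_comp: "adj S d A B \<Longrightarrow> adj S d A' B' \<Longrightarrow> adj S d (\<lambda>f. A (A' f)) (\<lambda>f. B' (B f))"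
  by (simp add: adj_def)

lemma rmat_adj:
  assumes ab: "a < n" "b < n" and g: "g \<in> \<real>"
    and d: "\<And>v. v permutes {..<n} \<Longrightarrow> d (swap_ix a b \<circ> v) = d v"
  shows "adj {v. v permutes {..<n}} d (rmat a b 1 g) (rmat a b 1 g)"
  unfolding adj_def
proof (intro allI)
  fix f h
  let ?S = "{v. v permutes {..<n}}" and ?s = "swap_ix a b"
  have "(\<Sum>v\<in>?S. complex_of_real (d v) * f (?s \<circ> v) * cnj (h v)) = (\<Sum>v\<in>?S. complex_of_real (d v) * f v * cnj (h (?s \<circ> v)))"
    by (rule sum.reindex_bij_witness[of _ "\<lambda>v. ?s \<circ> v" "\<lambda>v. ?s \<circ> v"])
      (auto simp: permutes_swap_ix_comp ab d comp_assoc[symmetric])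
  moreover have "cnj g = g" using g by (simp add: Reals_cnj_iff)
  moreover have "form ?S d (rmat a b 1 g f) h = form ?S d f h - g * (\<Sum>v\<in>?S. complex_of_real (d v) * f (?s \<circ> v) * cnj (h v))"
    by (simp add: form_def rmat_def sum_distrib_left sum_subtractf[symmetric] algebra_simps)
  moreover have "form ?S d f (rmat a b 1 g h) = form ?S d f h - cnj g * (\<Sum>v\<in>?S. complex_of_real (d v) * f v * cnj (h (?s \<circ> v)))"
    by (simp add: form_def rmat_def sum_distrib_left sum_subtractf[symmetric] algebra_simps)
  ultimately show "form ?S d (rmat a b 1 g f) h = form ?S d f (rmat a b 1 g h)" by simp
qed

lemma Mv_adj:
  assumes "\<And>y. y \<in> insert x (set ys) \<Longrightarrow> y < n" "\<And>y. y \<in> set ys \<Longrightarrow> g x y \<in> \<real>"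
    and "\<And>y v. y \<in> set ys \<Longrightarrow> v permutes {..<n} \<Longrightarrow> d (swap_ix x y \<circ> v) = d v"
  shows "adj {v. v permutes {..<n}} d (Mv g x ys) (Mv g x (rev ys))"
  using assms
proof (induction ys)
  case (Cons y ys)
  have "adj {v. v permutes {..<n}} d (\<lambda>f. Mv g x ys (rmat x y 1 (g x y) f)) (\<lambda>f. rmat x y 1 (g x y) (Mv g x (rev ys) f))"
  proof (rule adj_comp[OF Cons.IH rmat_adj])
    show "a < n" if "a \<in> insert x (set ys)" for a using that by (intro Cons.prems(1)) auto
    show "g x a \<in> \<real>" if "a \<in> set ys" for a using that by (intro Cons.prems(2)) simp
    show "d (swap_ix x a \<circ> v) = d v" if "a \<in> set ys" "v permutes {..<n}" for a v using that by (intro Cons.prems(3)) simp_all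
    show "x < n" "y < n" by (rule Cons.prems(1); simp)+
    show "g x y \<in> \<real>" by (rule Cons.prems(2)) simp
    show "d (swap_ix x y \<circ> v) = d v" if "v permutes {..<n}" for v using that by (intro Cons.prems(3)) simp_all
  qed
  then show ?case by (simp add: adj_def Mv_snoc)
qed (simp add: adj_def)

text \<open>Each factor is self-adjoint since \<open>g\<close> is real and the weight is invariant
  under the letter swaps. Adjunction reverses the order of the factors, and \<open>Kop_Mv\<close>
  identifies the reversed product with the original one.\<close>

lemma Kop_adj:
  assumes "distinct xs" "\<And>y. y \<in> set xs \<Longrightarrow> y < n" "ybe_on (set xs) g"
    and "\<And>x y. x \<in> set xs \<Longrightarrow> y \<in> set xs \<Longrightarrow> g x y \<in> \<real>"
    and "\<And>x y v. x \<in> set xs \<Longrightarrow> y \<in> set xs \<Longrightarrow> v permutes {..<n} \<Longrightarrow> d (swap_ix x y \<circ> v) = d v"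
  shows "adj {v. v permutes {..<n}} d (Kop g xs) (Kop g xs)"
  using assms
proof (induction xs)
  case (Cons x xs)
  have "adj {v. v permutes {..<n}} d (Kop g xs) (Kop g xs)"
  proof (rule Cons.IH)
    show "distinct xs" using Cons.prems(1) by simp
    show "ybe_on (set xs) g" using Cons.prems(3) by (rule ybe_on_mono) auto
    show "a < n" if "a \<in> set xs" for a using that by (intro Cons.prems(2)) simp
    show "g a b \<in> \<real>" if "a \<in> set xs" "b \<in> set xs" for a b using that by (intro Cons.prems(4)) simp_all
    show "d (swap_ix a b \<circ> v) = d v" if "a \<in> set xs" "b \<in> set xs" "v permutes {..<n}" for a b v
      using that by (intro Cons.prems(5)) simp_all
  qed
  moreover have "adj {v. v permutes {..<n}} d (Mv g x xs) (Mv g x (rev xs))"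
  proof (rule Mv_adj)
    show "a < n" if "a \<in> insert x (set xs)" for a using that by (intro Cons.prems(2)) simp
    show "g x a \<in> \<real>" if "a \<in> set xs" for a using that by (intro Cons.prems(4)) simp_all
    show "d (swap_ix x a \<circ> v) = d v" if "a \<in> set xs" "v permutes {..<n}" for a v
      using that by (intro Cons.prems(5)) simp_all
  qed
  ultimately have "adj {v. v permutes {..<n}} d (\<lambda>f. Kop g xs (Mv g x xs f)) (\<lambda>f. Mv g x (rev xs) (Kop g xs f))"
    by (rule adj_comp)
  moreover have "Mv g x (rev xs) (Kop g xs f) = Kop g xs (Mv g x xs f)" for f
    by (rule Kop_Mv[symmetric]) (use Cons.prems(1,3) in simp_all)
  ultimately show ?case by (simp add: adj_def)
qed (simp add: adj_def)

section \<open>Compactness and positivity along a path of forms\<close>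

lemma finite_bounded_subseq_real:
  fixes F :: "nat \<Rightarrow> 'x \<Rightarrow> real"
  assumes "finite S" "\<And>m v. v \<in> S \<Longrightarrow> \<bar>F m v\<bar> \<le> B"
  shows "\<exists>r. strict_mono r \<and> (\<forall>v\<in>S. convergent (\<lambda>m. F (r m) v))"
  using assms
proof (induction S)
  case empty
  show ?case by (rule exI[of _ id]) (simp add: strict_mono_def)
next
  case (insert u S)
  have "\<exists>r. strict_mono r \<and> (\<forall>v\<in>S. convergent (\<lambda>m. F (r m) v))"
    by (rule insert.IH) (rule insert.prems, simp)
  then obtain r :: "nat \<Rightarrow> nat" where r: "strict_mono r" "\<forall>v\<in>S. convergent (\<lambda>m. F (r m) v)" by blast
  obtain s :: "nat \<Rightarrow> nat" where s: "strict_mono s" "monoseq (\<lambda>m. F (r (s m)) u)"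
    using seq_monosub[of "\<lambda>m. F (r m) u"] by blast
  have "Bseq (\<lambda>m. F (r (s m)) u)" by (rule BseqI'[of _ B]) (simp add: insert.prems)
  then have "convergent (\<lambda>m. F (r (s m)) u)" using s(2) by (rule Bseq_monoseq_convergent)
  moreover have "convergent (\<lambda>m. F (r (s m)) v)" if "v \<in> S" for v
    using convergent_subseq_convergent[OF bspec[OF r(2) that] s(1)] by (simp add: comp_def)
  ultimately have "\<forall>v\<in>insert u S. convergent (\<lambda>m. F ((r \<circ> s) m) v)" by simp
  then show ?case using strict_mono_o[OF r(1) s(1)] by blast
qed

lemma finite_bounded_subseq:
  fixes F :: "nat \<Rightarrow> 'x \<Rightarrow> complex"
  assumes S: "finite S" and B: "\<And>m v. v \<in> S \<Longrightarrow> cmod (F m v) \<le> B"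
  shows "\<exists>r f. strict_mono r \<and> (\<forall>v\<in>S. (\<lambda>m. F (r m) v) \<longlonglongrightarrow> f v)"
proof -
  have Reb: "\<bar>Re (F m v)\<bar> \<le> B" if "v \<in> S" for m v using B[OF that, of m] abs_Re_le_cmod[of "F m v"] by linarith
  have "\<exists>r. strict_mono r \<and> (\<forall>v\<in>S. convergent (\<lambda>m. Re (F (r m) v)))"
    by (rule finite_bounded_subseq_real[OF S]) (rule Reb)
  then obtain r :: "nat \<Rightarrow> nat" where r: "strict_mono r" "\<forall>v\<in>S. convergent (\<lambda>m. Re (F (r m) v))" by blast
  have Imb: "\<bar>Im (F (r m) v)\<bar> \<le> B" if "v \<in> S" for m v using B[OF that, of "r m"] abs_Im_le_cmod[of "F (r m) v"] by linarith
  have "\<exists>s. strict_mono s \<and> (\<forall>v\<in>S. convergent (\<lambda>m. Im (F (r (s m)) v)))"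
    by (rule finite_bounded_subseq_real[OF S]) (rule Imb)
  then obtain s :: "nat \<Rightarrow> nat" where s: "strict_mono s" "\<forall>v\<in>S. convergent (\<lambda>m. Im (F (r (s m)) v))" by blast
  have "\<exists>l. (\<lambda>m. F ((r \<circ> s) m) v) \<longlonglongrightarrow> l" if v: "v \<in> S" for v
  proof -
    have "convergent (\<lambda>m. Re (F (r (s m)) v))"
      using convergent_subseq_convergent[OF bspec[OF r(2) v] s(1)] by (simp only: comp_def)
    then obtain x where x: "(\<lambda>m. Re (F (r (s m)) v)) \<longlonglongrightarrow> x" unfolding convergent_def ..
    obtain y where y: "(\<lambda>m. Im (F (r (s m)) v)) \<longlonglongrightarrow> y" using bspec[OF s(2) v] unfolding convergent_def ..
    have "(\<lambda>m. F ((r \<circ> s) m) v) \<longlonglongrightarrow> Complex x y"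
      unfolding tendsto_complex_iff comp_apply complex.sel using x y by (rule conjI)
    then show ?thesis ..
  qed
  then have "\<forall>v\<in>S. \<exists>l. (\<lambda>m. F ((r \<circ> s) m) v) \<longlonglongrightarrow> l" by (rule ballI)
  from bchoice[OF this] have "\<exists>f. \<forall>v\<in>S. (\<lambda>m. F ((r \<circ> s) m) v) \<longlonglongrightarrow> f v" .
  then show ?thesis using strict_mono_o[OF r(1) s(1)] by blast
qed

lemma form_add_left: "form S d (\<lambda>v. f v + g v) h = form S d f h + form S d g h"
  and form_add_right: "form S d f (\<lambda>v. g v + h v) = form S d f g + form S d f h"
  and form_scale_left: "form S d (\<lambda>v. r * f v) h = r * form S d f h"
  and form_scale_right: "form S d f (\<lambda>v. r * h v) = cnj r * form S d f h"
  by (simp_all add: form_def algebra_simps sum.distrib sum_distrib_left)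

lemma form_self: "form S d f f = of_real (\<Sum>v\<in>S. d v * (cmod (f v))\<^sup>2)"
  by (simp add: form_def mult.assoc complex_norm_square[symmetric] del: of_real_power)

lemma tendsto_form:
  assumes "\<And>v. v \<in> S \<Longrightarrow> (\<lambda>m. F m v) \<longlonglongrightarrow> f v" "\<And>v. v \<in> S \<Longrightarrow> (\<lambda>m. E m v) \<longlonglongrightarrow> h v"
  shows "(\<lambda>m. form S d (F m) (E m)) \<longlonglongrightarrow> form S d f h"
  unfolding form_def using assms by (intro tendsto_sum tendsto_mult tendsto_const tendsto_cnj) auto

text \<open>At a first failure time the form would be semidefinite with a null vector, which then
  lies in the kernel of the operator.\<close>

lemma positive_definite_path:
  fixes K :: "real \<Rightarrow> 'x op"
  assumes S: "finite S" and d: "\<And>v. v \<in> S \<Longrightarrow> d v > 0"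
    and K0: "\<And>f v. v \<in> S \<Longrightarrow> K 0 f v = f v"
    and ad: "\<And>c. 0 \<le> c \<Longrightarrow> c < 1 \<Longrightarrow> adj S d (K c) (K c)"
    and li: "\<And>c. lin (K c)"
    and cont: "\<And>X c F f v. X \<longlonglongrightarrow> c \<Longrightarrow> (\<And>v. v \<in> S \<Longrightarrow> (\<lambda>m. F m v) \<longlonglongrightarrow> f v) \<Longrightarrow> v \<in> S \<Longrightarrow>
      (\<lambda>m. K (X m) (F m) v) \<longlonglongrightarrow> K c f v"
    and inj: "\<And>c f v. 0 \<le> c \<Longrightarrow> c < 1 \<Longrightarrow> (\<And>v. v \<in> S \<Longrightarrow> K c f v = 0) \<Longrightarrow> v \<in> S \<Longrightarrow> f v = 0"
    and c: "0 \<le> c" "c < 1" and f: "v0 \<in> S" "f v0 \<noteq> 0"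
  shows "Re (form S d f (K c f)) > 0"
proof (rule ccontr)
  define b where "b c f = Re (form S d f (K c f))" for c f
  define N where "N f = (\<Sum>v\<in>S. d v * (cmod (f v))\<^sup>2)" for f
  assume "\<not> ?thesis"
  then have bf: "b c f \<le> 0" by (simp add: b_def)
  have N0: "N f \<ge> 0" for f unfolding N_def using d by (intro sum_nonneg) (simp add: less_imp_le)
  have Npos: "N f > 0" if "v \<in> S" "f v \<noteq> 0" for f v
    unfolding N_def using d that by (intro sum_pos2[OF S that(1)]) (auto simp: less_imp_le)
  have b_scale: "b c (\<lambda>v. of_real t * f v) = t\<^sup>2 * b c f" for c t f
    by (simp add: b_def lin_scale[OF li] form_scale_left form_scale_right power2_eq_square)
  have b_tendsto: "(\<lambda>m. b (X m) (F m)) \<longlonglongrightarrow> b c f"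
    if "X \<longlonglongrightarrow> c" "\<And>v. v \<in> S \<Longrightarrow> (\<lambda>m. F m v) \<longlonglongrightarrow> f v" for X c F f
    unfolding b_def by (intro tendsto_Re tendsto_form cont) (use that in auto)
  \<comment> \<open>The times at which positivity fails. Witnesses are normalized so that a limit of
    witnesses is again nonzero; \<open>AI\<close> rescales an arbitrary witness.\<close>
  define A where "A = {c. 0 \<le> c \<and> c < 1 \<and> (\<exists>f. N f = 1 \<and> b c f \<le> 0)}"
  have AI: "x \<in> A" if "0 \<le> x" "x < 1" "v \<in> S" "h v \<noteq> 0" "b x h \<le> 0" for x v h
  proof -
    have n: "N h > 0" using Npos that by auto
    let ?t = "1 / sqrt (N h)"
    have t2: "?t\<^sup>2 = 1 / N h" using n by (simp add: power_divide)
    have "N (\<lambda>v. of_real ?t * h v) = ?t\<^sup>2 * N h"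
      unfolding N_def sum_distrib_left by (intro sum.cong) (simp_all add: norm_mult power_mult_distrib norm_divide power_divide)
    then have "N (\<lambda>v. of_real ?t * h v) = 1" using n t2 by simp
    moreover have "b x (\<lambda>v. of_real ?t * h v) \<le> 0" unfolding b_scale using that(5) by (simp add: mult_nonneg_nonpos)
    ultimately have "\<exists>f. N f = 1 \<and> b x f \<le> 0" by (intro exI conjI)
    then show ?thesis using that(1,2) by (simp add: A_def)
  qed
  have cA: "c \<in> A" using AI[OF c f(1) f(2) bf] .
  have bdd: "bdd_below A" by (rule bdd_belowI[of _ 0]) (auto simp: A_def)
  define c0 where "c0 = Inf A"
  have c0: "0 \<le> c0" "c0 < 1"
  proof -
    show "0 \<le> c0" unfolding c0_def by (rule cInf_greatest) (use cA in \<open>auto simp: A_def\<close>)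
    show "c0 < 1" using cInf_lower[OF cA bdd] c unfolding c0_def by linarith
  qed
  have "\<exists>p. fst p \<in> A \<and> fst p < c0 + 1 / real (Suc m) \<and> N (snd p) = 1 \<and> b (fst p) (snd p) \<le> 0" for m
  proof -
    have "A \<noteq> {}" using cA by blast
    have "Inf A < c0 + 1 / real (Suc m)" by (simp add: c0_def)
    then obtain x where x: "x \<in> A" "x < c0 + 1 / real (Suc m)"
      unfolding cInf_less_iff[OF \<open>A \<noteq> {}\<close> bdd] by (rule bexE)
    from x(1) obtain F where "N F = 1" "b x F \<le> 0" unfolding A_def mem_Collect_eq by (elim conjE exE)
    then show ?thesis using x by (intro exI[of _ "(x, F)"]) simp
  qed
  then have "\<forall>m. \<exists>p. fst p \<in> A \<and> fst p < c0 + 1 / real (Suc m) \<and> N (snd p) = 1 \<and> b (fst p) (snd p) \<le> 0" by (rule allI)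
  from choice[OF this] obtain p where p: "\<forall>m. fst (p m) \<in> A \<and> fst (p m) < c0 + 1 / real (Suc m) \<and> N (snd (p m)) = 1 \<and> b (fst (p m)) (snd (p m)) \<le> 0" ..
  define X where "X m = fst (p m)" for m
  define F where "F m = snd (p m)" for m
  have XF: "X m \<in> A" "X m < c0 + 1 / real (Suc m)" "N (F m) = 1" "b (X m) (F m) \<le> 0" for m
    using p by (simp_all add: X_def F_def)
  have Xlim: "X \<longlonglongrightarrow> c0"
  proof (rule real_tendsto_sandwich[of "\<lambda>_. c0" _ _ "\<lambda>m. c0 + 1 / of_nat (Suc m)"])
    show "\<forall>\<^sub>F m in sequentially. c0 \<le> X m" using XF(1) cInf_lower[OF _ bdd] by (simp add: c0_def)
    show "\<forall>\<^sub>F m in sequentially. X m \<le> c0 + 1 / of_nat (Suc m)" using XF(2) by (simp add: less_imp_le)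
    show "(\<lambda>m. c0 + 1 / real (Suc m)) \<longlonglongrightarrow> c0"
      using tendsto_add[OF tendsto_const LIMSEQ_inverse_real_of_nat, of c0] by (simp add: inverse_eq_divide)
  qed simp
  have bound: "cmod (F m v) \<le> 1 + (\<Sum>v\<in>S. 1 / d v)" if v: "v \<in> S" for m v
  proof -
    have "d v * (cmod (F m v))\<^sup>2 \<le> N (F m)"
      unfolding N_def using d S v by (intro member_le_sum) (auto simp: less_imp_le)
    then have "(cmod (F m v))\<^sup>2 \<le> 1 / d v" using XF(3)[of m] d[OF v] by (simp add: pos_le_divide_eq mult.commute)
    also have "\<dots> \<le> (\<Sum>v\<in>S. 1 / d v)" using d S v by (intro member_le_sum) (auto simp: less_imp_le)
    finally have "(cmod (F m v))\<^sup>2 \<le> (\<Sum>v\<in>S. 1 / d v)" .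
    moreover have "cmod (F m v) \<le> 1 + (cmod (F m v))\<^sup>2"
      using zero_le_power2[of "cmod (F m v) - 1"] norm_ge_zero[of "F m v"] unfolding power2_diff power_one mult_1_right by linarith
    ultimately show ?thesis by linarith
  qed
  have "\<exists>r f. strict_mono r \<and> (\<forall>v\<in>S. (\<lambda>m. F (r m) v) \<longlonglongrightarrow> f v)"
    by (rule finite_bounded_subseq[OF S]) (rule bound)
  then obtain r f0 where r1: "strict_mono r" and r2: "\<forall>v\<in>S. (\<lambda>m. F (r m) v) \<longlonglongrightarrow> f0 v" by (elim exE conjE)
  note r = r1 bspec[OF r2]
  have "(\<lambda>m. N (F (r m))) \<longlonglongrightarrow> N f0" unfolding N_def
    by (intro tendsto_sum tendsto_mult tendsto_const tendsto_power tendsto_norm r(2))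
  then have Nf0: "N f0 = 1" using XF(3) by (simp add: LIMSEQ_const_iff)
  have "(\<lambda>m. b (X (r m)) (F (r m))) \<longlonglongrightarrow> b c0 f0"
    using LIMSEQ_subseq_LIMSEQ[OF Xlim r(1)] r(2) by (intro b_tendsto) (auto simp: comp_def)
  then have bf0: "b c0 f0 \<le> 0" by (rule LIMSEQ_le_const2) (use XF(4) in auto)
  \<comment> \<open>Times before the infimum \<open>c0\<close> lie outside \<open>A\<close>, so the
    form is nonnegative there and in the limit from the left. If \<open>c0 = 0\<close> there are no
    earlier times, and \<open>K 0\<close> being the identity is used instead.\<close>
  have psd: "b c0 h \<ge> 0" for h
  proof (cases "c0 = 0")
    case True
    have "form S d h (K 0 h) = form S d h h" unfolding form_def by (intro sum.cong refl) (simp add: K0)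
    then show ?thesis using N0[of h] True by (simp add: b_def form_self N_def)
  next
    case False
    define X' where "X' m = c0 - c0 / real (Suc m)" for m
    have X': "0 \<le> X' m" "X' m < c0" for m using c0 False by (auto simp: X'_def field_simps)
    have "X' \<longlonglongrightarrow> c0 - c0 * 0"
      unfolding X'_def divide_inverse by (intro tendsto_diff tendsto_mult tendsto_const LIMSEQ_inverse_real_of_nat)
    then have "(\<lambda>m. b (X' m) h) \<longlonglongrightarrow> b c0 h" by (intro b_tendsto) auto
    moreover have "b (X' m) h \<ge> 0" for m
    proof (rule ccontr)
      assume neg: "\<not> b (X' m) h \<ge> 0"
      have "\<exists>v\<in>S. h v \<noteq> 0"
      proof (rule ccontr)
        assume "\<not> ?thesis"
        then have "b (X' m) h = 0" by (simp add: b_def form_def)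
        then show False using neg by simp
      qed
      then obtain v where v: "v \<in> S" "h v \<noteq> 0" ..
      have "X' m \<in> A"
      proof (rule AI[of _ v h])
        show "X' m < 1" using X'[of m] c0 by linarith
        show "b (X' m) h \<le> 0" using neg by linarith
      qed (rule X' v)+
      then show False using cInf_lower[OF _ bdd, of "X' m"] X'(2)[of m] by (simp add: c0_def)
    qed
    ultimately show ?thesis by (intro LIMSEQ_le_const) auto
  qed
  define h where "h = K c0 f0"
  have expand: "b c0 (\<lambda>v. f0 v + of_real t * h v) = b c0 f0 + 2 * t * N h + t\<^sup>2 * b c0 h" for t
  proof -
    have "form S d f0 (K c0 h) = form S d h h" using ad[OF c0] by (simp add: adj_def h_def)
    moreover have "form S d h h = of_real (N h)" by (simp only: form_self N_def)
    ultimately show ?thesis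
      by (simp add: b_def lin_add[OF li] lin_scale[OF li] form_add_left form_add_right form_scale_left form_scale_right
          h_def[symmetric] power2_eq_square[of t] algebra_simps)
  qed
  have "N h = 0"
  proof (rule ccontr)
    assume "N h \<noteq> 0"
    then have nh: "N h > 0" using N0[of h] by simp
    \<comment> \<open>Moving from the null vector by -t in direction h = K c0 f0 changes the form by
      -2 t N h to first order. The summand 1 keeps the denominator positive and makes
      \<open>t * b c0 h \<le> N h\<close>, so the quadratic term cannot compensate.\<close>
    define t where "t = N h / (1 + b c0 h)"
    have t: "t > 0" "t * b c0 h \<le> N h" using nh psd[of h] by (auto simp: t_def field_simps)
    have "0 \<le> b c0 f0 + 2 * (- t) * N h + (- t)\<^sup>2 * b c0 h" using psd unfolding expand[symmetric] .
    also have "\<dots> = b c0 f0 + t * (t * b c0 h - 2 * N h)" by (simp add: power2_eq_square algebra_simps)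
    also have "\<dots> < 0" using bf0 mult_pos_neg[OF t(1), of "t * b c0 h - 2 * N h"] t(2) nh by linarith
    finally show False by simp
  qed
  then have "K c0 f0 v = 0" if "v \<in> S" for v using Npos[OF that, of h] by (auto simp: h_def)
  then have "f0 v = 0" if "v \<in> S" for v by (rule inj[OF c0 _ that])
  then have "N f0 = 0" by (simp add: N_def)
  then show False using Nf0 by simp
qed

section \<open>Commutation and continuity of the group reversals\<close>

lemma Mv_Kop_commute:
  assumes "x \<notin> set zs" "set ys \<inter> set zs = {}"
  shows "Mv g x ys (Kop g zs f) = Kop g zs (Mv g x ys f)"
  using assms
proof (induction ys arbitrary: f)
  case (Cons y ys)
  then show ?case using rmat_Kop_commute[of x zs y] by simp
qed simp

lemma Kop_Kop_commute:
  assumes "set xs \<inter> set zs = {}"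
  shows "Kop g xs (Kop g zs f) = Kop g zs (Kop g xs f)"
  using assms
proof (induction xs arbitrary: f)
  case (Cons x xs)
  then show ?case using Mv_Kop_commute[of x zs xs] by simp
qed simp

lemma tendsto_rmat:
  assumes "a < n" "b < n" "(\<lambda>m. G m) \<longlonglongrightarrow> g" "\<And>v. v permutes {..<n} \<Longrightarrow> (\<lambda>m. F m v) \<longlonglongrightarrow> f v" "v permutes {..<n}"
  shows "(\<lambda>m. rmat a b r (G m) (F m) v) \<longlonglongrightarrow> rmat a b r g f v"
  unfolding rmat_def using assms(3-5) permutes_swap_ix_comp[OF assms(5,1,2)]
  by (intro tendsto_diff tendsto_mult tendsto_const) auto

lemma tendsto_Mv:
  assumes "\<And>y. y \<in> insert x (set ys) \<Longrightarrow> y < n" "\<And>y. (\<lambda>m. G m x y) \<longlonglongrightarrow> g x y"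
    "\<And>v. v permutes {..<n} \<Longrightarrow> (\<lambda>m. F m v) \<longlonglongrightarrow> f v" "v permutes {..<n}"
  shows "(\<lambda>m. Mv (G m) x ys (F m) v) \<longlonglongrightarrow> Mv g x ys f v"
  using assms(1,3,4)
proof (induction ys arbitrary: F f v)
  case (Cons y ys)
  have "(\<lambda>m. Mv (G m) x ys (rmat x y 1 (G m x y) (F m)) v) \<longlonglongrightarrow> Mv g x ys (rmat x y 1 (g x y) f) v"
  proof (rule Cons.IH[OF _ _ Cons.prems(3)])
    show "a < n" if "a \<in> insert x (set ys)" for a using that by (intro Cons.prems(1)) auto
    show "(\<lambda>m. rmat x y 1 (G m x y) (F m) u) \<longlonglongrightarrow> rmat x y 1 (g x y) f u" if "u permutes {..<n}" for u
      by (rule tendsto_rmat[OF _ _ assms(2) Cons.prems(2) that]) (rule Cons.prems(1), simp)+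
  qed
  then show ?case by simp
qed simp

lemma tendsto_Kop:
  assumes "\<And>y. y \<in> set xs \<Longrightarrow> y < n" "\<And>x y. (\<lambda>m. G m x y) \<longlonglongrightarrow> g x y"
    "\<And>v. v permutes {..<n} \<Longrightarrow> (\<lambda>m. F m v) \<longlonglongrightarrow> f v" "v permutes {..<n}"
  shows "(\<lambda>m. Kop (G m) xs (F m) v) \<longlonglongrightarrow> Kop g xs f v"
  using assms(1,3,4)
proof (induction xs arbitrary: F f v)
  case (Cons x xs)
  have "(\<lambda>m. Kop (G m) xs (Mv (G m) x xs (F m)) v) \<longlonglongrightarrow> Kop g xs (Mv g x xs f) v"
  proof (rule Cons.IH[OF _ _ Cons.prems(3)])
    show "a < n" if "a \<in> set xs" for a using that by (intro Cons.prems(1)) simp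
    show "(\<lambda>m. Mv (G m) x xs (F m) u) \<longlonglongrightarrow> Mv g x xs f u" if "u permutes {..<n}" for u
      by (rule tendsto_Mv[OF _ assms(2) Cons.prems(2) that]) (rule Cons.prems(1), simp)
  qed
  then show ?case by simp
qed simp

text \<open>Only exchanges between the groups us and vs change this weight, and they change it exactly by
  the ratio of the two nondiagonal coefficients of the Hamiltonian.\<close>

definition wt :: "nat \<Rightarrow> nat list \<Rightarrow> (nat \<Rightarrow> real) \<Rightarrow> (nat \<Rightarrow> nat) \<Rightarrow> real" where
  "wt n us q v = (\<Prod>i<n. if v i \<in> set us then q i else 1)"

lemma wt_invariant:
  assumes "x \<in> set us \<longleftrightarrow> y \<in> set us"
  shows "wt n us q (swap_ix x y \<circ> v) = wt n us q v"
proof -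
  have "swap_ix x y u \<in> set us \<longleftrightarrow> u \<in> set us" for u
    using assms by (cases "u = x"; cases "u = y") simp_all
  then show ?thesis unfolding wt_def comp_apply by presburger
qed

lemma wt_split:
  assumes "k < n" "l < n" "k \<noteq> l"
  shows "wt n us q v = (if v k \<in> set us then q k else 1) * (if v l \<in> set us then q l else 1)
    * (\<Prod>i\<in>{..<n} - {k, l}. if v i \<in> set us then q i else 1)"
proof -
  have "wt n us q v = (\<Prod>i\<in>insert k (insert l ({..<n} - {k, l})). if v i \<in> set us then q i else 1)"
    unfolding wt_def
  proof (rule prod.cong)
    show "{..<n} = insert k (insert l ({..<n} - {k, l}))" using assms by blast
  qed (rule refl)
  also have "\<dots> = (if v k \<in> set us then q k else 1) * (if v l \<in> set us then q l else 1)
    * (\<Prod>i\<in>{..<n} - {k, l}. if v i \<in> set us then q i else 1)"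
    using assms(3) by (subst prod.insert, simp, simp, subst prod.insert) (simp_all only: mult.assoc finite_Diff finite_lessThan Diff_iff insert_iff simp_thms)
  finally show ?thesis .
qed

text \<open>For two letters of one group the weight is unchanged and the reversed list accounts for
  the transposition. Letters of different groups keep their order in \<open>rev us @ rev vs\<close>,
  so the coefficients to be balanced are R = Q k / (Q l - Q k) and R + 1 = Q l / (Q l - Q k), in the
  ratio Q k : Q l; a \<open>q\<close> proportional to \<open>Q\<close> does this.\<close>

lemma wt_balance:
  assumes kl: "k < n" "l < n" "k \<noteq> l" and Q: "Q k \<noteq> Q l"
    and v: "v k \<noteq> v l" "v k \<in> set us \<union> set vs" "v l \<in> set us \<union> set vs" and disj: "set us \<inter> set vs = {}"
    and q: "us = [] \<or> q k * Q l = q l * Q k"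
  shows "wt n us q (v \<circ> swap_ix k l) * (Q k / (Q l - Q k) + of_bool (bef (us @ vs) (v l) (v k)))
    = wt n us q v * (Q k / (Q l - Q k) + of_bool (bef (rev us @ rev vs) (v k) (v l)))"
proof -
  define P where "P = (\<Prod>i\<in>{..<n} - {k, l}. if v i \<in> set us then q i else 1)"
  have P: "(\<Prod>i\<in>{..<n} - {k, l}. if (v \<circ> swap_ix k l) i \<in> set us then q i else 1) = P"
    unfolding P_def by (intro prod.cong) auto
  have w1: "wt n us q v = (if v k \<in> set us then q k else 1) * (if v l \<in> set us then q l else 1) * P"
    unfolding wt_split[OF kl] P_def ..
  have w2: "wt n us q (v \<circ> swap_ix k l) = (if v l \<in> set us then q k else 1) * (if v k \<in> set us then q l else 1) * P"
    unfolding wt_split[OF kl] P by simp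
  have Qd: "Q l - Q k \<noteq> 0" using Q by simp
  have s: "Q k / (Q l - Q k) + 1 = Q l / (Q l - Q k)" using Qd by (simp add: field_simps)
  define R where "R = Q k / (Q l - Q k)"
  have R: "Q k / (Q l - Q k) = R" "Q l / (Q l - Q k) = R + 1" unfolding R_def by (rule refl) (rule s[symmetric])
  have cross: "q l * R = q k * (R + 1)" if "us \<noteq> []"
  proof -
    have "q l * Q k / (Q l - Q k) = q k * Q l / (Q l - Q k)" using q that by simp
    then show ?thesis unfolding times_divide_eq_right[symmetric] R .
  qed
  have b0: "bef (us @ vs) (v l) (v k) \<longleftrightarrow> bef us (v l) (v k) \<or> bef vs (v l) (v k) \<or> v l \<in> set us \<and> v k \<in> set vs"
    by (rule bef_append)
  have b1: "bef (rev us @ rev vs) (v k) (v l) \<longleftrightarrow> bef us (v l) (v k) \<or> bef vs (v l) (v k) \<or> v k \<in> set us \<and> v l \<in> set vs"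
    unfolding bef_append bef_rev set_rev ..
  have nu: "\<not> bef us (v l) (v k)" if "v l \<notin> set us \<or> v k \<notin> set us" using bef_set[of us "v l" "v k"] that by blast
  have nv: "\<not> bef vs (v l) (v k)" if "v l \<notin> set vs \<or> v k \<notin> set vs" using bef_set[of vs "v l" "v k"] that by blast
  have side: "v k \<in> set vs \<longleftrightarrow> v k \<notin> set us" "v l \<in> set vs \<longleftrightarrow> v l \<notin> set us" using v disj by blast+
  show ?thesis
  proof (cases "v k \<in> set us"; cases "v l \<in> set us")
    assume a: "v k \<in> set us" "v l \<notin> set us"
    then have "us \<noteq> []" by auto
    have "\<not> bef (us @ vs) (v l) (v k)" "bef (rev us @ rev vs) (v k) (v l)" unfolding b0 b1 using a nu nv side by blast+
    then have "wt n us q (v \<circ> swap_ix k l) * (R + of_bool (bef (us @ vs) (v l) (v k))) = q l * R * P"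
      "wt n us q v * (R + of_bool (bef (rev us @ rev vs) (v k) (v l))) = q k * (R + 1) * P"
      unfolding w1 w2 using a by (simp_all only: if_True if_False of_bool_eq simp_thms mult_1_left mult_1_right add_0_right mult.assoc mult.commute[of P])
    then show ?thesis unfolding R using cross[OF \<open>us \<noteq> []\<close>] by (simp only:)
  next
    assume a: "v k \<notin> set us" "v l \<in> set us"
    then have "us \<noteq> []" by auto
    have "bef (us @ vs) (v l) (v k)" "\<not> bef (rev us @ rev vs) (v k) (v l)" unfolding b0 b1 using a nu nv side by blast+
    then have "wt n us q (v \<circ> swap_ix k l) * (R + of_bool (bef (us @ vs) (v l) (v k))) = q k * (R + 1) * P"
      "wt n us q v * (R + of_bool (bef (rev us @ rev vs) (v k) (v l))) = q l * R * P"
      unfolding w1 w2 using a by (simp_all only: if_True if_False of_bool_eq simp_thms mult_1_left mult_1_right add_0_right mult.assoc mult.commute[of P])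
    then show ?thesis unfolding R using cross[OF \<open>us \<noteq> []\<close>] by (simp only:)
  next
    assume a: "v k \<in> set us" "v l \<in> set us"
    then have "bef (us @ vs) (v l) (v k) = bef (rev us @ rev vs) (v k) (v l)" unfolding b0 b1 using side by blast
    then show ?thesis unfolding w1 w2 using a by (simp only: if_True)
  next
    assume a: "v k \<notin> set us" "v l \<notin> set us"
    then have "bef (us @ vs) (v l) (v k) = bef (rev us @ rev vs) (v k) (v l)" unfolding b0 b1 using side by blast
    then show ?thesis unfolding w1 w2 using a by (simp only: if_False)
  qed
qed

abbreviation trigG :: "(nat \<Rightarrow> real) \<Rightarrow> nat \<Rightarrow> nat \<Rightarrow> complex" where
  "trigG Q \<equiv> \<lambda>x y. complex_of_real (Q x / (Q y - Q x))"

text \<open>The diagonal part is real. In each exchange term the substitution of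
  \<open>v \<circ> swap_ix k l\<close> for v moves the exchange to the other argument, and
  \<open>wt_balance\<close> turns its coefficient into that of the order reversed within each
  group.\<close>

lemma gaudin_adj:
  assumes Q: "inj_on Q {..<n}" and k: "k < n" and z: "\<And>i. i < n \<Longrightarrow> \<zeta> i \<in> \<real>"
    and set: "set us \<union> set vs = {..<n}" "set us \<inter> set vs = {}"
    and q: "us = [] \<or> (\<forall>k<n. \<forall>l<n. q k * Q l = q l * Q k)"
  shows "form {v. v permutes {..<n}} (wt n us q) (gaudin n (trigG Q) \<zeta> (complex_of_real c) (us @ vs) k f) h
    = form {v. v permutes {..<n}} (wt n us q) f (gaudin n (trigG Q) \<zeta> (complex_of_real c) (rev us @ rev vs) k h)"
proof -
  let ?S = "{v. v permutes {..<n}}" and ?d = "wt n us q" and ?A = "{..<n} - {k}"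
  define g0 where "g0 v l = Q k / (Q l - Q k) + of_bool (bef (us @ vs) (v k) (v l))" for v l
  define g1 where "g1 v l = Q k / (Q l - Q k) + of_bool (bef (rev us @ rev vs) (v k) (v l))" for v l
  have ob: "complex_of_real (of_bool b) = of_bool b" for b by (cases b) simp_all
  have H0: "gaudin n (trigG Q) \<zeta> (complex_of_real c) (us @ vs) k f v = \<zeta> (v k) * f v
      - of_real c * (\<Sum>l\<in>?A. of_real (g0 v l) * f (v \<circ> swap_ix k l))" if "v permutes {..<n}" for v f
    using that by (simp add: gaudin_def g0_def ob)
  have H1: "gaudin n (trigG Q) \<zeta> (complex_of_real c) (rev us @ rev vs) k f v = \<zeta> (v k) * f v
      - of_real c * (\<Sum>l\<in>?A. of_real (g1 v l) * f (v \<circ> swap_ix k l))" if "v permutes {..<n}" for v f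
    using that by (simp add: gaudin_def g1_def ob)
  have e: "(\<Sum>v\<in>?S. of_real (?d v) * (of_real (g0 v l) * f (v \<circ> swap_ix k l)) * cnj (h v))
    = (\<Sum>v\<in>?S. of_real (?d v) * f v * (of_real (g1 v l) * cnj (h (v \<circ> swap_ix k l))))" if l: "l \<in> ?A" for l
  proof (rule sum.reindex_bij_witness[of _ "\<lambda>v. v \<circ> swap_ix k l" "\<lambda>v. v \<circ> swap_ix k l"])
    fix v assume "v \<in> ?S"
    then have v: "v permutes {..<n}" by simp
    show "v \<circ> swap_ix k l \<circ> swap_ix k l = v" by (simp add: comp_assoc)
    then show "v \<circ> swap_ix k l \<circ> swap_ix k l = v" .
    show "v \<circ> swap_ix k l \<in> ?S" using permutes_comp_swap_ix[OF v k] l by simp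
    then show "v \<circ> swap_ix k l \<in> ?S" .
    have "?d v * g0 v l = ?d (v \<circ> swap_ix k l) * g1 (v \<circ> swap_ix k l) l"
    proof -
      let ?v = "v \<circ> swap_ix k l"
      have l': "l < n" "k \<noteq> l" using l by auto
      have v': "?v permutes {..<n}" using permutes_comp_swap_ix[OF v k] l by simp
      have "wt n us q (?v \<circ> swap_ix k l) * (Q k / (Q l - Q k) + of_bool (bef (us @ vs) (?v l) (?v k)))
        = wt n us q ?v * (Q k / (Q l - Q k) + of_bool (bef (rev us @ rev vs) (?v k) (?v l)))"
      proof (rule wt_balance[OF k l'])
        show "Q k \<noteq> Q l" using Q k l' by (auto simp: inj_on_def)
        show "?v k \<noteq> ?v l" by (rule permutes_neq[OF v' l'(2)])
        show "?v k \<in> set us \<union> set vs" "?v l \<in> set us \<union> set vs" unfolding set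
          using permutes_lt[OF v' k] permutes_lt[OF v' l'(1)] by simp_all
        show "set us \<inter> set vs = {}" by (rule set(2))
        show "us = [] \<or> q k * Q l = q l * Q k" using q k l' by blast
      qed
      then show ?thesis by (simp add: g0_def g1_def comp_assoc)
    qed
    then have "complex_of_real (?d v) * of_real (g0 v l) = of_real (?d (v \<circ> swap_ix k l)) * of_real (g1 (v \<circ> swap_ix k l) l)"
      by (simp only: of_real_mult[symmetric])
    then show "of_real (?d (v \<circ> swap_ix k l)) * f (v \<circ> swap_ix k l) * (of_real (g1 (v \<circ> swap_ix k l) l) * cnj (h (v \<circ> swap_ix k l \<circ> swap_ix k l)))
      = of_real (?d v) * (of_real (g0 v l) * f (v \<circ> swap_ix k l)) * cnj (h v)"
      by (simp add: comp_assoc algebra_simps)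
  qed
  have "form ?S ?d (gaudin n (trigG Q) \<zeta> (complex_of_real c) (us @ vs) k f) h
    = (\<Sum>v\<in>?S. of_real (?d v) * (\<zeta> (v k) * f v) * cnj (h v)
        - of_real c * (\<Sum>l\<in>?A. of_real (?d v) * (of_real (g0 v l) * f (v \<circ> swap_ix k l)) * cnj (h v)))"
    unfolding form_def
  proof (intro sum.cong refl)
    fix v assume "v \<in> ?S"
    then have v: "v permutes {..<n}" by simp
    show "of_real (?d v) * gaudin n (trigG Q) \<zeta> (complex_of_real c) (us @ vs) k f v * cnj (h v)
      = of_real (?d v) * (\<zeta> (v k) * f v) * cnj (h v)
        - of_real c * (\<Sum>l\<in>?A. of_real (?d v) * (of_real (g0 v l) * f (v \<circ> swap_ix k l)) * cnj (h v))"
      unfolding H0[OF v] by (simp add: sum_distrib_left sum_distrib_right algebra_simps)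
  qed
  also have "\<dots> = (\<Sum>v\<in>?S. of_real (?d v) * (\<zeta> (v k) * f v) * cnj (h v))
        - of_real c * (\<Sum>l\<in>?A. \<Sum>v\<in>?S. of_real (?d v) * (of_real (g0 v l) * f (v \<circ> swap_ix k l)) * cnj (h v))"
    unfolding sum_subtractf sum_distrib_left[symmetric] by (subst sum.swap) simp
  also have "(\<Sum>l\<in>?A. \<Sum>v\<in>?S. of_real (?d v) * (of_real (g0 v l) * f (v \<circ> swap_ix k l)) * cnj (h v))
    = (\<Sum>l\<in>?A. \<Sum>v\<in>?S. of_real (?d v) * f v * (of_real (g1 v l) * cnj (h (v \<circ> swap_ix k l))))"
    by (intro sum.cong refl e)
  also have "(\<Sum>v\<in>?S. of_real (?d v) * (\<zeta> (v k) * f v) * cnj (h v)) - of_real c * \<dots>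
    = (\<Sum>v\<in>?S. of_real (?d v) * (\<zeta> (v k) * f v) * cnj (h v)
        - of_real c * (\<Sum>l\<in>?A. of_real (?d v) * f v * (of_real (g1 v l) * cnj (h (v \<circ> swap_ix k l)))))"
    by (subst sum.swap) (simp add: sum_subtractf sum_distrib_left)
  also have "\<dots> = form ?S ?d f (gaudin n (trigG Q) \<zeta> (complex_of_real c) (rev us @ rev vs) k h)"
    unfolding form_def
  proof (intro sum.cong refl)
    fix v assume "v \<in> ?S"
    then have v: "v permutes {..<n}" by simp
    have "cnj (\<zeta> (v k)) = \<zeta> (v k)" using z[OF permutes_lt[OF v k]] by (simp add: Reals_cnj_iff)
    then show "of_real (?d v) * (\<zeta> (v k) * f v) * cnj (h v)
        - of_real c * (\<Sum>l\<in>?A. of_real (?d v) * f v * (of_real (g1 v l) * cnj (h (v \<circ> swap_ix k l))))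
      = of_real (?d v) * f v * cnj (gaudin n (trigG Q) \<zeta> (complex_of_real c) (rev us @ rev vs) k h v)"
      unfolding H1[OF v] by (simp add: sum_distrib_left algebra_simps)
  qed
  finally show ?thesis .
qed

section \<open>Reality of the spectrum\<close>

lemma gaudin_lin: "lin (gaudin n G \<zeta> c xs k)"
proof (rule linI)
  fix f g :: "(nat \<Rightarrow> nat) \<Rightarrow> complex" and r v
  let ?e = "\<lambda>l. G k l + of_bool (bef xs (v k) (v l))"
  have "(\<Sum>l\<in>{..<n} - {k}. ?e l * (f (v \<circ> swap_ix k l) + g (v \<circ> swap_ix k l)))
    = (\<Sum>l\<in>{..<n} - {k}. ?e l * f (v \<circ> swap_ix k l)) + (\<Sum>l\<in>{..<n} - {k}. ?e l * g (v \<circ> swap_ix k l))"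
    by (simp only: distrib_left sum.distrib)
  then show "gaudin n G \<zeta> c xs k (\<lambda>w. f w + g w) v = gaudin n G \<zeta> c xs k f v + gaudin n G \<zeta> c xs k g v"
    unfolding gaudin_def by (simp only: split: if_split) (simp add: distrib_left)
  have "(\<Sum>l\<in>{..<n} - {k}. ?e l * (r * f (v \<circ> swap_ix k l))) = r * (\<Sum>l\<in>{..<n} - {k}. ?e l * f (v \<circ> swap_ix k l))"
    by (simp only: sum_distrib_left mult.left_commute)
  then show "gaudin n G \<zeta> c xs k (\<lambda>w. r * f w) v = r * gaudin n G \<zeta> c xs k f v"
    unfolding gaudin_def by (simp only: split: if_split) (simp add: right_diff_distrib)
qed

lemma gaudin_cong:
  assumes k: "k < n" and "\<And>v. v permutes {..<n} \<Longrightarrow> f v = h v"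
  shows "gaudin n G \<zeta> c xs k f v = gaudin n G \<zeta> c xs k h v"
proof (cases "v permutes {..<n}")
  case v: True
  have "f (v \<circ> swap_ix k l) = h (v \<circ> swap_ix k l)" if "l < n" for l
    by (rule assms(2)[OF permutes_comp_swap_ix[OF v k that]])
  then show ?thesis using assms(2)[OF v] by (simp add: gaudin_def)
qed (simp add: gaudin_def)

text \<open>With \<open>K\<close> reversing both groups, the Hamiltonian H satisfies H* K = K H,
  where H* is the adjoint for the weight \<open>wt\<close>. An eigenvector f then gives \<alpha> (f,
  K f) = cnj \<alpha> (f, K f), and (f, K f) is positive by
  \<open>positive_definite_path\<close>.\<close>

lemma gaudin_eigenvalue_real:
  assumes Q: "inj_on Q {..<n}" and k: "k < n" and z: "\<And>i. i < n \<Longrightarrow> \<zeta> i \<in> \<real>"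
    and dist: "distinct (us @ vs)" and set: "set us \<union> set vs = {..<n}"
    and q: "us = [] \<or> (\<forall>k<n. \<forall>l<n. q k * Q l = q l * Q k)" and qpos: "\<And>i. i < n \<Longrightarrow> q i > 0"
    and sep: "\<And>i j. i \<noteq> j \<Longrightarrow> i \<in> set us \<and> j \<in> set us \<or> i \<in> set vs \<and> j \<in> set vs \<Longrightarrow> cmod (\<zeta> i - \<zeta> j) \<ge> 1"
    and c: "0 \<le> c" "c < 1"
    and ev: "gaudin_eigenvalue n (trigG Q) \<zeta> (complex_of_real c) (us @ vs) k \<alpha>"
  shows "\<alpha> \<in> \<real>"
proof -
  let ?S = "{v. v permutes {..<n}}" and ?d = "wt n us q"
  define g where "g c x y = complex_of_real c / (\<zeta> x - \<zeta> y)" for c x y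
  define K where "K c f = Kop (g c) vs (Kop (g c) us f)" for c :: real and f
  have disj: "set us \<inter> set vs = {}" using dist by simp
  have lt: "i < n" if "i \<in> set us \<or> i \<in> set vs" for i using that set by auto
  have lus: "i < n" if "i \<in> set us" for i using lt that by blast
  have lvs: "i < n" if "i \<in> set vs" for i using lt that by blast
  have sepu: "cmod (\<zeta> i - \<zeta> j) \<ge> 1" if "i \<in> set us" "j \<in> set us" "i \<noteq> j" for i j
    by (rule sep[OF that(3)]) (use that in blast)
  have sepv: "cmod (\<zeta> i - \<zeta> j) \<ge> 1" if "i \<in> set vs" "j \<in> set vs" "i \<noteq> j" for i j
    by (rule sep[OF that(3)]) (use that in blast)
  have ybe: "ybe_on A (g c)" if "\<And>i j. i \<in> A \<Longrightarrow> j \<in> A \<Longrightarrow> i \<noteq> j \<Longrightarrow> cmod (\<zeta> i - \<zeta> j) \<ge> 1" for A c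
    unfolding ybe_on_def
  proof (intro ballI impI)
    fix x y w assume a: "x \<in> A" "y \<in> A" "w \<in> A" "x \<noteq> y" "x \<noteq> w" "y \<noteq> w"
    have nz: "\<zeta> x - \<zeta> y \<noteq> 0" "\<zeta> x - \<zeta> w \<noteq> 0" "\<zeta> y - \<zeta> w \<noteq> 0"
      using that[of x y] that[of x w] that[of y w] a by (metis norm_zero not_one_le_zero)+
    have e: "\<zeta> x - \<zeta> w = (\<zeta> x - \<zeta> y) + (\<zeta> y - \<zeta> w)" by simp
    \<comment> \<open>The addition rule needed for Yang-Baxter, with A and B consecutive differences
      of spectral parameters.\<close>
    have frac: "r / A * (r / B) = r / (A + B) * (r / A + r / B)" if "A \<noteq> 0" "B \<noteq> 0" "A + B \<noteq> 0" for r A B :: complex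
    proof -
      have "r / A + r / B = r * (A + B) / (A * B)" using that by (simp add: field_simps)
      then show ?thesis using that by simp
    qed
    show "g c x y * g c y w = g c x w * (g c x y + g c y w)"
      unfolding g_def e by (rule frac) (use nz in simp_all)
  qed
  have g_real: "g c x y \<in> \<real>" if "x < n" "y < n" for c x y
    unfolding g_def using z[OF that(1)] z[OF that(2)] by (intro Reals_divide Reals_diff) auto
  have g_eq: "g c x y * (\<zeta> x - \<zeta> y) = complex_of_real c" if "cmod (\<zeta> x - \<zeta> y) \<ge> 1" for c x y
  proof -
    have "\<zeta> x - \<zeta> y \<noteq> 0" using that by (metis norm_zero not_one_le_zero)
    then show ?thesis by (simp add: g_def)
  qed
  \<comment> \<open>The modulus of g is c divided by a distance of at least 1, hence below 1. For c
    = 1 this would fail at distance exactly 1.\<close>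
  have g_ne: "(g c x y)\<^sup>2 \<noteq> 1" if "0 \<le> c" "c < 1" "cmod (\<zeta> x - \<zeta> y) \<ge> 1" for c x y
  proof
    assume "(g c x y)\<^sup>2 = 1"
    then have "cmod (g c x y) ^ 2 = 1" by (metis norm_power norm_one)
    then have "cmod (g c x y) = 1" using norm_ge_zero[of "g c x y"] by (simp add: power2_eq_1_iff)
    moreover have "cmod (g c x y) * cmod (\<zeta> x - \<zeta> y) = c"
      using arg_cong[OF g_eq[OF that(3)], of cmod c] that(1) by (simp add: norm_mult)
    ultimately show False using that by simp
  qed
  have ad: "adj ?S ?d (K c) (K c)" for c
  proof -
    have 1: "adj ?S ?d (Kop (g c) us) (Kop (g c) us)"
    proof (rule Kop_adj)
      show "distinct us" using dist by simp
      show "ybe_on (set us) (g c)" by (rule ybe) (rule sepu)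
      show "g c x y \<in> \<real>" if "x \<in> set us" "y \<in> set us" for x y using that by (intro g_real lus)
      show "?d (swap_ix x y \<circ> v) = ?d v" if "x \<in> set us" "y \<in> set us" for x y v
        by (rule wt_invariant) (use that in blast)
    qed (rule lus)
    have 2: "adj ?S ?d (Kop (g c) vs) (Kop (g c) vs)"
    proof (rule Kop_adj)
      show "distinct vs" using dist by simp
      show "ybe_on (set vs) (g c)" by (rule ybe) (rule sepv)
      show "g c x y \<in> \<real>" if "x \<in> set vs" "y \<in> set vs" for x y using that by (intro g_real lvs)
      show "?d (swap_ix x y \<circ> v) = ?d v" if "x \<in> set vs" "y \<in> set vs" for x y v
        by (rule wt_invariant) (use that disj in blast)
    qed (rule lvs)
    have "Kop (g c) us (Kop (g c) vs f) = Kop (g c) vs (Kop (g c) us f)" for f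
      by (rule Kop_Kop_commute[OF disj])
    then show ?thesis using adj_comp[OF 2 1] unfolding K_def adj_def by simp
  qed
  have K_lin: "lin (K c)" for c
    unfolding K_def by (rule linI) (simp_all only: lin_add[OF Kop_lin] lin_scale[OF Kop_lin])
  have inter: "gaudin n (trigG Q) \<zeta> (complex_of_real c) (rev us @ rev vs) k (K c f)
    = K c (gaudin n (trigG Q) \<zeta> (complex_of_real c) (us @ vs) k f)" for f
  proof -
    have 1: "gaudin n (trigG Q) \<zeta> (complex_of_real c) ([] @ rev us @ vs) k (Kop (g c) us f)
      = Kop (g c) us (gaudin n (trigG Q) \<zeta> (complex_of_real c) ([] @ us @ vs) k f)"
    proof (rule gaudin_Kop_intertwine)
      show "distinct ([] @ us @ vs)" using dist by simp
      show "g c a b * (\<zeta> a - \<zeta> b) = complex_of_real c" if "a \<in> set us" "b \<in> set us" "a \<noteq> b" for a b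
        by (rule g_eq) (rule sepu[OF that])
    qed (rule lus k | assumption)+
    have 2: "gaudin n (trigG Q) \<zeta> (complex_of_real c) (rev us @ rev vs @ []) k (Kop (g c) vs (Kop (g c) us f))
      = Kop (g c) vs (gaudin n (trigG Q) \<zeta> (complex_of_real c) (rev us @ vs @ []) k (Kop (g c) us f))"
    proof (rule gaudin_Kop_intertwine)
      show "distinct (rev us @ vs @ [])" using dist by simp
      show "g c a b * (\<zeta> a - \<zeta> b) = complex_of_real c" if "a \<in> set vs" "b \<in> set vs" "a \<noteq> b" for a b
        by (rule g_eq) (rule sepv[OF that])
    qed (rule lvs k | assumption)+
    show ?thesis using 1 2 unfolding K_def append_Nil append_Nil2 by (simp only:)
  qed
  from ev obtain f0 v0 where f0: "v0 permutes {..<n}" "f0 v0 \<noteq> 0"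
    "\<forall>v. v permutes {..<n} \<longrightarrow> gaudin n (trigG Q) \<zeta> (complex_of_real c) (us @ vs) k f0 v = \<alpha> * f0 v"
    unfolding gaudin_eigenvalue_def by (elim exE conjE)
  \<comment> \<open>Extended by 0, since \<open>gaudin\<close> vanishes off the permutations; the
    eigenvector equation becomes an equality of functions to which \<open>K\<close> can be
    applied.\<close>
  define f where "f v = (if v permutes {..<n} then f0 v else 0)" for v
  have Hf: "gaudin n (trigG Q) \<zeta> (complex_of_real c) (us @ vs) k f = (\<lambda>v. \<alpha> * f v)"
  proof
    fix v
    have "gaudin n (trigG Q) \<zeta> (complex_of_real c) (us @ vs) k f v = gaudin n (trigG Q) \<zeta> (complex_of_real c) (us @ vs) k f0 v"
      by (rule gaudin_cong[OF k]) (simp add: f_def)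
    then show "gaudin n (trigG Q) \<zeta> (complex_of_real c) (us @ vs) k f v = \<alpha> * f v"
    proof (cases "v permutes {..<n}")
      case True
      then show ?thesis using \<open>gaudin _ _ _ _ _ _ f v = _\<close> f0(3) by (simp only: f_def if_True)
    next
      case False
      then show ?thesis by (simp add: gaudin_def f_def)
    qed
  qed
  have pos: "Re (form ?S ?d f (K c f)) > 0"
  proof (rule positive_definite_path[of ?S ?d K, OF _ _ _ ad K_lin _ _ c])
    show "finite ?S" by (rule finite_permutations) simp
    show "?d v > 0" for v unfolding wt_def using qpos by (intro prod_pos) auto
    show "K 0 f v = f v" for f v
    proof -
      have g0: "g 0 x y = 0" for x y by (simp add: g_def)
      have L0: "rmat x y 1 0 f = f" for x y f by (rule ext) (simp add: rmat_def)
      have M0: "Mv (g 0) x ys f = f" for x ys f by (induction ys arbitrary: f) (simp_all add: g0 L0)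
      have K0: "Kop (g 0) xs f = f" for xs f by (induction xs arbitrary: f) (simp_all add: M0)
      show ?thesis by (simp add: K_def K0)
    qed
    show "(\<lambda>m. K (X m) (F m) v) \<longlonglongrightarrow> K c' f' v"
      if X: "X \<longlonglongrightarrow> c'" and F: "\<And>v. v \<in> ?S \<Longrightarrow> (\<lambda>m. F m v) \<longlonglongrightarrow> f' v" and v: "v \<in> ?S" for X c' F f' v
    proof -
      have gl: "(\<lambda>m. g (X m) x y) \<longlonglongrightarrow> g c' x y" for x y
        unfolding g_def divide_inverse by (intro tendsto_mult tendsto_of_real X tendsto_const)
      have F': "(\<lambda>m. F m v) \<longlonglongrightarrow> f' v" if "v permutes {..<n}" for v by (rule F) (simp add: that)
      have 1: "(\<lambda>m. Kop (g (X m)) us (F m) v) \<longlonglongrightarrow> Kop (g c') us f' v" if "v permutes {..<n}" for v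
        by (rule tendsto_Kop[OF lus gl F' that])
      have v': "v permutes {..<n}" using v by simp
      show ?thesis unfolding K_def by (rule tendsto_Kop[OF lvs gl 1 v'])
    qed
    show "f' v = 0" if c': "0 \<le> c'" "c' < 1" and z: "\<And>v. v \<in> ?S \<Longrightarrow> K c' f' v = 0" and v: "v \<in> ?S" for c' f' v
    proof -
      have z': "Kop (g c') vs (Kop (g c') us f') v = 0" if "v permutes {..<n}" for v
        using z[of v] that by (simp add: K_def)
      have 1: "Kop (g c') us f' v = 0" if "v permutes {..<n}" for v
      proof (rule Kop_injective[OF _ _ lvs z' that])
        show "(g c' x y)\<^sup>2 \<noteq> 1" if "x \<in> set vs" "y \<in> set vs" "x \<noteq> y" for x y
          by (rule g_ne[OF c' sepv[OF that]])
        show "distinct vs" using dist by simp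
      qed
      have v': "v permutes {..<n}" using v by simp
      show ?thesis
      proof (rule Kop_injective[OF _ _ lus 1 v'])
        show "(g c' x y)\<^sup>2 \<noteq> 1" if "x \<in> set us" "y \<in> set us" "x \<noteq> y" for x y
          by (rule g_ne[OF c' sepu[OF that]])
        show "distinct us" using dist by simp
      qed
    qed
    show "v0 \<in> ?S" using f0(1) by simp
    show "f v0 \<noteq> 0" using f0 by (simp add: f_def)
  qed
  have "\<alpha> * form ?S ?d f (K c f) = form ?S ?d (gaudin n (trigG Q) \<zeta> (complex_of_real c) (us @ vs) k f) (K c f)"
    unfolding Hf form_scale_left ..
  also have "\<dots> = form ?S ?d f (gaudin n (trigG Q) \<zeta> (complex_of_real c) (rev us @ rev vs) k (K c f))"
    by (rule gaudin_adj[OF Q k z set disj q])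
  also have "\<dots> = cnj \<alpha> * form ?S ?d f (K c f)"
    unfolding inter Hf lin_scale[OF K_lin] form_scale_right ..
  finally have "\<alpha> = cnj \<alpha>" using pos by auto
  then show ?thesis by (simp add: Reals_cnj_iff)
qed

section \<open>Passing to coupling constant 1\<close>

lemma char_poly_real_spectrum_bound:
  fixes A :: "complex mat"
  assumes A: "A \<in> carrier_mat m m" and r: "\<And>e. eigenvalue A e \<Longrightarrow> e \<in> \<real>"
  shows "cmod (poly (char_poly A) \<alpha>) \<ge> \<bar>Im \<alpha>\<bar> ^ m"
proof -
  obtain as where as: "char_poly A = (\<Prod>a\<leftarrow>as. [:- a, 1:])" "length as = m"
    using char_poly_factorized[OF A] by blast
  have "eigenvalue A a" if "a \<in> set as" for a
    unfolding eigenvalue_root_char_poly[OF A] as(1) using that by (simp add: poly_prod_list prod_list_zero_iff)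
  then have real: "a \<in> \<real>" if "a \<in> set as" for a using r that by blast
  have "\<bar>Im \<alpha>\<bar> ^ length as \<le> cmod (poly (\<Prod>a\<leftarrow>as. [:- a, 1:]) \<alpha>)" using real
  proof (induction as)
    case (Cons a as)
    have "\<bar>Im \<alpha>\<bar> \<le> cmod (\<alpha> - a)"
      using abs_Im_le_cmod[of "\<alpha> - a"] Cons.prems[of a] by (simp add: complex_is_Real_iff)
    moreover have "\<bar>Im \<alpha>\<bar> ^ length as \<le> cmod (poly (\<Prod>a\<leftarrow>as. [:- a, 1:]) \<alpha>)"
      using Cons by simp
    ultimately have "\<bar>Im \<alpha>\<bar> * \<bar>Im \<alpha>\<bar> ^ length as \<le> cmod (\<alpha> - a) * cmod (poly (\<Prod>a\<leftarrow>as. [:- a, 1:]) \<alpha>)"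
      by (intro mult_mono) auto
    moreover have "poly (\<Prod>a\<leftarrow>a # as. [:- a, 1:]) \<alpha> = (\<alpha> - a) * poly (\<Prod>a\<leftarrow>as. [:- a, 1:]) \<alpha>" by (simp add: algebra_simps)
    ultimately show ?case by (simp add: norm_mult)
  qed simp
  then show ?thesis using as by simp
qed

text \<open>At a nonreal \<alpha> every linear factor of a characteristic polynomial with real roots
  has modulus at least |Im \<alpha>|. This bound does not depend on c, so it persists in the limit
  and prevents \<alpha> from becoming a root at 1.\<close>

lemma eigenvalue_limit_real:
  fixes F :: "complex \<Rightarrow> nat \<Rightarrow> nat \<Rightarrow> complex"
  assumes pf: "\<And>i j. i < m \<Longrightarrow> j < m \<Longrightarrow> polyfun (\<lambda>s. F s i j)"
    and real: "eventually (\<lambda>c. \<forall>e. eigenvalue (mat m m (\<lambda>(i, j). F (of_real c) i j)) e \<longrightarrow> e \<in> \<real>) (at_left 1)"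
    and ev: "eigenvalue (mat m m (\<lambda>(i, j). F 1 i j)) \<alpha>"
  shows "\<alpha> \<in> \<real>"
proof (rule ccontr)
  assume "\<alpha> \<notin> \<real>"
  then have Im: "Im \<alpha> \<noteq> 0" by (simp add: complex_is_Real_iff)
  define P where "P s = poly (char_poly (mat m m (\<lambda>(i, j). F s i j))) \<alpha>" for s
  have P: "P s = det (mat m m (\<lambda>(i, j). (if i = j then \<alpha> else 0) - F s i j))" for s
  proof -
    have "P s = det (- char_matrix (mat m m (\<lambda>(i, j). F s i j)) \<alpha>)"
      unfolding P_def by (rule char_poly_matrix[of _ m]) simp
    also have "- char_matrix (mat m m (\<lambda>(i, j). F s i j)) \<alpha> = mat m m (\<lambda>(i, j). (if i = j then \<alpha> else 0) - F s i j)"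
      by (rule eq_matI) (auto simp: char_matrix_def)
    finally show ?thesis .
  qed
  have "polyfun P" unfolding P[abs_def] by (intro polyfun_det polyfun_diff polyfun_const pf)
  then have "isCont P 1" by (rule polyfun_continuous)
  moreover have "((\<lambda>c. complex_of_real c) \<longlongrightarrow> complex_of_real 1) (at_left 1)"
    by (intro tendsto_of_real tendsto_ident_at)
  ultimately have "((\<lambda>c. P (complex_of_real c)) \<longlongrightarrow> P 1) (at_left 1)"
    using isCont_tendsto_compose[of 1 P "\<lambda>c. complex_of_real c" "at_left 1"] by simp
  then have "((\<lambda>c. cmod (P (complex_of_real c))) \<longlongrightarrow> cmod (P 1)) (at_left 1)" by (rule tendsto_norm)
  moreover have "eventually (\<lambda>c. \<bar>Im \<alpha>\<bar> ^ m \<le> cmod (P (complex_of_real c))) (at_left 1)"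
    using real
  proof eventually_elim
    case (elim c)
    show ?case unfolding P_def by (rule char_poly_real_spectrum_bound[of _ m]) (use elim in simp_all)
  qed
  ultimately have "\<bar>Im \<alpha>\<bar> ^ m \<le> cmod (P 1)"
    by (rule tendsto_lowerbound) simp
  moreover have "P 1 = 0"
    using ev eigenvalue_root_char_poly[of "mat m m (\<lambda>(i, j). F 1 i j)" m \<alpha>] by (simp add: P_def)
  moreover have "\<bar>Im \<alpha>\<bar> ^ m > 0" using Im by simp
  ultimately show False by simp
qed

text \<open>Enumerating the permutations gives a matrix of fixed size whose entries are polynomial
  in c, so that the characteristic polynomial is available for the limit argument.\<close>

lemma gaudin_eigenvalue_matrix:
  assumes k: "k < n"
  shows "\<exists>m F. (\<forall>i j. polyfun (\<lambda>s. F s i j)) \<and>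
    (\<forall>c \<alpha>. gaudin_eigenvalue n G \<zeta> c xs k \<alpha> \<longleftrightarrow> eigenvalue (mat m m (\<lambda>(i, j). F c i j)) \<alpha>)"
proof -
  let ?S = "{v. v permutes {..<n}}"
  have "finite ?S" by (rule finite_permutations) simp
  then obtain ps where ps: "set ps = ?S" "distinct ps" using finite_distinct_list by blast
  define m where "m = length ps"
  define \<delta> where "\<delta> j v = (of_bool (v = ps ! j) :: complex)" for j v
  define F where "F c i j = gaudin n G \<zeta> c xs k (\<delta> j) (ps ! i)" for c i j
  have pf: "polyfun (\<lambda>s. F s i j)" for i j
  proof (cases "ps ! i permutes {..<n}")
    case True
    then show ?thesis unfolding F_def gaudin_def by (simp only: if_True) (intro polyfun_intros)
  next
    case False
    then show ?thesis unfolding F_def gaudin_def by (simp only: if_False) (rule polyfun_const)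
  qed
  have pi: "ps ! i permutes {..<n}" if "i < m" for i using nth_mem[of i ps] that ps(1) by (simp add: m_def)
  have mult: "gaudin n G \<zeta> c xs k f (ps ! i) = (\<Sum>j<m. F c i j * f (ps ! j))" for c f i
  proof -
    have "f v = (\<Sum>j<m. f (ps ! j) * \<delta> j v)" if v: "v permutes {..<n}" for v
    proof -
      obtain i where i: "i < m" "v = ps ! i" using v ps(1) by (metis in_set_conv_nth m_def mem_Collect_eq)
      have "(\<Sum>j<m. f (ps ! j) * \<delta> j v) = (\<Sum>j<m. if j = i then f (ps ! j) else 0)"
        using i ps(2) by (intro sum.cong refl) (auto simp: \<delta>_def m_def nth_eq_iff_index_eq)
      then show ?thesis using i by simp
    qed
    then have "gaudin n G \<zeta> c xs k f (ps ! i) = gaudin n G \<zeta> c xs k (\<lambda>v. \<Sum>j<m. f (ps ! j) * \<delta> j v) (ps ! i)"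
      by (rule gaudin_cong[OF k])
    then show ?thesis unfolding lin_sum[OF gaudin_lin] lin_scale[OF gaudin_lin] F_def by (simp only: mult.commute)
  qed
  have "gaudin_eigenvalue n G \<zeta> c xs k \<alpha> \<longleftrightarrow> eigenvalue (mat m m (\<lambda>(i, j). F c i j)) \<alpha>" for c \<alpha>
  proof
    assume "gaudin_eigenvalue n G \<zeta> c xs k \<alpha>"
    then obtain f v where f: "v permutes {..<n}" "f v \<noteq> 0" "\<And>v. v permutes {..<n} \<Longrightarrow> gaudin n G \<zeta> c xs k f v = \<alpha> * f v"
      unfolding gaudin_eigenvalue_def by blast
    obtain i where i: "i < m" "v = ps ! i" using f(1) ps(1) by (metis in_set_conv_nth m_def mem_Collect_eq)
    define u where "u = vec m (\<lambda>i. f (ps ! i))"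
    have "u $ i \<noteq> 0" using i f(2) by (simp add: u_def)
    then have "u \<noteq> 0\<^sub>v m" using i(1) by auto
    moreover have "mat m m (\<lambda>(i, j). F c i j) *\<^sub>v u = \<alpha> \<cdot>\<^sub>v u"
    proof (rule eq_vecI)
      fix i assume "i < dim_vec (\<alpha> \<cdot>\<^sub>v u)"
      then have i: "i < m" by (simp add: u_def)
      show "(mat m m (\<lambda>(i, j). F c i j) *\<^sub>v u) $ i = (\<alpha> \<cdot>\<^sub>v u) $ i"
        using f(3)[OF pi[OF i]] i unfolding mult by (simp add: u_def scalar_prod_def atLeast0LessThan)
    qed (simp add: u_def)
    ultimately show "eigenvalue (mat m m (\<lambda>(i, j). F c i j)) \<alpha>"
      unfolding eigenvalue_def eigenvector_def by (intro exI[of _ u]) (simp add: u_def)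
  next
    assume "eigenvalue (mat m m (\<lambda>(i, j). F c i j)) \<alpha>"
    then obtain u where u: "u \<in> carrier_vec m" "u \<noteq> 0\<^sub>v m" "mat m m (\<lambda>(i, j). F c i j) *\<^sub>v u = \<alpha> \<cdot>\<^sub>v u"
      unfolding eigenvalue_def eigenvector_def by auto
    define f where "f v = (\<Sum>j<m. u $ j * \<delta> j v)" for v
    have fi: "f (ps ! i) = u $ i" if "i < m" for i
    proof -
      have "f (ps ! i) = (\<Sum>j<m. if j = i then u $ j else 0)"
        unfolding f_def using that ps(2) by (intro sum.cong refl) (auto simp: \<delta>_def m_def nth_eq_iff_index_eq)
      then show ?thesis using that by simp
    qed
    obtain i where i: "i < m" "u $ i \<noteq> 0" using u(1,2) by (metis carrier_vecD eq_vecI index_zero_vec)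
    have "gaudin n G \<zeta> c xs k f v = \<alpha> * f v" if v: "v permutes {..<n}" for v
    proof -
      obtain i where i: "i < m" "v = ps ! i" using v ps(1) by (metis in_set_conv_nth m_def mem_Collect_eq)
      have "(\<Sum>j<m. F c i j * f (ps ! j)) = (\<Sum>j<m. F c i j * u $ j)"
        by (intro sum.cong refl) (simp add: fi)
      also have "\<dots> = (mat m m (\<lambda>(i, j). F c i j) *\<^sub>v u) $ i"
        using i u(1) by (simp add: scalar_prod_def atLeast0LessThan)
      also have "\<dots> = \<alpha> * u $ i" unfolding u(3) using i u(1) by simp
      finally show ?thesis unfolding i(2) mult fi[OF i(1)] .
    qed
    then show "gaudin_eigenvalue n G \<zeta> c xs k \<alpha>"
      unfolding gaudin_eigenvalue_def using pi[OF i(1)] fi[OF i(1)] i(2) by (intro exI[of _ f]) auto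
  qed
  then show ?thesis using pf by blast
qed

section \<open>From Dunkl eigenvectors to Gaudin eigenvectors\<close>

context dunkl
begin

text \<open>At w = v^-1 the equation of the operator with index i = v k has w i = k. Its diagonal
  entry is then the fixed number \<open>a k\<close> while the eigenvalue becomes
  \<open>\<zeta> (v k)\<close>, so the two exchange roles; comparing positions i < j becomes
  comparing letters in the order \<open>[0..<n]\<close>.\<close>

lemma Y_eigen_imp_gaudin_eigenvalue:
  assumes f: "f \<noteq> (\<lambda>w. 0)" "\<And>w. \<not> w permutes {..<n} \<Longrightarrow> f w = 0"
    and ev: "\<And>i. i < n \<Longrightarrow> Y 1 a i f = (\<lambda>w. \<zeta> i * f w)" and k: "k < n"
  shows "gaudin_eigenvalue n G \<zeta> 1 [0..<n] k (a k)"
proof -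
  define h where "h v = f (inv_into UNIV v)" for v
  obtain w where w: "f w \<noteq> 0" using f(1) by auto
  then have wp: "w permutes {..<n}" using f(2) by blast
  have "h (inv_into UNIV w) \<noteq> 0" using w by (simp add: h_def permutes_inv_inv[OF wp])
  moreover have "gaudin n G \<zeta> 1 [0..<n] k h v = a k * h v" if v: "v permutes {..<n}" for v
  proof -
    let ?w = "inv_into UNIV v" and ?i = "v k"
    have wp: "?w permutes {..<n}" by (rule permutes_inv[OF v])
    have i: "?i < n" by (rule permutes_lt[OF v k])
    have wi: "?w (v l) = l" for l by (rule permutes_inverses(2)[OF v])
    have S: "(\<Sum>j\<in>{..<n} - {?i}. th ?i j ?w * f (?w \<circ> swap_ix ?i j))
      = (\<Sum>l\<in>{..<n} - {k}. (G k l + of_bool (bef [0..<n] (v k) (v l))) * h (v \<circ> swap_ix k l))"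
    proof (rule sum.reindex_bij_witness[of _ v ?w])
      fix j assume j: "j \<in> {..<n} - {?i}"
      show vw: "v (?w j) = j" by (rule permutes_inverses(1)[OF v])
      have l: "?w j < n" using permutes_lt[OF wp] j by simp
      have "?w j \<noteq> k" using j vw by auto
      then show "?w j \<in> {..<n} - {k}" using l by simp
      have "inv_into UNIV (v \<circ> swap_ix k (?w j)) = swap_ix k (?w j) \<circ> ?w"
        using o_inv_distrib[OF permutes_bij[OF v] bij_transpose[of k "?w j"]] by (simp add: inv_transpose_eq)
      also have "\<dots> = ?w \<circ> swap_ix ?i j"
        using comp_swap_eq_swap_comp[OF wp, of ?i j] by (simp add: wi)
      finally show "(G k (?w j) + of_bool (bef [0..<n] (v k) (v (?w j)))) * h (v \<circ> swap_ix k (?w j))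
        = th ?i j ?w * f (?w \<circ> swap_ix ?i j)"
        using j by (simp add: h_def th_def vw wi bef_upt)
    next
      fix l assume l: "l \<in> {..<n} - {k}"
      show "?w (v l) = l" by (rule wi)
      show "v l \<in> {..<n} - {?i}" using permutes_lt[OF v, of l] permutes_neq[OF v, of l k] l by simp
    qed
    have "Y 1 a ?i f ?w = \<zeta> ?i * f ?w" using ev[OF i] by simp
    then have "a k * h v + (\<Sum>l\<in>{..<n} - {k}. (G k l + of_bool (bef [0..<n] (v k) (v l))) * h (v \<circ> swap_ix k l)) = \<zeta> ?i * h v"
      unfolding Y_def S using wp by (simp add: wi h_def)
    then show ?thesis using v by (simp add: gaudin_def algebra_simps)
  qed
  ultimately show ?thesis unfolding gaudin_eigenvalue_def using permutes_inv[OF wp] by blast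
qed

end

lemma trigG_dunkl:
  assumes Q: "inj_on Q {..<n}"
  shows "dunkl n (trigG Q)"
proof
  have ne: "Q y - Q x \<noteq> 0" if "x < n" "y < n" "x \<noteq> y" for x y
    using Q that by (auto simp: inj_on_def)
  fix x y assume xy: "x < n" "y < n" "x \<noteq> y"
  have "Q y / (Q x - Q y) = - 1 - Q x / (Q y - Q x)"
    using ne[OF xy] ne[OF xy(2,1)] xy by (simp add: field_simps)
  from arg_cong[OF this, of complex_of_real]
  show "complex_of_real (Q y / (Q x - Q y)) = - 1 - complex_of_real (Q x / (Q y - Q x))"
    by (simp only: of_real_diff of_real_minus of_real_1)
  fix w assume w: "w < n" "x \<noteq> w" "y \<noteq> w"
  have "Q x / (Q y - Q x) * (Q x / (Q w - Q x)) + Q x / (Q w - Q x) * (Q y / (Q w - Q y)) + Q x / (Q w - Q x)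
    = Q y / (Q w - Q y) * (Q x / (Q y - Q x))"
  proof -
    \<comment> \<open>Here A = Q y - Q x and B = Q w - Q x, so that B - A = Q w - Q y.\<close>
    have id: "X / A * (X / B) + X / B * (Y / (B - A)) + X / B = Y / (B - A) * (X / A)"
      if "A \<noteq> 0" "B \<noteq> 0" "B - A \<noteq> 0" "Y = X + A" for X Y A B :: real
    proof -
      have "X / A * (X / B) + X / B * (Y / (B - A)) + X / B = (X * X * (B - A) + X * Y * A + X * A * (B - A)) / (A * B * (B - A))"
        using that(1-3) by (simp add: add_divide_distrib)
      also have "X * X * (B - A) + X * Y * A + X * A * (B - A) = Y * X * B" unfolding that(4) by (simp add: algebra_simps)
      also have "Y * X * B / (A * B * (B - A)) = Y / (B - A) * (X / A)" using that(1-3) by simp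
      finally show ?thesis .
    qed
    have "Q w - Q x - (Q y - Q x) = Q w - Q y" by simp
    then show ?thesis
      using id[of "Q y - Q x" "Q w - Q x" "Q y" "Q x"] ne[OF xy] ne[of x w] ne[of y w] xy w by simp
  qed
  from arg_cong[OF this, of complex_of_real]
  show "complex_of_real (Q x / (Q y - Q x)) * complex_of_real (Q x / (Q w - Q x))
    + complex_of_real (Q x / (Q w - Q x)) * complex_of_real (Q y / (Q w - Q y)) + complex_of_real (Q x / (Q w - Q x))
    = complex_of_real (Q y / (Q w - Q y)) * complex_of_real (Q x / (Q y - Q x))"
    by (simp only: of_real_add of_real_mult)
qed

text \<open>For c slightly below 1, an eigenvalue for the natural order is also one for
  \<open>us @ vs\<close> by reordering, and that one is real. The order must be changed before the
  limit, since R-matrices between the groups may be singular at c = 1.\<close>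

lemma gaudin_eigenvalue_real_limit:
  assumes Q: "inj_on Q {..<n}" and k: "k < n" and z: "\<And>i. i < n \<Longrightarrow> \<zeta> i \<in> \<real>"
    and dist: "distinct (us @ vs)" and set: "set us \<union> set vs = {..<n}"
    and q: "us = [] \<or> (\<forall>k<n. \<forall>l<n. q k * Q l = q l * Q k)" and qpos: "\<And>i. i < n \<Longrightarrow> q i > 0"
    and sep: "\<And>i j. i \<noteq> j \<Longrightarrow> i \<in> set us \<and> j \<in> set us \<or> i \<in> set vs \<and> j \<in> set vs \<Longrightarrow> cmod (\<zeta> i - \<zeta> j) \<ge> 1"
    and ev: "gaudin_eigenvalue n (trigG Q) \<zeta> 1 [0..<n] k \<alpha>"
  shows "\<alpha> \<in> \<real>"
proof -
  obtain m F where F: "\<And>i j. polyfun (\<lambda>s. F s i j)"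
    "\<And>c \<alpha>. gaudin_eigenvalue n (trigG Q) \<zeta> c [0..<n] k \<alpha> \<longleftrightarrow> eigenvalue (mat m m (\<lambda>(i, j). F c i j)) \<alpha>"
    using gaudin_eigenvalue_matrix[OF k, of "trigG Q" \<zeta> "[0..<n]"] by blast
  show ?thesis
  proof (rule eigenvalue_limit_real[of m F])
    show "eigenvalue (mat m m (\<lambda>(i, j). F 1 i j)) \<alpha>" using ev unfolding F(2) .
    \<comment> \<open>The finitely many couplings at which some R-matrix used for reordering could
      be singular; a left neighbourhood of 1 avoids them, even if 1 itself belongs to
      \<open>E\<close>.\<close>
    define E where "E = (\<lambda>(i, j). cmod (\<zeta> i - \<zeta> j)) ` ({..<n} \<times> {..<n})"
    have "eventually (\<lambda>c. c \<noteq> e \<or> e = 1) (at_left (1::real))" for e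
    proof (cases "e = 1")
      case False
      then show ?thesis using t1_space_nhds[of 1 e] eventually_at_filter
        by (auto simp: eventually_at_filter elim!: eventually_mono)
    qed simp
    moreover have "eventually (\<lambda>c. c \<noteq> 1) (at_left (1::real))" by (simp add: eventually_at_filter)
    ultimately have "eventually (\<lambda>c. c \<noteq> e) (at_left (1::real))" for e
      by (metis (mono_tags, lifting) eventually_mono)
    then have "eventually (\<lambda>c. \<forall>e\<in>E. c \<noteq> e) (at_left (1::real))"
      by (intro eventually_ball_finite) (auto simp: E_def)
    moreover have "eventually (\<lambda>c. c \<in> {0<..<1}) (at_left (1::real))"
      by (rule eventually_at_leftI[of 0]) auto
    ultimately show "eventually (\<lambda>c. \<forall>e. eigenvalue (mat m m (\<lambda>(i, j). F (of_real c) i j)) e \<longrightarrow> e \<in> \<real>) (at_left 1)"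
    proof eventually_elim
      case (elim c)
      then have c: "0 < c" "c < 1" by auto
      show ?case
      proof (intro allI impI)
        fix e assume "eigenvalue (mat m m (\<lambda>(i, j). F (of_real c) i j)) e"
        then have "gaudin_eigenvalue n (trigG Q) \<zeta> (complex_of_real c) [0..<n] k e" unfolding F(2) .
        then have good: "gaudin_eigenvalue n (trigG Q) \<zeta> (complex_of_real c) (us @ vs) k e"
        proof (rule gaudin_eigenvalue_reorder[rotated -1])
          fix i j assume ij: "i < n" "j < n" "i \<noteq> j"
          show "(\<zeta> i - \<zeta> j)\<^sup>2 \<noteq> (complex_of_real c)\<^sup>2"
          proof
            assume "(\<zeta> i - \<zeta> j)\<^sup>2 = (complex_of_real c)\<^sup>2"
            then have "\<zeta> i - \<zeta> j = of_real c \<or> \<zeta> i - \<zeta> j = - of_real c" by (simp add: power2_eq_iff)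
            then have "cmod (\<zeta> i - \<zeta> j) = c" using c(1) by (metis norm_minus_cancel norm_of_real abs_of_pos)
            moreover have "cmod (\<zeta> i - \<zeta> j) \<in> E" using ij by (auto simp: E_def)
            ultimately show False using elim(1) by blast
          qed
        next
          show "distinct (us @ vs)" by (rule dist)
          show "set (us @ vs) = {..<n}" using set by simp
        qed (use k in auto)
        show "e \<in> \<real>"
          by (rule gaudin_eigenvalue_real[OF Q k z dist set q qpos sep less_imp_le[OF c(1)] c(2) good])
      qed
    qed
  qed (rule F(1))
qed

lemma linear_factors_unique:
  fixes \<zeta> z :: "nat \<Rightarrow> complex"
  assumes "(\<Prod>i<n. [:- \<zeta> i, 1:]) = (\<Prod>i<n. [:- z i, 1:])"
  shows "\<exists>p. p permutes {..<n} \<and> (\<forall>i<n. \<zeta> i = z (p i))"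
proof -
  have pr: "proots (\<Prod>i<n. [:- \<zeta> i, 1:]) = image_mset \<zeta> (mset_set {..<n})" for \<zeta> :: "nat \<Rightarrow> complex"
  proof -
    have "proots (\<Prod>i<n. [:- \<zeta> i, 1:]) = (\<Sum>i<n. proots [:- \<zeta> i, 1:])" by (rule proots_prod) simp
    also have "\<dots> = (\<Sum>i<n. {#\<zeta> i#})" by (intro sum.cong refl) (simp add: proots_linear_factor)
    also have "\<dots> = image_mset \<zeta> (mset_set {..<n})" by (induction n) (simp_all add: lessThan_Suc)
    finally show ?thesis .
  qed
  have "image_mset \<zeta> (mset_set {..<n}) = image_mset z (mset_set {..<n})"
    using arg_cong[OF assms, of proots] unfolding pr .
  from image_mset_eq_implies_permutes[OF finite_lessThan this]
  obtain p where "p permutes {..<n}" "\<forall>i\<in>{..<n}. \<zeta> i = z (p i)" .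
  then show ?thesis by blast
qed

text \<open>The joint eigenvector yields the eigenvalues in an order \<open>\<zeta>\<close> that
  differs from \<open>z\<close> by an unknown permutation p. The groups of letters are therefore the
  preimages under p of \<open>I\<close> and its complement.\<close>

lemma real_diagonal:
  assumes Q: "inj_on Q {..<N}" and ev: "lists_eigenvalues N (Zd N Q a) z" and z: "\<forall>i<N. z i \<in> \<real>"
    and q: "I = {} \<or> (\<forall>k<N. \<forall>l<N. q k * Q l = q l * Q k)" and qpos: "\<And>i. i < N \<Longrightarrow> q i > 0"
    and sep: "\<forall>i<N. \<forall>j<N. i \<noteq> j \<and> (i \<in> I \<and> j \<in> I \<or> i \<notin> I \<and> j \<notin> I) \<longrightarrow> cmod (z i - z j) \<ge> 1"
    and k: "k < N"
  shows "a k \<in> \<real>"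
proof -
  interpret dunkl N "trigG Q" by (rule trigG_dunkl[OF Q])
  obtain f \<zeta> where f: "f \<noteq> (\<lambda>w. 0)" "\<forall>w. \<not> w permutes {..<N} \<longrightarrow> f w = 0"
    "\<forall>i<N. Y 1 a i f = (\<lambda>w. \<zeta> i * f w)" "char_poly (Zmat 1 a) = (\<Prod>i<N. [:- \<zeta> i, 1:])"
    using eigenvalues_as_weights[of a] by blast
  have "Zmat 1 a = Zd N Q a" by (simp only: Zmat_def Zd_def mult_1)
  then have "(\<Prod>i<N. [:- \<zeta> i, 1:]) = (\<Prod>i<N. [:- z i, 1:])"
    using ev f(4) by (simp add: lists_eigenvalues_def)
  then obtain p where p: "p permutes {..<N}" "\<And>i. i < N \<Longrightarrow> \<zeta> i = z (p i)"
    using linear_factors_unique by blast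
  define us where "us = filter (\<lambda>i. p i \<in> I) [0..<N]"
  define vs where "vs = filter (\<lambda>i. p i \<notin> I) [0..<N]"
  have us: "i \<in> set us \<longleftrightarrow> i < N \<and> p i \<in> I" and vs: "i \<in> set vs \<longleftrightarrow> i < N \<and> p i \<notin> I" for i
    by (auto simp: us_def vs_def)
  show ?thesis
  proof (rule gaudin_eigenvalue_real_limit[OF Q k, of \<zeta> us vs q])
    show "\<zeta> i \<in> \<real>" if "i < N" for i using z p permutes_lt[OF p(1) that] that by simp
    show "distinct (us @ vs)" using us vs by (auto simp: us_def vs_def)
    show "set us \<union> set vs = {..<N}" using us vs by auto
    show "us = [] \<or> (\<forall>k<N. \<forall>l<N. q k * Q l = q l * Q k)" using q by (auto simp: us_def)
    show "cmod (\<zeta> i - \<zeta> j) \<ge> 1"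
      if "i \<noteq> j" "i \<in> set us \<and> j \<in> set us \<or> i \<in> set vs \<and> j \<in> set vs" for i j
    proof -
      have ij: "i < N" "j < N" "p i \<in> I \<and> p j \<in> I \<or> p i \<notin> I \<and> p j \<notin> I" using that us vs by blast+
      have "p i < N" "p j < N" "p i \<noteq> p j"
        using permutes_lt[OF p(1)] permutes_neq[OF p(1) that(1)] ij by simp_all
      then show ?thesis using sep ij p(2) by simp
    qed
    show "gaudin_eigenvalue N (trigG Q) \<zeta> 1 [0..<N] k (a k)"
      by (rule Y_eigen_imp_gaudin_eigenvalue[OF f(1)]) (use f(2,3) k in simp_all)
  qed (rule qpos)
qed

theorem theorem6p2:
  fixes N :: nat and Q :: "nat \<Rightarrow> real" and a z :: "nat \<Rightarrow> complex"
  assumes "N \<ge> 2"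
    and "inj_on Q {..<N}"
    and "\<forall>i<N. Q i \<noteq> 0"
    and "lists_eigenvalues N (Zd N Q a) z"
    and "\<forall>i<N. z i \<in> \<real>"
  shows "((\<forall>i<N. \<forall>j<N. i \<noteq> j \<longrightarrow> cmod (z i - z j) \<ge> 1) \<longrightarrow> (\<forall>i<N. a i \<in> \<real>))
    \<and> (((\<forall>i<N. Q i > 0) \<or> (\<forall>i<N. Q i < 0)) \<and>
       (\<exists>I \<subseteq> {..<N}. \<forall>i<N. \<forall>j<N. i \<noteq> j \<and> (i \<in> I \<and> j \<in> I \<or> i \<notin> I \<and> j \<notin> I)
          \<longrightarrow> cmod (z i - z j) \<ge> 1)
       \<longrightarrow> (\<forall>i<N. a i \<in> \<real>))"
proof (intro conjI impI)
  assume "\<forall>i<N. \<forall>j<N. i \<noteq> j \<longrightarrow> cmod (z i - z j) \<ge> 1"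
  \<comment> \<open>With \<open>I\<close> empty there is a single group and the weight is constantly
    1.\<close>
  then show "\<forall>i<N. a i \<in> \<real>"
    using real_diagonal[OF assms(2,4,5), of "{}" "\<lambda>_. 1"] by simp
next
  assume "((\<forall>i<N. Q i > 0) \<or> (\<forall>i<N. Q i < 0)) \<and>
       (\<exists>I \<subseteq> {..<N}. \<forall>i<N. \<forall>j<N. i \<noteq> j \<and> (i \<in> I \<and> j \<in> I \<or> i \<notin> I \<and> j \<notin> I)
          \<longrightarrow> cmod (z i - z j) \<ge> 1)"
  then obtain I where sgn: "(\<forall>i<N. Q i > 0) \<or> (\<forall>i<N. Q i < 0)"
    and I: "\<forall>i<N. \<forall>j<N. i \<noteq> j \<and> (i \<in> I \<and> j \<in> I \<or> i \<notin> I \<and> j \<notin> I) \<longrightarrow> cmod (z i - z j) \<ge> 1"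
    by blast
  \<comment> \<open>The weight must be positive and proportional to \<open>Q\<close>; equal signs
    make |Q| such a choice.\<close>
  have "\<bar>Q k\<bar> * Q l = \<bar>Q l\<bar> * Q k" if "k < N" "l < N" for k l
    using sgn
  proof
    assume "\<forall>i<N. Q i > 0"
    then have "Q k > 0" "Q l > 0" using that by blast+
    then show ?thesis by simp
  next
    assume "\<forall>i<N. Q i < 0"
    then have "Q k < 0" "Q l < 0" using that by blast+
    then show ?thesis by simp
  qed
  moreover have "\<bar>Q i\<bar> > 0" if "i < N" for i using assms(3) that by simp
  ultimately show "\<forall>i<N. a i \<in> \<real>"
    using real_diagonal[OF assms(2,4,5), of I "\<lambda>k. \<bar>Q k\<bar>"] I by blast
qed

end
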